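(* Let $\Gamma$ be a connected $4$-valent half-arc-transitive graph of order $p^n$ for some odd prime $p$ and some positive integer $n$. Then $\Gamma$ is a weak metacirculant if and only if $\Gamma$ is a metacirculant.
   Context: All groups and graphs are finite; graphs are simple and undirected. A graph is half-arc-transitive if its automorphism group is transitive on vertices and on edges but not on arcs (ordered pairs of adjacent vertices). For positive integers $m,r$, an $(m,r)$-metacirculant is a graph $\Gamma$ of order $mr$ that admits an automorphism $\sigma$ of order $r$ such that $\langle\sigma\rangle$ is semi-regular on $V(\Gamma)$ (all vertex stabilisers in $\langle\sigma\rangle$ are trivial), and an automorphism $\tau$ normalising $\langle\sigma\rangle$ such that $\tau$ has a cycle of size $m$ on $V(\Gamma)$ and cyclically permutes the $m$ orbits of $\langle\sigma\rangle$. A metacirculant is an $(m,r)$-metacirculant for some $m,r$. A group $G$ is metacyclic if it has a normal subgroup $N$ with both $N$ and $G/N$ cyclic. A graph is a weak metacirculant if it admits a metacyclic group of automorphisms acting transitively on its vertices. *)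

theory Defs
  imports
    "HOL-Algebra.Group_Action"
    "HOL-Algebra.Elementary_Groups"
    "HOL-Algebra.Multiplicative_Group"
    "Graph_Theory.Digraph_Component"
    "HOL-Combinatorics.Orbits"
    "HOL-Computational_Algebra.Primes"
begin

text \<open>Finite simple undirected graphs are modelled by the locale \<^locale>\<open>pair_graph\<close>: finite
  loop-free symmetric digraphs whose arcs are ordered pairs of vertices, so an undirected edge is
  represented by its two arcs.\<close>

definition edges :: "'a pair_pre_digraph \<Rightarrow> 'a set set" where
  "edges \<Gamma> = {{u, v} | u v. (u, v) \<in> parcs \<Gamma>}"

definition automorphisms :: "'a pair_pre_digraph \<Rightarrow> ('a \<Rightarrow> 'a) set" where
  "automorphisms \<Gamma> = {f \<in> Bij (pverts \<Gamma>).
     \<forall>u\<in>pverts \<Gamma>. \<forall>v\<in>pverts \<Gamma>. (f u, f v) \<in> parcs \<Gamma> \<longleftrightarrow> (u, v) \<in> parcs \<Gamma>}"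

definition Aut :: "'a pair_pre_digraph \<Rightarrow> ('a \<Rightarrow> 'a) monoid" where
  "Aut \<Gamma> = BijGroup (pverts \<Gamma>) \<lparr>carrier := automorphisms \<Gamma>\<rparr>"

text \<open>The induced maps are restricted to the set acted upon because the library's
  \<^const>\<open>BijGroup\<close> consists of extensional functions.\<close>

definition edge_action :: "'a pair_pre_digraph \<Rightarrow> ('a \<Rightarrow> 'a) \<Rightarrow> 'a set \<Rightarrow> 'a set" where
  "edge_action \<Gamma> f = (\<lambda>e\<in>edges \<Gamma>. f ` e)"

definition arc_action :: "'a pair_pre_digraph \<Rightarrow> ('a \<Rightarrow> 'a) \<Rightarrow> 'a \<times> 'a \<Rightarrow> 'a \<times> 'a" where
  "arc_action \<Gamma> f = (\<lambda>a\<in>parcs \<Gamma>. map_prod f f a)"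

definition half_arc_transitive :: "'a pair_pre_digraph \<Rightarrow> bool" where
  "half_arc_transitive \<Gamma> \<longleftrightarrow>
     transitive_action (Aut \<Gamma>) (pverts \<Gamma>) (\<lambda>f. f) \<and>
     transitive_action (Aut \<Gamma>) (edges \<Gamma>) (edge_action \<Gamma>) \<and>
     \<not> transitive_action (Aut \<Gamma>) (parcs \<Gamma>) (arc_action \<Gamma>)"

definition semiregular :: "('a \<Rightarrow> 'a) monoid \<Rightarrow> 'a set \<Rightarrow> bool" where
  "semiregular H V \<longleftrightarrow> (\<forall>v\<in>V. stabilizer H (\<lambda>f. f) v = {\<one>\<^bsub>H\<^esub>})"

text \<open>In the last two conjuncts, \<^term>\<open>cyclic_on f S\<close> says that \<^term>\<open>S\<close> is a single
  cycle of \<^term>\<open>f\<close>: first for \<^term>\<open>\<tau>\<close> on vertices, then for the map induced by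
  \<^term>\<open>\<tau>\<close> on vertex sets.\<close>

definition mr_metacirculant :: "nat \<Rightarrow> nat \<Rightarrow> 'a pair_pre_digraph \<Rightarrow> bool" where
  "mr_metacirculant m r \<Gamma> \<longleftrightarrow>
     0 < m \<and> 0 < r \<and> card (pverts \<Gamma>) = m * r \<and>
     (\<exists>\<sigma>\<in>carrier (Aut \<Gamma>). \<exists>\<tau>\<in>carrier (Aut \<Gamma>).
        let S = subgroup_generated (Aut \<Gamma>) {\<sigma>} in
          group.ord (Aut \<Gamma>) \<sigma> = r \<and>
          semiregular S (pverts \<Gamma>) \<and>
          \<tau> \<in> normalizer (Aut \<Gamma>) (carrier S) \<and>
          (\<exists>C\<subseteq>pverts \<Gamma>. cyclic_on \<tau> C \<and> card C = m) \<and>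
          cyclic_on (\<lambda>B. \<tau> ` B) (orbits S (pverts \<Gamma>) (\<lambda>f. f)))"

definition metacirculant :: "'a pair_pre_digraph \<Rightarrow> bool" where
  "metacirculant \<Gamma> \<longleftrightarrow> (\<exists>m r. mr_metacirculant m r \<Gamma>)"

definition metacyclic_group :: "('g, 'b) monoid_scheme \<Rightarrow> bool" where
  "metacyclic_group G \<longleftrightarrow> group G \<and>
     (\<exists>N. N \<lhd> G \<and> cyclic_group (G\<lparr>carrier := N\<rparr>) \<and> cyclic_group (G Mod N))"

definition weak_metacirculant :: "'a pair_pre_digraph \<Rightarrow> bool" where
  "weak_metacirculant \<Gamma> \<longleftrightarrow>
     (\<exists>H. subgroup H (Aut \<Gamma>) \<and> metacyclic_group (Aut \<Gamma>\<lparr>carrier := H\<rparr>) \<and>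
        transitive_action (Aut \<Gamma>\<lparr>carrier := H\<rparr>) (pverts \<Gamma>) (\<lambda>f. f))"

lemma automorphisms_subgroup: "subgroup (automorphisms \<Gamma>) (BijGroup (pverts \<Gamma>))"
proof -
  interpret B: group "BijGroup (pverts \<Gamma>)" by (rule group_BijGroup)
  show ?thesis
  proof (rule B.subgroupI)
    show "automorphisms \<Gamma> \<subseteq> carrier (BijGroup (pverts \<Gamma>))"
      by (auto simp: automorphisms_def BijGroup_def)
    have "(\<lambda>x\<in>pverts \<Gamma>. x) \<in> automorphisms \<Gamma>"
      by (auto simp: automorphisms_def id_Bij)
    then show "automorphisms \<Gamma> \<noteq> {}" by blast
  next
    fix f assume f: "f \<in> automorphisms \<Gamma>"
    then have b: "f \<in> Bij (pverts \<Gamma>)" by (simp add: automorphisms_def)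
    then have bb: "bij_betw f (pverts \<Gamma>) (pverts \<Gamma>)" by (simp add: Bij_def)
    let ?g = "\<lambda>x\<in>pverts \<Gamma>. inv_into (pverts \<Gamma>) f x"
    have "(?g u, ?g v) \<in> parcs \<Gamma> \<longleftrightarrow> (u, v) \<in> parcs \<Gamma>"
      if "u \<in> pverts \<Gamma>" "v \<in> pverts \<Gamma>" for u v
    proof -
      have "inv_into (pverts \<Gamma>) f u \<in> pverts \<Gamma>" "inv_into (pverts \<Gamma>) f v \<in> pverts \<Gamma>"
        using bb that by (auto simp: bij_betw_def intro: inv_into_into)
      moreover have "f (inv_into (pverts \<Gamma>) f u) = u" "f (inv_into (pverts \<Gamma>) f v) = v"
        using bb that by (auto simp: bij_betw_def intro: f_inv_into_f)
      ultimately show ?thesis using f that by (force simp: automorphisms_def)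
    qed
    then show "inv\<^bsub>BijGroup (pverts \<Gamma>)\<^esub> f \<in> automorphisms \<Gamma>"
      using b by (simp add: inv_BijGroup automorphisms_def restrict_inv_into_Bij)
  next
    fix f g assume fg: "f \<in> automorphisms \<Gamma>" "g \<in> automorphisms \<Gamma>"
    then have "f \<in> Bij (pverts \<Gamma>)" "g \<in> Bij (pverts \<Gamma>)" by (auto simp: automorphisms_def)
    moreover from this have "\<And>u. u \<in> pverts \<Gamma> \<Longrightarrow> g u \<in> pverts \<Gamma>"
      by (auto dest: Bij_imp_funcset)
    ultimately show "f \<otimes>\<^bsub>BijGroup (pverts \<Gamma>)\<^esub> g \<in> automorphisms \<Gamma>"
      using fg by (auto simp: BijGroup_def automorphisms_def compose_Bij compose_eq)
  qed
qed

lemma group_Aut: "group (Aut \<Gamma>)"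
  unfolding Aut_def
  by (rule subgroup.subgroup_is_group[OF automorphisms_subgroup group_BijGroup])

lemma Aut_simps:
  "carrier (Aut \<Gamma>) = automorphisms \<Gamma>"
  "\<one>\<^bsub>Aut \<Gamma>\<^esub> = (\<lambda>x\<in>pverts \<Gamma>. x)"
  "\<lbrakk>f \<in> automorphisms \<Gamma>; g \<in> automorphisms \<Gamma>\<rbrakk> \<Longrightarrow> f \<otimes>\<^bsub>Aut \<Gamma>\<^esub> g = compose (pverts \<Gamma>) f g"
  by (auto simp: Aut_def BijGroup_def automorphisms_def)

lemma Aut_induced_action:
  assumes "\<And>f. f \<in> automorphisms \<Gamma> \<Longrightarrow> \<phi> f \<in> extensional E"
    and maps: "\<And>f x. f \<in> automorphisms \<Gamma> \<Longrightarrow> x \<in> E \<Longrightarrow> \<phi> f x \<in> E"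
    and one: "\<And>x. x \<in> E \<Longrightarrow> \<phi> \<one>\<^bsub>Aut \<Gamma>\<^esub> x = x"
    and mult: "\<And>f g x. \<lbrakk>f \<in> automorphisms \<Gamma>; g \<in> automorphisms \<Gamma>; x \<in> E\<rbrakk>
      \<Longrightarrow> \<phi> (compose (pverts \<Gamma>) f g) x = \<phi> f (\<phi> g x)"
  shows "group_action (Aut \<Gamma>) E \<phi>"
proof -
  interpret A: group "Aut \<Gamma>" by (rule group_Aut)
  have B: "\<phi> f \<in> Bij E" if f: "f \<in> automorphisms \<Gamma>" for f
  proof -
    define g where "g = inv\<^bsub>Aut \<Gamma>\<^esub> f"
    have g: "g \<in> automorphisms \<Gamma>" using f A.inv_closed by (simp add: g_def Aut_simps)
    have 1: "compose (pverts \<Gamma>) f g = \<one>\<^bsub>Aut \<Gamma>\<^esub>" "compose (pverts \<Gamma>) g f = \<one>\<^bsub>Aut \<Gamma>\<^esub>"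
      using f g A.r_inv[of f] A.l_inv[of f] by (simp_all add: g_def Aut_simps)
    have "bij_betw (\<phi> f) E E"
      by (rule bij_betw_byWitness[where f' = "\<phi> g"])
        (use f g 1 maps one mult[OF f g] mult[OF g f] in auto)
    then show ?thesis using assms(1)[OF f] by (simp add: Bij_def)
  qed
  have "\<phi> \<in> hom (Aut \<Gamma>) (BijGroup E)"
  proof (rule homI)
    fix f assume "f \<in> carrier (Aut \<Gamma>)"
    then show "\<phi> f \<in> carrier (BijGroup E)" using B by (simp add: Aut_simps BijGroup_def)
  next
    fix f g assume "f \<in> carrier (Aut \<Gamma>)" "g \<in> carrier (Aut \<Gamma>)"
    then have fg: "f \<in> automorphisms \<Gamma>" "g \<in> automorphisms \<Gamma>" by (simp_all add: Aut_simps)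
    then have c: "compose (pverts \<Gamma>) f g \<in> automorphisms \<Gamma>"
      using A.m_closed[of f g] by (simp add: Aut_simps)
    have "\<phi> (compose (pverts \<Gamma>) f g) = compose E (\<phi> f) (\<phi> g)"
      by (rule extensionalityI[where A = E])
        (use assms(1)[OF c] fg mult in \<open>auto simp: compose_eq\<close>)
    then show "\<phi> (f \<otimes>\<^bsub>Aut \<Gamma>\<^esub> g) = \<phi> f \<otimes>\<^bsub>BijGroup E\<^esub> \<phi> g"
      using fg B by (simp add: Aut_simps BijGroup_def)
  qed
  then show ?thesis
    unfolding group_action_def group_hom_def group_hom_axioms_def
    using group_Aut group_BijGroup by blast
qed

lemma automorphism_vertex: "\<lbrakk>f \<in> automorphisms \<Gamma>; v \<in> pverts \<Gamma>\<rbrakk> \<Longrightarrow> f v \<in> pverts \<Gamma>"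
  by (auto simp: automorphisms_def dest: Bij_imp_funcset)

lemma vertex_group_action: "group_action (Aut \<Gamma>) (pverts \<Gamma>) (\<lambda>f. f)"
  by (rule Aut_induced_action)
    (auto simp: automorphism_vertex Aut_simps compose_eq automorphisms_def Bij_imp_extensional
      dest: Bij_imp_funcset)

lemma (in pair_wf_digraph) edge_group_action: "group_action (Aut G) (edges G) (edge_action G)"
proof (rule Aut_induced_action)
  fix f e assume f: "f \<in> automorphisms G" and e: "e \<in> edges G"
  from e obtain u v where uv: "e = {u, v}" "(u, v) \<in> parcs G" by (auto simp: edges_def)
  then have "(f u, f v) \<in> parcs G"
    using f wellformed'[OF uv(2)] by (auto simp: automorphisms_def)
  then show "edge_action G f e \<in> edges G"
    using e uv(1) by (auto simp: edge_action_def edges_def)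
next
  fix e assume e: "e \<in> edges G"
  then have "e \<subseteq> pverts G" by (auto simp: edges_def dest: wellformed')
  then show "edge_action G \<one>\<^bsub>Aut G\<^esub> e = e" using e by (auto simp: edge_action_def Aut_simps)
next
  fix f g e assume fg: "f \<in> automorphisms G" "g \<in> automorphisms G" and e: "e \<in> edges G"
  from e obtain u v where uv: "e = {u, v}" "(u, v) \<in> parcs G" by (auto simp: edges_def)
  then have "(g u, g v) \<in> parcs G"
    using fg wellformed'[OF uv(2)] by (auto simp: automorphisms_def)
  then have "g ` e \<in> edges G" using uv(1) by (auto simp: edges_def)
  then show "edge_action G (compose (pverts G) f g) e = edge_action G f (edge_action G g e)"
    using e uv wellformed'[OF uv(2)] by (simp add: edge_action_def compose_eq)
qed (simp add: edge_action_def)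

lemma (in pair_wf_digraph) arc_group_action: "group_action (Aut G) (parcs G) (arc_action G)"
proof -
  have arc: "(f u, f v) \<in> parcs G" if "f \<in> automorphisms G" "(u, v) \<in> parcs G" for f u v
    using that wellformed'[OF that(2)] by (auto simp: automorphisms_def)
  show ?thesis
    by (rule Aut_induced_action)
      (auto simp: arc_action_def Aut_simps compose_eq arc wellformed')
qed

end

theory Submission
  imports
    Defs
    "HOL-Algebra.Sylow"
    "HOL-Algebra.Zassenhaus"
    "HOL-Number_Theory.Residues"
begin

text \<open>
A metacirculant admits the vertex-transitive metacyclic group generated by \<open>\<sigma>\<close> and \<open>\<tau>\<close>, so the
content lies in the converse.

Half-arc-transitivity orients the edges: one of the two orbits of \<open>Aut \<Gamma>\<close> on arcs is a
digraph of in- and out-valency two. An automorphism of odd order that fixes a vertex fixes both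
out-neighbours and both in-neighbours of it, hence, by connectedness, everything
(\<open>odd_order_stabiliser_trivial\<close>). So the stabiliser \<open>T\<close> of a base vertex has order prime
to \<open>p\<close>, and a subgroup \<open>P\<close> of order \<open>p ^ n\<close> of the given metacyclic group is metacyclic and
regular on vertices. Thus \<open>Aut \<Gamma> = T P\<close> with \<open>T \<inter> P = 1\<close>. Let \<open>a\<close> and \<open>b\<close> be the elements
of \<open>P\<close> that carry the base vertex to its two out-neighbours. Connectedness says that they generate
\<open>P\<close>, and transitivity on oriented arcs that \<open>T a T\<close> contains \<open>b\<close>.

It is enough to write \<open>P\<close> as a product of a cyclic normal subgroup \<open>\<langle>d\<rangle>\<close> and a cyclic subgroup
\<open>\<langle>c\<rangle>\<close> that meet trivially: then \<open>\<sigma> = d\<close> and \<open>\<tau> = c\<close> show that \<open>\<Gamma>\<close> is a metacirculant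
(\<open>split_regular_imp_metacirculant\<close>). There are three cases.

If \<open>b\<close> generates \<open>P\<close>, take \<open>d = b\<close> and \<open>c = 1\<close>. If a nontrivial element of \<open>T\<close> normalises \<open>P\<close>, it must
interchange \<open>a\<close> and \<open>b\<close>; and a metacyclic \<open>p\<close>-group, \<open>p\<close> odd, with two generators that are swapped
by an automorphism splits (\<open>swap_automorphism_split\<close>).

If \<open>b\<close> does not generate \<open>P\<close> and only the identity of \<open>T\<close> normalises \<open>P\<close>, transfer leads to a contradiction. For a
character \<open>\<nu>\<close> of \<open>P\<close> with values in the \<open>p\<close>-th roots of unity let \<open>V\<close> be its transfer to
\<open>Aut \<Gamma>\<close>. On \<open>P\<close>, \<open>V u = 1\<close> implies \<open>\<nu> u = 1\<close> (\<open>transfer_character\<close>). But \<open>V\<close> is trivial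
on \<open>T\<close>, so \<open>V a = V b\<close> because \<open>b\<close> lies in \<open>T a T\<close>, and therefore \<open>\<nu> a = \<nu> b\<close> for every
\<open>\<nu>\<close>. If \<open>\<nu>\<close> is a nontrivial character that is trivial on the proper subgroup \<open>\<langle>b\<rangle>\<close>, then
\<open>\<nu>\<close> is trivial on both generators of \<open>P\<close>, which is absurd.

What makes both the transfer argument and the splitting work is one computation in a metacyclic
\<open>p\<close>-group with \<open>p\<close> odd: the product of a character of a normal subgroup over \<open>p\<close> consecutive
conjugates by powers of one element is trivial (\<open>character_norm_trivial\<close>). The commutator of that
element with the argument lies in a cyclic normal subgroup on which the character is invariant, so
the values form a geometric progression whose exponents sum to \<open>p (p - 1) / 2\<close>, a multiple of \<open>p\<close>.
\<close>

section \<open>Groups and group actions\<close>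

lemma (in group) inv_mult_cancel:
  assumes "x \<in> carrier G" "y \<in> carrier G"
  shows "inv x \<otimes> (x \<otimes> y) = y" and "x \<otimes> (inv x \<otimes> y) = y"
  using assms by (simp_all flip: m_assoc)

lemma (in group) conj_pow:
  assumes "g \<in> carrier G" "u \<in> carrier G"
  shows "g \<otimes> u [^] (k::nat) \<otimes> inv g = (g \<otimes> u \<otimes> inv g) [^] k"
proof (induction k)
  case (Suc k)
  have "g \<otimes> u [^] Suc k \<otimes> inv g = (g \<otimes> u [^] k \<otimes> inv g) \<otimes> (g \<otimes> u \<otimes> inv g)"
    using assms by (simp add: m_assoc inv_mult_cancel)
  then show ?case using Suc by simp
qed (use assms in simp)

text \<open>In a finite group a conjugation that maps a subgroup into itself maps it onto itself, so the
elements with this property are closed under inverses and it is enough to test generators.\<close>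

lemma (in group) normal_if_generators_normalise:
  assumes fin: "finite (carrier G)" and M: "subgroup M G" and S: "S \<subseteq> carrier G" "generate G S = carrier G"
    and conj: "\<And>s m. s \<in> S \<Longrightarrow> m \<in> M \<Longrightarrow> s \<otimes> m \<otimes> inv s \<in> M"
  shows "M \<lhd> G"
proof (rule normal_invI[OF M])
  interpret M: subgroup M G by (rule M)
  have finM: "finite M" using fin M.subset finite_subset by blast
  fix g m assume g: "g \<in> carrier G" and m: "m \<in> M"
  have "(\<lambda>m. g \<otimes> m \<otimes> inv g) ` M = M"
    using g unfolding S(2)[symmetric]
  proof (induction rule: generate.induct)
    case one
    then show ?case using M.mem_carrier by auto
  next
    case (incl h)
    then have h: "h \<in> carrier G" using S by blast
    have "inj_on (\<lambda>m. h \<otimes> m \<otimes> inv h) M"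
      by (intro inj_onI) (use h M.mem_carrier in simp)
    then show ?case using conj[OF incl] by (intro endo_inj_surj finM) auto
  next
    case (inv h)
    then have h: "h \<in> carrier G" using S by blast
    have "inj_on (\<lambda>m. h \<otimes> m \<otimes> inv h) M"
      by (intro inj_onI) (use h M.mem_carrier in simp)
    then have "(\<lambda>m. h \<otimes> m \<otimes> inv h) ` M = M" using conj[OF inv] by (intro endo_inj_surj finM) auto
    then have "(\<lambda>m. inv h \<otimes> m \<otimes> inv (inv h)) ` M = (\<lambda>m. inv h \<otimes> m \<otimes> inv (inv h)) ` (\<lambda>m. h \<otimes> m \<otimes> inv h) ` M"
      by simp
    also have "\<dots> = (\<lambda>m. m) ` M"
      unfolding image_image
      by (intro image_cong) (use h M.mem_carrier in \<open>auto simp: m_assoc inv_mult_cancel\<close>)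
    finally show ?case by simp
  next
    case (eng h k)
    have c: "h \<in> carrier G" "k \<in> carrier G" using eng.hyps S by auto
    have "(\<lambda>m. h \<otimes> k \<otimes> m \<otimes> inv (h \<otimes> k)) ` M = (\<lambda>m. h \<otimes> m \<otimes> inv h) ` (\<lambda>m. k \<otimes> m \<otimes> inv k) ` M"
      unfolding image_image
      by (intro image_cong) (use c M.mem_carrier in \<open>auto simp: m_assoc inv_mult_group\<close>)
    then show ?case using eng.IH by simp
  qed
  then show "g \<otimes> m \<otimes> inv g \<in> M" using m by blast
qed

text \<open>Group actions are homomorphisms into the extensional bijections of a set; a family of maps
that satisfies the elementary action laws becomes one after restriction to the set.\<close>

lemma (in group) group_action_restrictI:
  assumes closed: "\<And>g t. g \<in> carrier G \<Longrightarrow> t \<in> E \<Longrightarrow> act g t \<in> E"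
    and one: "\<And>t. t \<in> E \<Longrightarrow> act \<one> t = t"
    and mult: "\<And>g h t. g \<in> carrier G \<Longrightarrow> h \<in> carrier G \<Longrightarrow> t \<in> E \<Longrightarrow> act (g \<otimes> h) t = act g (act h t)"
  shows "group_action G E (\<lambda>g. restrict (act g) E)"
proof -
  have B: "restrict (act g) E \<in> Bij E" if g: "g \<in> carrier G" for g
  proof -
    have "bij_betw (act g) E E"
      by (rule bij_betw_byWitness[where f' = "act (inv g)"])
        (use g closed in \<open>auto simp flip: mult simp: one\<close>)
    then show ?thesis by (simp add: Bij_def cong: bij_betw_cong)
  qed
  have "(\<lambda>g. restrict (act g) E) \<in> hom G (BijGroup E)"
  proof (rule homI)
    fix g h assume gh: "g \<in> carrier G" "h \<in> carrier G"
    then have "restrict (act (g \<otimes> h)) E = compose E (restrict (act g) E) (restrict (act h) E)"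
      by (auto simp: compose_def mult closed fun_eq_iff)
    then show "restrict (act (g \<otimes> h)) E = restrict (act g) E \<otimes>\<^bsub>BijGroup E\<^esub> restrict (act h) E"
      using gh B by (simp add: BijGroup_def)
  qed (use B in \<open>simp add: BijGroup_def\<close>)
  then show ?thesis
    unfolding group_action_def group_hom_def group_hom_axioms_def
    using is_group group_BijGroup by blast
qed

section \<open>Characters of finite p-groups\<close>

text \<open>The non-fixed points fall into orbits of length divisible by \<open>p\<close>, so the number of
fixed points is divisible by \<open>p\<close> as well and cannot be one.\<close>

lemma (in group_action) p_group_fixed_points:
  assumes p: "prime p" and ord: "order G = p ^ n" and fin: "finite E"
    and dvd: "p dvd card E" and t: "t \<in> E" and fix_t: "\<And>g. g \<in> carrier G \<Longrightarrow> \<phi> g t = t"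
  shows "\<exists>s\<in>E. s \<noteq> t \<and> (\<forall>g\<in>carrier G. \<phi> g s = s)"
proof (rule ccontr)
  assume no: "\<not> ?thesis"
  interpret group G using group_hom group_hom.axioms(1) by blast
  define X where "X = {Group_Action.orbit G \<phi> s | s. s \<in> E - {t}}"
  have self: "s \<in> Group_Action.orbit G \<phi> s" if "s \<in> E" for s
  proof -
    have "\<phi> \<one> s = s" using that by (simp flip: id_eq_one)
    then show ?thesis unfolding Group_Action.orbit_def by (smt (verit) mem_Collect_eq one_closed)
  qed
  have sub: "Group_Action.orbit G \<phi> s \<subseteq> E" if "s \<in> E" for s
    using that element_image by (auto simp: Group_Action.orbit_def)
  have t_notin: "t \<notin> Group_Action.orbit G \<phi> s" if s: "s \<in> E - {t}" for s
  proof
    assume "t \<in> Group_Action.orbit G \<phi> s"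
    then have "s \<in> Group_Action.orbit G \<phi> t" using orbit_sym s t by auto
    then show False using fix_t s by (auto simp: Group_Action.orbit_def)
  qed
  have UX: "\<Union>X = E - {t}"
    unfolding X_def using self sub t_notin by blast
  have "p dvd card (\<Union>X)"
  proof (rule dvd_partition)
    show "finite (\<Union>X)" using UX fin by simp
    show "\<forall>c\<in>X. p dvd card c"
    proof
      fix c assume "c \<in> X"
      then obtain s where s: "s \<in> E" "s \<noteq> t" and c: "c = Group_Action.orbit G \<phi> s" by (auto simp: X_def)
      have "card c dvd p ^ n"
        using orbit_stabilizer_theorem[OF s(1)] ord by (metis c dvd_triv_left)
      then obtain k where k: "card c = p ^ k" using p divides_primepow_nat by blast
      have "k \<noteq> 0"
      proof
        assume "k = 0"
        then have "card c = 1" using k by simp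
        then have "c = {s}" using self[OF s(1)] c by (metis card_1_singletonE singletonD)
        then have "\<forall>g\<in>carrier G. \<phi> g s = s" using c by (auto simp: Group_Action.orbit_def)
        then show False using no s by blast
      qed
      then show "p dvd card c" using k by simp
    qed
    show "\<forall>c1\<in>X. \<forall>c2\<in>X. c1 \<noteq> c2 \<longrightarrow> c1 \<inter> c2 = {}"
    proof (intro ballI impI)
      fix c1 c2 assume c: "c1 \<in> X" "c2 \<in> X" "c1 \<noteq> c2"
      then obtain s1 s2 where s: "s1 \<in> E" "s2 \<in> E" "c1 = Group_Action.orbit G \<phi> s1" "c2 = Group_Action.orbit G \<phi> s2"
        by (auto simp: X_def)
      have "c1 = c2" if "r \<in> c1" "r \<in> c2" for r
      proof -
        have r: "r \<in> E" using that s sub by blast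
        have *: "Group_Action.orbit G \<phi> s' = Group_Action.orbit G \<phi> r"
          if "s' \<in> E" "r \<in> Group_Action.orbit G \<phi> s'" for s'
          using that r sub orbit_sym orbit_trans by (meson subsetD subset_antisym subsetI)
        show ?thesis using *[of s1] *[of s2] s that by simp
      qed
      then show "c1 \<inter> c2 = {}" using c by blast
    qed
  qed
  moreover have "card E = Suc (card (E - {t}))" using fin t by (metis card_Suc_Diff1)
  ultimately have "p dvd 1" using dvd UX by (metis dvd_add_right_iff plus_1_eq_Suc add.commute)
  then show False using p by simp
qed

text \<open>Let \<open>H\<close> act on its right cosets by right multiplication. The coset \<open>H\<close> is fixed and the
index is divisible by \<open>p\<close>, so another coset \<open>H g\<close> is fixed too, which says that \<open>g\<close>
normalises \<open>H\<close>.\<close>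

lemma (in group) p_group_normalizer_grows:
  assumes p: "prime p" and ord: "order G = p ^ n" and H: "subgroup H G" and ne: "H \<noteq> carrier G"
  shows "\<exists>g\<in>carrier G - H. \<forall>h\<in>H. g \<otimes> h \<otimes> inv g \<in> H"
proof -
  interpret H: subgroup H G by (rule H)
  have fin: "finite (carrier G)" using ord p by (metis order_gt_0_iff_finite prime_gt_0_nat zero_less_power)
  let ?H = "G\<lparr>carrier := H\<rparr>"
  interpret HG: group ?H by (rule H.subgroup_is_group[OF is_group])
  have lag: "card (rcosets H) * card H = p ^ n" using lagrange[OF H] ord by simp
  obtain k where k: "card H = p ^ k" using lag p divides_primepow_nat by (metis dvd_triv_right)
  have "card (rcosets H) dvd p ^ n" using lag by (metis dvd_triv_left)
  then obtain j where j: "card (rcosets H) = p ^ j" using p divides_primepow_nat by blast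
  have "j \<noteq> 0"
  proof
    assume "j = 0"
    then have "card H = card (carrier G)" using lag j ord by (simp add: order_def)
    then show False using ne H.subset fin card_subset_eq by blast
  qed
  then have dvd: "p dvd card (rcosets H)" using j by simp
  have finr: "finite (rcosets H)" using fin by (simp add: RCOSETS_def)
  define act where "act = (\<lambda>h C. C #> inv h)"
  have *: "group_action ?H (rcosets H) (\<lambda>g. restrict (act g) (rcosets H))"
  proof (rule HG.group_action_restrictI)
    fix g t assume gt: "g \<in> carrier ?H" "t \<in> rcosets H"
    then obtain x where "x \<in> carrier G" "t = H #> x" by (auto simp: RCOSETS_def)
    then show "act g t \<in> rcosets H" using gt H.subset by (auto simp: act_def coset_mult_assoc rcosetsI)
  next
    fix t assume "t \<in> rcosets H"
    then obtain x where "x \<in> carrier G" "t = H #> x" by (auto simp: RCOSETS_def)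
    then show "act \<one>\<^bsub>?H\<^esub> t = t" using H.subset by (auto simp: act_def coset_mult_assoc)
  next
    fix g h t assume gt: "g \<in> carrier ?H" "h \<in> carrier ?H" "t \<in> rcosets H"
    then obtain x where "x \<in> carrier G" "t = H #> x" by (auto simp: RCOSETS_def)
    then show "act (g \<otimes>\<^bsub>?H\<^esub> h) t = act g (act h t)"
      using gt H.subset H.mem_carrier by (auto simp: act_def coset_mult_assoc inv_mult_group m_assoc)
  qed
  have HH: "H \<in> rcosets H" using H.subset by (metis coset_mult_one one_closed rcosetsI)
  have fixH: "act h H = H" if "h \<in> H" for h
    using that H by (simp add: act_def coset_join2 H.mem_carrier)
  have "\<exists>s\<in>rcosets H. s \<noteq> H \<and> (\<forall>g\<in>carrier ?H. restrict (act g) (rcosets H) s = s)"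
    by (rule group_action.p_group_fixed_points[OF * p _ finr dvd HH, of k])
      (use HH fixH k in \<open>auto simp: order_def\<close>)
  then obtain s where s: "s \<in> rcosets H" "s \<noteq> H" "\<And>h. h \<in> H \<Longrightarrow> s #> inv h = s"
    by (auto simp: act_def)
  then obtain g where g: "g \<in> carrier G" "s = H #> g" by (auto simp: RCOSETS_def)
  have "g \<notin> H" using g s coset_join2[OF g(1) H] by auto
  moreover have "g \<otimes> h \<otimes> inv g \<in> H" if h: "h \<in> H" for h
  proof -
    have hc: "h \<in> carrier G" using h by (rule H.mem_carrier)
    have "H #> (g \<otimes> h) = H #> g"
      using s(3)[of "inv h"] g h hc H.subset by (simp add: coset_mult_assoc)
    then have "g \<otimes> h \<in> H #> g" using H.subset g hc rcos_self[OF _ H, of "g \<otimes> h"] by auto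
    then obtain h' where "h' \<in> H" "g \<otimes> h = h' \<otimes> g" by (auto simp: r_coset_def)
    then show ?thesis using g hc by (simp add: H.mem_carrier m_assoc)
  qed
  ultimately show ?thesis using g by blast
qed

text \<open>Complex values stand in for the group of order \<open>p\<close>: finite products of values are then
ordinary products of numbers.\<close>

definition p_character :: "nat \<Rightarrow> ('g, 'b) monoid_scheme \<Rightarrow> ('g \<Rightarrow> complex) \<Rightarrow> bool" where
  "p_character p G \<chi> \<longleftrightarrow>
     (\<forall>g\<in>carrier G. \<forall>h\<in>carrier G. \<chi> (g \<otimes>\<^bsub>G\<^esub> h) = \<chi> g * \<chi> h) \<and>
     (\<forall>g\<in>carrier G. \<chi> g ^ p = 1)"

context group
begin

context
  fixes p \<chi> assumes \<chi>: "p_character p G \<chi>" and p0: "0 < p"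
begin

lemma p_character_mult: "g \<in> carrier G \<Longrightarrow> h \<in> carrier G \<Longrightarrow> \<chi> (g \<otimes> h) = \<chi> g * \<chi> h"
  using \<chi> by (simp add: p_character_def)

lemma p_character_power: "g \<in> carrier G \<Longrightarrow> \<chi> g ^ p = 1"
  using \<chi> by (simp add: p_character_def)

lemma p_character_nonzero: "g \<in> carrier G \<Longrightarrow> \<chi> g \<noteq> 0"
  using p_character_power[of g] p0 by (metis power_0_left zero_neq_one not_gr_zero)

lemma p_character_one: "\<chi> \<one> = 1"
  using p_character_mult[of \<one> \<one>] p_character_nonzero[of \<one>] by simp

lemma p_character_inv: "g \<in> carrier G \<Longrightarrow> \<chi> (inv g) = inverse (\<chi> g)"
  using p_character_mult[of "inv g" g] p_character_one by (metis inv_closed inverse_unique l_inv mult.commute)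

lemma p_character_nat_pow: "g \<in> carrier G \<Longrightarrow> \<chi> (g [^] (k::nat)) = \<chi> g ^ k"
  by (induction k) (simp_all add: p_character_one p_character_mult)

lemma p_character_generate:
  assumes "S \<subseteq> carrier G" "\<And>s. s \<in> S \<Longrightarrow> \<chi> s = 1" "g \<in> generate G S"
  shows "\<chi> g = 1"
  using assms(3)
proof (induction rule: generate.induct)
  case (eng h1 h2)
  then show ?case using assms(1) p_character_mult generate_in_carrier by simp
qed (use assms p_character_one p_character_inv in auto)

end

end

text \<open>A maximal subgroup \<open>M\<close> above \<open>Q\<close> is normal because its normaliser is larger. For \<open>g\<close>
outside \<open>M\<close>, the power \<open>g ^ i\<close> lies in \<open>M\<close> exactly when \<open>p\<close> divides \<open>i\<close>, so the exponent
of \<open>g\<close> in a decomposition \<open>h = m g ^ i\<close> is well defined modulo \<open>p\<close> and may be sent to a power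
of a primitive \<open>p\<close>-th root of unity.\<close>

lemma (in group) p_group_character_exists:
  assumes p: "prime p" and ord: "order G = p ^ n" and Q: "subgroup Q G" and ne: "Q \<noteq> carrier G"
  obtains \<chi> g where "p_character p G \<chi>" "\<And>q. q \<in> Q \<Longrightarrow> \<chi> q = 1" "g \<in> carrier G" "\<chi> g \<noteq> 1"
proof -
  have p1: "1 < p" using p prime_gt_1_nat by blast
  have fin: "finite (carrier G)" using ord p by (metis order_gt_0_iff_finite prime_gt_0_nat zero_less_power)
  define F where "F = {M. subgroup M G \<and> Q \<subseteq> M \<and> M \<noteq> carrier G}"
  have "F \<subseteq> Pow (carrier G)" using subgroup.subset by (auto simp: F_def)
  then have "finite F" using fin finite_subset by blast
  moreover have "Q \<in> F" using Q ne by (simp add: F_def)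
  ultimately obtain M where M: "M \<in> F" "Q \<subseteq> M" "\<And>K. K \<in> F \<Longrightarrow> M \<subseteq> K \<Longrightarrow> M = K"
    using finite_has_maximal2[of F Q] by metis
  have subM: "subgroup M G" and neM: "M \<noteq> carrier G" using M(1) by (auto simp: F_def)
  interpret M: subgroup M G by (rule subM)
  have max: "K = carrier G" if "subgroup K G" "M \<subseteq> K" "k \<in> K" "k \<notin> M" for K k
    using M that by (auto simp: F_def)
  have "M \<lhd> G"
  proof -
    obtain g where g: "g \<in> carrier G" "g \<notin> M" "\<forall>h\<in>M. g \<otimes> h \<otimes> inv g \<in> M"
      using p_group_normalizer_grows[OF p ord subM neM] by blast
    have S: "insert g M \<subseteq> carrier G" using g M.subset by blast
    have "generate G (insert g M) = carrier G"
      by (rule max[OF generate_is_subgroup[OF S], of g]) (use g in \<open>auto intro: generate.incl\<close>)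
    then show ?thesis
      by (rule normal_if_generators_normalise[OF fin subM S]) (use g in auto)
  qed
  interpret M: normal M G by fact
  obtain g where g: "g \<in> carrier G" "g \<notin> M" using neM M.subset by blast
  have mem_dvd: "int p dvd i" if i: "g [^] (i::int) \<in> M" for i
  proof (rule ccontr)
    assume "\<not> int p dvd i"
    then have "coprime (int p) i" using p by (intro prime_imp_coprime) simp_all
    then have "coprime i (int (p ^ n))" by (simp add: coprime_commute)
    then have "gcd i (int (p ^ n)) = 1" by simp
    then obtain u v where "u * i + v * int (p ^ n) = 1"
      using bezout_int[of i "int (p ^ n)"] by auto
    then have uv: "i * u + int (p ^ n) * v = 1" by (simp add: mult.commute)
    have e: "g [^] (int (p ^ n)) = \<one>" using pow_order_eq_1[OF g(1)] ord by (metis int_pow_int)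
    have "g = g [^] (i * u + int (p ^ n) * v)" using uv g by simp
    also have "\<dots> = (g [^] i) [^] u \<otimes> (g [^] int (p ^ n)) [^] v"
      using g by (simp only: int_pow_mult int_pow_pow)
    also have "\<dots> = (g [^] i) [^] u" using e g by (simp add: int_pow_one)
    finally show False using g subgroup_int_pow_closed[OF subM i, of u] by metis
  qed
  have full: "M <#> generate G {h} = carrier G" if h: "h \<in> carrier G" "h \<notin> M" for h
  proof (rule max)
    show "subgroup (M <#> generate G {h}) G"
      by (rule mult_norm_subgroup[OF M.normal_axioms generate_is_subgroup]) (use h in auto)
    show "M \<subseteq> M <#> generate G {h}"
    proof
      fix m assume "m \<in> M"
      then have "m \<otimes> \<one> \<in> M <#> generate G {h}"
        unfolding set_mult_def using generate.one[of G "{h}"] by blast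
      then show "m \<in> M <#> generate G {h}" using \<open>m \<in> M\<close> by simp
    qed
    have "\<one> \<otimes> h \<in> M <#> generate G {h}"
      unfolding set_mult_def using generate.incl[of h "{h}" G] M.one_closed by blast
    then show "h \<in> M <#> generate G {h}" using h by simp
  qed (use h in auto)
  \<comment> \<open>Otherwise \<open>M\<close> and \<open>g ^ p\<close> generate everything, so \<open>g = m g ^ (p i)\<close> and
    \<open>g ^ (1 - p i)\<close> lies in \<open>M\<close>, against \<open>mem_dvd\<close>.\<close>
  have gp: "g [^] p \<in> M"
  proof (rule ccontr)
    assume "g [^] p \<notin> M"
    then have "g \<in> M <#> generate G {g [^] p}" using full[of "g [^] p"] g by simp
    then obtain m l where m: "m \<in> M" "l \<in> generate G {g [^] p}" "g = m \<otimes> l"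
      unfolding set_mult_def by blast
    obtain i where "l = (g [^] p) [^] (i::int)" using m(2) g generate_pow[of "g [^] p"] by auto
    then have m: "m \<in> M" "g = m \<otimes> (g [^] p) [^] i" using m by auto
    have "g [^] (1 - int p * i) = g \<otimes> inv ((g [^] p) [^] i)"
      using g by (simp add: int_pow_diff int_pow_pow flip: int_pow_int)
    also have "\<dots> = m"
      using m(1) g M.mem_carrier
      by (subst m(2)) (simp add: m_assoc)
    finally have "int p dvd 1 - int p * i" using m(1) mem_dvd[of "1 - int p * i"] by simp
    then have "int p dvd (1 - int p * i) + int p * i" by (intro dvd_add) simp_all
    then have "int p dvd 1" by simp
    then show False using p1 by simp
  qed
  define e where "e = (\<lambda>i::int. cis (2 * pi * of_int i / of_nat p))"
  have e_add: "e (i + j) = e i * e j" for i j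
    by (simp add: e_def cis_mult add_divide_distrib distrib_left)
  have e_dvd: "e i = 1" if "int p dvd i" for i
  proof -
    from that obtain k where "i = int p * k" by blast
    then have "2 * pi * of_int i / of_nat p = 2 * pi * real_of_int k" using p1 by simp
    then show ?thesis unfolding e_def by (metis Ints_of_int cis_multiple_2pi)
  qed
  have e1: "e 1 \<noteq> 1"
  proof
    assume "e 1 = 1"
    then have "cos (2 * pi / of_nat p) = 1" by (simp add: e_def cis.ctr complex_eq_iff)
    then obtain k :: int where "2 * pi / of_nat p = of_int k * 2 * pi" using cos_one_2pi_int by auto
    then have "1 = of_int k * (of_nat p :: real)" using p1 by (simp add: field_simps)
    then have "1 = k * int p" by (metis (mono_tags) of_int_1 of_int_eq_iff of_int_mult of_int_of_nat_eq)
    then have "int p dvd 1" by (metis dvd_triv_right)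
    then show False using p1 by simp
  qed
  define r where "r = (\<lambda>h. SOME i::int. \<exists>m\<in>M. h = m \<otimes> g [^] i)"
  have r_ex: "\<exists>m\<in>M. h = m \<otimes> g [^] r h" if "h \<in> carrier G" for h
  proof -
    have "h \<in> M <#> generate G {g}" using full[OF g] that by simp
    then obtain m l where m: "m \<in> M" "l \<in> generate G {g}" "h = m \<otimes> l"
      unfolding set_mult_def by blast
    then have "\<exists>i::int. \<exists>m\<in>M. h = m \<otimes> g [^] i"
      using generate_pow[OF g(1)] by auto
    then show ?thesis unfolding r_def by (rule someI_ex)
  qed
  have r_eq: "e (r h) = e i" if h: "h = m \<otimes> g [^] i" "m \<in> M" for h m i
  proof -
    have "h \<in> carrier G" using h g M.mem_carrier by simp
    then obtain m' where m': "m' \<in> M" "h = m' \<otimes> g [^] r h" using r_ex by blast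
    have "g [^] (i - r h) = inv m \<otimes> m'"
    proof -
      have c: "m \<in> carrier G" "m' \<in> carrier G" using h m' M.mem_carrier by auto
      have "m \<otimes> g [^] i = m' \<otimes> g [^] r h" using h m' by simp
      then have "g [^] i = inv m \<otimes> m' \<otimes> g [^] r h"
        using c g by (metis int_pow_closed inv_closed inv_mult_cancel(1) m_assoc)
      then show ?thesis using c g by (simp add: int_pow_diff m_assoc)
    qed
    then have "int p dvd i - r h" using mem_dvd m' h by simp
    then have "e (i - r h + r h) = e (r h)" by (subst e_add) (simp add: e_dvd)
    then show ?thesis by simp
  qed
  define \<chi> where "\<chi> = (\<lambda>h. e (r h))"
  have \<chi>: "p_character p G \<chi>"
    unfolding p_character_def
  proof (intro conjI ballI)
    fix h k assume h: "h \<in> carrier G" "k \<in> carrier G"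
    obtain m where m: "m \<in> M" "h = m \<otimes> g [^] r h" using r_ex h by blast
    obtain l where l: "l \<in> M" "k = l \<otimes> g [^] r k" using r_ex h by blast
    have "h \<otimes> k = (m \<otimes> (g [^] r h \<otimes> l \<otimes> inv (g [^] r h))) \<otimes> g [^] (r h + r k)"
    proof -
      have "h \<otimes> k = (m \<otimes> g [^] r h) \<otimes> (l \<otimes> g [^] r k)" using m l by simp
      also have "\<dots> = (m \<otimes> (g [^] r h \<otimes> l \<otimes> inv (g [^] r h))) \<otimes> (g [^] r h \<otimes> g [^] r k)"
        using m(1) l(1) g M.mem_carrier by (simp add: m_assoc inv_solve_left)
      finally show ?thesis using g by (simp add: int_pow_mult)
    qed
    moreover have "m \<otimes> (g [^] r h \<otimes> l \<otimes> inv (g [^] r h)) \<in> M"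
      using m l g M.inv_op_closed2 by simp
    ultimately have "e (r (h \<otimes> k)) = e (r h + r k)" by (rule r_eq)
    then show "\<chi> (h \<otimes> k) = \<chi> h * \<chi> k" by (simp add: \<chi>_def e_add)
  next
    fix h assume "h \<in> carrier G"
    have "e i ^ k = e (int k * i)" for i k
      by (induction k) (simp_all add: e_add algebra_simps e_dvd)
    then show "\<chi> h ^ p = 1" by (simp add: \<chi>_def e_dvd)
  qed
  have "\<chi> q = 1" if "q \<in> Q" for q
    using r_eq[of q q 0] that M(2) e_dvd[of 0] by (auto simp: \<chi>_def)
  moreover have "\<chi> g \<noteq> 1"
    using r_eq[of g \<one> 1] e1 g by (auto simp: \<chi>_def)
  ultimately show ?thesis using that \<chi> g by blast
qed

section \<open>Roots of unity\<close>

lemma root_of_unity_power_cong: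
  fixes w :: complex
  assumes "w ^ p = 1" "[a = b] (mod p)"
  shows "w ^ a = w ^ b"
proof -
  have "w ^ c = w ^ (c mod p)" for c
    by (metis assms(1) div_mult_mod_eq mult.commute mult_1 power_add power_mult power_one)
  then show ?thesis using assms(2) by (metis cong_def)
qed

lemma root_of_unity_coprime:
  fixes w :: complex
  assumes "w ^ a = 1" "w ^ b = 1" "coprime a b"
  shows "w = 1"
proof (cases "a = 0")
  case True
  then show ?thesis using assms by simp
next
  case False
  then obtain x y where "a * x = b * y + gcd a b" using bezout_nat by blast
  then have "w ^ (a * x) = w ^ (b * y) * w" using assms(3) by (simp add: power_add)
  then show ?thesis using assms by (simp add: power_mult)
qed

lemma root_of_unity_inj:
  fixes w :: complex
  assumes "prime p" "w ^ p = 1" "w \<noteq> 1"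
  shows "inj_on (\<lambda>i. w ^ i) {..<p}"
proof -
  have le: "i = j" if "i \<le> j" "j < p" "w ^ i = w ^ j" for i j
  proof (rule ccontr)
    assume "i \<noteq> j"
    have "w \<noteq> 0" using assms prime_gt_0_nat by (metis power_0_left zero_neq_one not_gr_zero)
    then have "w ^ (j - i) = 1" using that by (simp add: power_diff)
    moreover have "coprime (j - i) p"
      using assms(1) that \<open>i \<noteq> j\<close>
      by (metis coprime_commute diff_is_0_eq' diff_le_self le_less_trans nat_dvd_not_less
          not_gr_zero le_antisym prime_imp_coprime_nat zero_less_diff le_neq_implies_less)
    ultimately show False using root_of_unity_coprime[OF _ assms(2)] assms(3) by blast
  qed
  show ?thesis
    by (intro inj_onI) (metis le lessThan_iff nat_le_linear)
qed

text \<open>The powers of \<open>w\<close> are \<open>p\<close> distinct roots of unity, hence all of them.\<close>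

lemma root_of_unity_powers:
  fixes w z :: complex
  assumes "prime p" "w ^ p = 1" "w \<noteq> 1" "z ^ p = 1"
  shows "\<exists>i<p. z = w ^ i"
proof -
  have p: "p > 0" using assms(1) prime_gt_0_nat by blast
  have "(\<lambda>i. w ^ i) ` {..<p} = {z. z ^ p = 1}"
  proof (rule card_subset_eq)
    show "finite {z::complex. z ^ p = 1}" using p by (intro finite_roots_unity) simp
    show "(\<lambda>i. w ^ i) ` {..<p} \<subseteq> {z. z ^ p = 1}"
      using assms(2) by (auto simp flip: power_mult) (metis mult.commute power_mult power_one)
    show "card ((\<lambda>i. w ^ i) ` {..<p}) = card {z::complex. z ^ p = 1}"
      using card_image[OF root_of_unity_inj[OF assms(1-3)]] card_roots_unity_eq[OF p] by simp
  qed
  then show ?thesis using assms(4) by blast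
qed

section \<open>Metacyclic p-groups\<close>

text \<open>With explicit generators every element has a normal form, in which products and commutators
can be computed.\<close>

definition metacyclic_pair :: "('g, 'b) monoid_scheme \<Rightarrow> 'g \<Rightarrow> 'g \<Rightarrow> bool" where
  "metacyclic_pair G x y \<longleftrightarrow> x \<in> carrier G \<and> y \<in> carrier G \<and> generate G {x} \<lhd> G \<and>
     (\<forall>g\<in>carrier G. \<exists>(i::int) (j::int). g = x [^]\<^bsub>G\<^esub> i \<otimes>\<^bsub>G\<^esub> y [^]\<^bsub>G\<^esub> j)"

locale finite_p_group = group G for G (structure) +
  fixes p n :: nat
  assumes p: "prime p" and order_eq: "order G = p ^ n"
begin

lemma finite_carrier: "finite (carrier G)"
  using order_eq p by (metis order_gt_0_iff_finite prime_gt_0_nat zero_less_power)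

lemma pow_order: "g \<in> carrier G \<Longrightarrow> g [^] (p ^ n) = \<one>"
  using pow_order_eq_1 order_eq by simp

text \<open>Conjugation by \<open>g\<close> raises a generator to some power \<open>k\<close>. Iterating \<open>p ^ n\<close> times gives
the identity, so \<open>k ^ (p ^ n) = 1\<close> modulo \<open>p\<close> unless the cyclic group is trivial, and
\<open>k ^ (p ^ n) = k\<close> modulo \<open>p\<close> by Fermat.\<close>

lemma cyclic_normal_conj:
  assumes x: "x \<in> carrier G" and N: "generate G {x} \<lhd> G" and g: "g \<in> carrier G"
  obtains k :: nat where "[k = 1] (mod p)" "\<And>u. u \<in> generate G {x} \<Longrightarrow> g \<otimes> u \<otimes> inv g = u [^] k"
proof (cases "x = \<one>")
  case True
  then have "g \<otimes> u \<otimes> inv g = u [^] (1::nat)" if "u \<in> generate G {x}" for u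
    using that g by (simp add: generate_one)
  then show ?thesis by (rule that[OF cong_refl])
next
  case False
  interpret N: normal "generate G {x}" G by fact
  have gen: "generate G {x} = {x [^] k | k. k \<in> (UNIV :: nat set)}"
    by (rule generate_pow_on_finite_carrier[OF finite_carrier x])
  have "g \<otimes> x \<otimes> inv g \<in> generate G {x}"
    using g by (intro N.inv_op_closed2) (auto intro: generate.incl)
  then obtain k where k: "g \<otimes> x \<otimes> inv g = x [^] (k::nat)" using gen by blast
  have iter: "g [^] i \<otimes> x \<otimes> inv (g [^] i) = x [^] (k ^ i)" for i :: nat
  proof (induction i)
    case (Suc i)
    have "g [^] Suc i \<otimes> x \<otimes> inv (g [^] Suc i) = g [^] i \<otimes> (g \<otimes> x \<otimes> inv g) \<otimes> inv (g [^] i)"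
      using g x by (simp add: m_assoc inv_mult_group)
    also have "\<dots> = (x [^] (k ^ i)) [^] k" using Suc g x by (simp add: k conj_pow)
    also have "\<dots> = x [^] (k ^ Suc i)" using x by (simp add: nat_pow_pow mult.commute)
    finally show ?case .
  qed (use x in simp)
  have "x [^] (k ^ (p ^ n)) = x [^] (1::nat)"
    using iter[of "p ^ n"] pow_order[OF g] x by simp
  then have "x [^] int (k ^ (p ^ n)) = x [^] int 1" by (simp only: int_pow_int)
  then have dvd: "int (ord x) dvd int 1 - int (k ^ (p ^ n))" using int_pow_eq[OF x] by blast
  have "ord x dvd p ^ n" using pow_order x pow_eq_id by blast
  then obtain j where j: "ord x = p ^ j" using p divides_primepow_nat by blast
  moreover have "ord x \<noteq> 1" using False x ord_eq_1 by blast
  ultimately have "p dvd ord x" by (metis dvd_power neq0_conv power_0)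
  then have "int p dvd int 1 - int (k ^ (p ^ n))" using dvd by (meson dvd_trans of_nat_dvd_iff)
  then have c1: "[k ^ (p ^ n) = 1] (mod p)"
    by (metis cong_int_iff cong_iff_dvd_diff cong_sym)
  have fermat: "[k ^ p = k] (mod p)"
  proof (cases "p dvd k")
    case True
    then show ?thesis using p prime_gt_0_nat by (simp add: cong_def prime_dvd_power_iff mod_eq_0_iff_dvd)
  next
    case False
    then have "[k ^ (p - 1) * k = 1 * k] (mod p)" by (intro cong_mult fermat_theorem p) auto
    then show ?thesis using prime_gt_0_nat[OF p] by (metis Suc_diff_1 mult_1 power_Suc mult.commute)
  qed
  have "[k ^ (p ^ i) = k] (mod p)" for i
  proof (induction i)
    case (Suc i)
    have "[(k ^ (p ^ i)) ^ p = k ^ p] (mod p)" by (rule cong_pow[OF Suc])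
    then show ?case using fermat by (metis cong_trans power_Suc2 power_mult)
  qed simp
  then have "[k = 1] (mod p)" using c1 by (metis cong_trans cong_sym)
  moreover have "g \<otimes> u \<otimes> inv g = u [^] k" if u: "u \<in> generate G {x}" for u
  proof -
    obtain l where l: "u = x [^] (l::nat)" using u gen by blast
    show ?thesis using g x by (simp add: l conj_pow k nat_pow_pow mult.commute)
  qed
  ultimately show ?thesis by (rule that)
qed

text \<open>Modulo \<open>\<langle>x ^ p\<rangle>\<close> the element \<open>x\<close> is central, and a group with a cyclic quotient by a
central subgroup is abelian. The proof multiplies out normal forms \<open>x ^ i y ^ j\<close>.\<close>

lemma metacyclic_pair_commutator:
  assumes xy: "metacyclic_pair G x y" and gh: "g \<in> carrier G" "h \<in> carrier G"
  shows "\<exists>f::int. int p dvd f \<and> g \<otimes> h = x [^] f \<otimes> (h \<otimes> g)"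
proof -
  have x: "x \<in> carrier G" and y: "y \<in> carrier G" and N: "generate G {x} \<lhd> G"
    and ex: "\<And>g. g \<in> carrier G \<Longrightarrow> \<exists>(i::int) (j::int). g = x [^] i \<otimes> y [^] j"
    using xy by (auto simp: metacyclic_pair_def)
  have move: "\<exists>k::int. int p dvd k - 1 \<and> (\<forall>l::int. y [^] i \<otimes> x [^] l = x [^] (k * l) \<otimes> y [^] i)" for i :: int
  proof -
    obtain k where k: "[k = 1] (mod p)" "\<And>u. u \<in> generate G {x} \<Longrightarrow> y [^] i \<otimes> u \<otimes> inv (y [^] i) = u [^] k"
      using cyclic_normal_conj[OF x N, of "y [^] i"] y by auto
    have "y [^] i \<otimes> x [^] l = x [^] (int k * l) \<otimes> y [^] i" for l :: int
    proof -
      have "x [^] l \<in> generate G {x}" using generate_pow[OF x] by blast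
      then have "y [^] i \<otimes> x [^] l \<otimes> inv (y [^] i) = (x [^] l) [^] k" by (rule k)
      also have "\<dots> = x [^] (int k * l)" using x by (simp add: int_pow_pow mult.commute flip: int_pow_int)
      finally show ?thesis using x y by (metis int_pow_closed inv_solve_right' m_closed)
    qed
    moreover have "int p dvd int k - 1" using k(1) by (metis cong_iff_dvd_diff cong_int_iff of_nat_1)
    ultimately show ?thesis by blast
  qed
  obtain i j where g: "g = x [^] (i::int) \<otimes> y [^] (j::int)" using ex gh by blast
  obtain i' j' where h: "h = x [^] (i'::int) \<otimes> y [^] (j'::int)" using ex gh by blast
  obtain k where k: "int p dvd k - 1" "\<And>l::int. y [^] j \<otimes> x [^] l = x [^] (k * l) \<otimes> y [^] j" using move by blast
  obtain k' where k': "int p dvd k' - 1" "\<And>l::int. y [^] j' \<otimes> x [^] l = x [^] (k' * l) \<otimes> y [^] j'" using move by blast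
  have "g \<otimes> h = x [^] i \<otimes> (y [^] j \<otimes> x [^] i') \<otimes> y [^] j'" using x y by (simp add: g h m_assoc)
  also have "\<dots> = x [^] (i + k * i') \<otimes> y [^] (j + j')"
    using x y by (simp add: k int_pow_mult m_assoc)
  finally have gh_eq: "g \<otimes> h = x [^] (i + k * i') \<otimes> y [^] (j + j')" .
  have "h \<otimes> g = x [^] i' \<otimes> (y [^] j' \<otimes> x [^] i) \<otimes> y [^] j" using x y by (simp add: g h m_assoc)
  also have "\<dots> = x [^] (i' + k' * i) \<otimes> y [^] (j' + j)"
    using x y by (simp add: k' int_pow_mult m_assoc)
  finally have hg_eq: "h \<otimes> g = x [^] (i' + k' * i) \<otimes> y [^] (j + j')" by (simp add: add.commute)
  define f where "f = (k - 1) * i' - (k' - 1) * i"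
  have "int p dvd f" using k(1) k'(1) by (simp add: f_def)
  moreover have "x [^] f \<otimes> (h \<otimes> g) = x [^] (f + (i' + k' * i)) \<otimes> y [^] (j + j')"
    using x y by (simp add: hg_eq int_pow_mult m_assoc)
  moreover have "f + (i' + k' * i) = i + k * i'" by (simp add: f_def algebra_simps)
  ultimately show ?thesis using gh_eq by metis
qed

lemma character_conj_invariant:
  assumes xy: "metacyclic_pair G x y" and M: "subgroup M G" and \<psi>: "p_character p (G\<lparr>carrier := M\<rparr>) \<psi>"
    and u: "u \<in> M" "u \<in> generate G {x}" and g: "g \<in> carrier G"
  shows "\<psi> (g \<otimes> u \<otimes> inv g) = \<psi> u"
proof -
  interpret M: subgroup M G by (rule M)
  interpret MG: group "G\<lparr>carrier := M\<rparr>" by (rule M.subgroup_is_group[OF is_group])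
  obtain k where k: "[k = 1] (mod p)" "g \<otimes> u \<otimes> inv g = u [^] k"
    using cyclic_normal_conj[of x g] xy u g by (metis metacyclic_pair_def)
  have "\<psi> (u [^] k) = \<psi> u ^ k"
    using MG.p_character_nat_pow[OF \<psi> prime_gt_0_nat[OF p], of u k] u nat_pow_consistent by simp
  also have "\<dots> = \<psi> u ^ 1"
    using MG.p_character_power[OF \<psi> prime_gt_0_nat[OF p], of u] u k by (intro root_of_unity_power_cong) auto
  finally show ?thesis using k by simp
qed

text \<open>With \<open>v\<close> the commutator of \<open>g\<close> and \<open>u\<close>, a member of the cyclic normal subgroup,
invariance under conjugation shows that the \<open>i\<close>-th factor is \<open>\<psi> u * \<psi> v ^ i\<close>. The
exponents of both \<open>\<psi> u\<close> and \<open>\<psi> v\<close> in the product are divisible by \<open>p\<close>; for the second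
one this uses that \<open>p\<close> is odd.\<close>

lemma character_norm_trivial:
  assumes xy: "metacyclic_pair G x y" and odd: "odd p" and M: "M \<lhd> G"
    and \<psi>: "p_character p (G\<lparr>carrier := M\<rparr>) \<psi>"
    and u: "u \<in> M" and g: "g \<in> carrier G" and f: "p dvd f"
  shows "(\<Prod>i<f. \<psi> (g [^] i \<otimes> u \<otimes> inv (g [^] i))) = 1"
proof -
  interpret M: normal M G by (rule M)
  interpret MG: group "G\<lparr>carrier := M\<rparr>" by (rule M.subgroup_is_group[OF is_group])
  note p0 = prime_gt_0_nat[OF p]
  have uc: "u \<in> carrier G" using u by (rule M.mem_carrier)
  have x: "x \<in> carrier G" using xy by (simp add: metacyclic_pair_def)
  have conj: "h \<otimes> m \<otimes> inv h \<in> M" if "h \<in> carrier G" "m \<in> M" for h m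
    using that M.inv_op_closed2 by blast
  obtain e where e: "g \<otimes> u = x [^] (e::int) \<otimes> (u \<otimes> g)"
    using metacyclic_pair_commutator[OF xy g uc] by blast
  define v where "v = x [^] e"
  have vc: "v \<in> carrier G" using x by (simp add: v_def)
  have gu: "g \<otimes> u \<otimes> inv g = v \<otimes> u" using e g uc vc by (simp add: v_def m_assoc)
  then have v: "v = (g \<otimes> u \<otimes> inv g) \<otimes> inv u" using uc vc by (simp add: m_assoc)
  then have vM: "v \<in> M" using conj[OF g u] u by simp
  have vN: "v \<in> generate G {x}" unfolding v_def using generate_pow[OF x] by blast
  have step: "\<psi> (g [^] i \<otimes> u \<otimes> inv (g [^] i)) = \<psi> u * \<psi> v ^ i" for i :: nat
  proof (induction i)
    case (Suc i)
    have gi: "g [^] i \<in> carrier G" using g by simp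
    have "g [^] Suc i \<otimes> u \<otimes> inv (g [^] Suc i) = g [^] i \<otimes> (g \<otimes> u \<otimes> inv g) \<otimes> inv (g [^] i)"
      using g uc by (simp add: m_assoc inv_mult_group)
    also have "\<dots> = (g [^] i \<otimes> v \<otimes> inv (g [^] i)) \<otimes> (g [^] i \<otimes> u \<otimes> inv (g [^] i))"
      unfolding gu using g uc vc by (simp add: m_assoc inv_mult_cancel)
    finally have "\<psi> (g [^] Suc i \<otimes> u \<otimes> inv (g [^] Suc i)) =
        \<psi> (g [^] i \<otimes> v \<otimes> inv (g [^] i)) * \<psi> (g [^] i \<otimes> u \<otimes> inv (g [^] i))"
      using MG.p_character_mult[OF \<psi> p0] conj[OF gi] vM u by simp
    then show ?case
      using Suc character_conj_invariant[OF xy M.subgroup_axioms \<psi> vM vN gi] by simp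
  qed (use uc in simp)
  have "2 * (\<Sum>i<f. i) = f * (f - 1)"
  proof (induction f)
    case (Suc f)
    then show ?case by (cases f) (simp_all add: algebra_simps)
  qed simp
  then have "p dvd 2 * (\<Sum>i<f. i)" using f by simp
  moreover have "coprime p 2" using odd by simp
  ultimately have dvd: "p dvd (\<Sum>i<f. i)" using coprime_dvd_mult_right_iff by blast
  have "(\<Prod>i<f. \<psi> (g [^] i \<otimes> u \<otimes> inv (g [^] i))) = \<psi> u ^ f * \<psi> v ^ (\<Sum>i<f. i)"
    by (simp add: step prod.distrib power_sum)
  also have "\<psi> u ^ f = \<psi> u ^ 0"
    using MG.p_character_power[OF \<psi> p0] u f by (intro root_of_unity_power_cong[of _ p]) (auto simp: cong_0_iff)
  also have "\<psi> v ^ (\<Sum>i<f. i) = \<psi> v ^ 0"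
    using MG.p_character_power[OF \<psi> p0] vM dvd by (intro root_of_unity_power_cong[of _ p]) (auto simp: cong_0_iff)
  finally show ?thesis by simp
qed

end

section \<open>Transfer to a group with a complement of a metacyclic Sylow subgroup\<close>

lemma prod_eq_1_by_orbits:
  assumes "finite A" "\<And>t. t \<in> A \<Longrightarrow> t \<in> orb t" "\<And>t. t \<in> A \<Longrightarrow> orb t \<subseteq> A"
    and "\<And>s t. t \<in> A \<Longrightarrow> s \<in> orb t \<Longrightarrow> orb s = orb t"
    and "\<And>t. t \<in> A \<Longrightarrow> prod f (orb t) = 1"
  shows "prod f A = 1"
proof -
  have "\<Union>(orb ` A) = A" using assms(2,3) by blast
  then have "prod f A = prod f (\<Union>(orb ` A))" by simp
  also have "\<dots> = prod (prod f) (orb ` A)"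
  proof (rule prod.Union_disjoint[unfolded comp_def])
    show "\<forall>B\<in>orb ` A. finite B" using assms(1,3) finite_subset by blast
    show "\<forall>B\<in>orb ` A. \<forall>C\<in>orb ` A. B \<noteq> C \<longrightarrow> B \<inter> C = {}"
    proof (intro ballI impI)
      fix B C assume "B \<in> orb ` A" "C \<in> orb ` A" "B \<noteq> C"
      then obtain s t where "s \<in> A" "t \<in> A" "B = orb s" "C = orb t" by blast
      then show "B \<inter> C = {}" using assms(4)[of s] assms(4)[of t] \<open>B \<noteq> C\<close> by blast
    qed
  qed
  also have "\<dots> = 1" using assms(5) by (intro prod.neutral) auto
  finally show ?thesis .
qed

text \<open>Let \<open>Q\<close> be the stabiliser of \<open>t0\<close>, a proper subgroup, and let \<open>M\<close> be the kernel of a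
nontrivial character that is trivial on \<open>Q\<close>. The set \<open>X\<close> splits into \<open>p\<close> blocks, the \<open>M\<close>-orbits,
permuted cyclically by powers of some \<open>b\<close> outside \<open>M\<close>. An element \<open>u\<close> of \<open>Q\<close> preserves every
block. On the first block the cocycle multiplies up to a character \<open>\<psi>\<close> of \<open>M\<close>, and the product
over the \<open>i\<close>-th block is the value of \<open>\<psi>\<close> at a conjugate of \<open>u\<close>. So the whole product is the
norm treated in \<open>character_norm_trivial\<close>.\<close>

lemma (in finite_p_group) cocycle_prod_trivial:
  fixes act :: "'a \<Rightarrow> 't \<Rightarrow> 't" and c :: "'a \<Rightarrow> 't \<Rightarrow> complex"
  assumes xy: "metacyclic_pair G x y" and odd: "odd p"
    and closed: "\<And>g t. g \<in> carrier G \<Longrightarrow> t \<in> X \<Longrightarrow> act g t \<in> X"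
    and act_one: "\<And>t. t \<in> X \<Longrightarrow> act \<one> t = t"
    and act_mult: "\<And>g h t. g \<in> carrier G \<Longrightarrow> h \<in> carrier G \<Longrightarrow> t \<in> X \<Longrightarrow> act (g \<otimes> h) t = act g (act h t)"
    and trans: "X = (\<lambda>g. act g t0) ` carrier G" and t0: "t0 \<in> X" and nontriv: "\<exists>g\<in>carrier G. act g t0 \<noteq> t0"
    and c_mult: "\<And>g h t. g \<in> carrier G \<Longrightarrow> h \<in> carrier G \<Longrightarrow> t \<in> X \<Longrightarrow> c (g \<otimes> h) t = c g (act h t) * c h t"
    and c_pow: "\<And>g t. g \<in> carrier G \<Longrightarrow> t \<in> X \<Longrightarrow> c g t ^ p = 1"
    and u: "u \<in> carrier G" "act u t0 = t0"
  shows "(\<Prod>t\<in>X. c u t) = 1"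
proof -
  note p0 = prime_gt_0_nat[OF p]
  have finX: "finite X" using finite_carrier trans by simp
  have cancel: "act (inv g) (act g t) = t" "act g (act (inv g) t) = t" if "g \<in> carrier G" "t \<in> X" for g t
    using that act_mult[of "inv g" g t] act_mult[of g "inv g" t] act_one by auto
  have c0: "c g t \<noteq> 0" if "g \<in> carrier G" "t \<in> X" for g t
    using c_pow[OF that] p0 by (metis power_0_left zero_neq_one not_gr_zero)
  define Q where "Q = {g \<in> carrier G. act g t0 = t0}"
  have Q: "subgroup Q G"
  proof (rule subgroupI)
    have "\<one> \<in> Q" using act_one t0 by (simp add: Q_def)
    then show "Q \<noteq> {}" by blast
    show "inv g \<in> Q" if "g \<in> Q" for g using that cancel(1)[of g t0] t0 by (simp add: Q_def)
    show "g \<otimes> h \<in> Q" if "g \<in> Q" "h \<in> Q" for g h using that act_mult[of g h t0] t0 by (simp add: Q_def)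
  qed (auto simp: Q_def)
  have neQ: "Q \<noteq> carrier G" using nontriv by (auto simp: Q_def)
  obtain \<chi> b where \<chi>: "p_character p G \<chi>" "\<And>q. q \<in> Q \<Longrightarrow> \<chi> q = 1" and b: "b \<in> carrier G" "\<chi> b \<noteq> 1"
    by (rule p_group_character_exists[OF p order_eq Q neQ]) blast
  note \<chi>_mult = p_character_mult[OF \<chi>(1) p0] and \<chi>_inv = p_character_inv[OF \<chi>(1) p0]
    and \<chi>_one = p_character_one[OF \<chi>(1) p0] and \<chi>_pow = p_character_nat_pow[OF \<chi>(1) p0]
    and \<chi>_p = p_character_power[OF \<chi>(1) p0] and \<chi>_0 = p_character_nonzero[OF \<chi>(1) p0]
  define M where "M = {g \<in> carrier G. \<chi> g = 1}"
  have M_I: "g \<in> M" if "g \<in> carrier G" "\<chi> g = 1" for g using that by (simp add: M_def)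
  have M_D: "\<chi> g = 1" if "g \<in> M" for g using that by (simp add: M_def)
  have M: "M \<lhd> G"
  proof (rule normal_invI)
    show "subgroup M G"
    proof (rule subgroupI)
      have "\<one> \<in> M" using \<chi>_one by (simp add: M_def)
      then show "M \<noteq> {}" by blast
    qed (auto simp: M_def \<chi>_mult \<chi>_inv)
    show "g \<otimes> h \<otimes> inv g \<in> M" if "g \<in> carrier G" "h \<in> M" for g h
      using that \<chi>_0 by (auto simp: M_def \<chi>_mult \<chi>_inv)
  qed
  interpret M: normal M G by (rule M)
  have "u \<in> Q" unfolding Q_def using u by blast
  then have "\<chi> u = 1" by (rule \<chi>(2))
  then have uM: "u \<in> M" using u M_I by blast
  have w: "\<chi> b ^ p = 1" using b \<chi>_p by blast
  define Y where "Y = (\<lambda>m. act m t0) ` M"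
  have YX: "Y \<subseteq> X" using closed t0 M.mem_carrier by (auto simp: Y_def)
  have actY: "bij_betw (act m) Y Y" if m: "m \<in> M" for m
  proof (rule bij_betw_byWitness[where f' = "act (inv m)"])
    have mc: "m \<in> carrier G" using m M.mem_carrier by blast
    have *: "act g ` Y \<subseteq> Y" if g: "g \<in> M" for g
      using g M.mem_carrier t0 by (force simp: Y_def simp flip: act_mult)
    show "act m ` Y \<subseteq> Y" "act (inv m) ` Y \<subseteq> Y" using * m by auto
    show "\<forall>t\<in>Y. act (inv m) (act m t) = t" "\<forall>t\<in>Y. act m (act (inv m) t) = t"
      using cancel[OF mc] YX by auto
  qed
  define \<psi> where "\<psi> = (\<lambda>m. \<Prod>t\<in>Y. c m t)"
  have \<psi>: "p_character p (G\<lparr>carrier := M\<rparr>) \<psi>"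
    unfolding p_character_def
  proof (intro conjI ballI)
    fix g h assume "g \<in> carrier (G\<lparr>carrier := M\<rparr>)" "h \<in> carrier (G\<lparr>carrier := M\<rparr>)"
    then have gh: "g \<in> M" "h \<in> M" "g \<in> carrier G" "h \<in> carrier G" using M.mem_carrier by auto
    have "\<psi> (g \<otimes> h) = (\<Prod>t\<in>Y. c g (act h t) * c h t)"
      unfolding \<psi>_def using gh c_mult YX by (intro prod.cong) auto
    also have "\<dots> = (\<Prod>t\<in>Y. c g (act h t)) * \<psi> h" by (simp add: prod.distrib \<psi>_def)
    also have "(\<Prod>t\<in>Y. c g (act h t)) = \<psi> g"
      unfolding \<psi>_def by (rule prod.reindex_bij_betw[OF actY[OF gh(2)]])
    finally show "\<psi> (g \<otimes>\<^bsub>G\<lparr>carrier := M\<rparr>\<^esub> h) = \<psi> g * \<psi> h" by simp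
  next
    fix g assume "g \<in> carrier (G\<lparr>carrier := M\<rparr>)"
    then have "g \<in> carrier G" using M.mem_carrier by auto
    then show "\<psi> g ^ p = 1"
      unfolding \<psi>_def prod_power_distrib using c_pow YX by (intro prod.neutral) auto
  qed
  define Z where "Z = (\<lambda>i::nat. act (b [^] i) ` Y)"
  have ZX: "Z i \<subseteq> X" for i unfolding Z_def using YX b(1)
    by (intro image_subsetI closed nat_pow_closed) auto
  have UZ: "X = (\<Union>i<p. Z i)"
  proof
    show "(\<Union>i<p. Z i) \<subseteq> X" using ZX by blast
    show "X \<subseteq> (\<Union>i<p. Z i)"
    proof
      fix t assume "t \<in> X"
      then obtain g where g: "g \<in> carrier G" "t = act g t0" using trans by blast
      obtain i where i: "i < p" "\<chi> g = \<chi> b ^ i"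
        using root_of_unity_powers[OF p w b(2) \<chi>_p[OF g(1)]] by blast
      define m where "m = inv (b [^] i) \<otimes> g"
      have "m \<in> M"
        by (rule M_I) (use g b i \<chi>_0[OF b(1)] in \<open>simp_all add: m_def \<chi>_mult \<chi>_inv \<chi>_pow\<close>)
      moreover have "t = act (b [^] i) (act m t0)"
      proof -
        have bi: "b [^] i \<in> carrier G" using b by simp
        have "act (b [^] i) (act m t0) = act (b [^] i \<otimes> m) t0"
          by (rule act_mult[symmetric]) (use bi g t0 m_def in auto)
        also have "b [^] i \<otimes> m = g" using bi g by (simp add: m_def inv_mult_cancel)
        finally show ?thesis using g by simp
      qed
      ultimately show "t \<in> (\<Union>i<p. Z i)" using i by (auto simp: Z_def Y_def)
    qed
  qed
  have disj: "Z i \<inter> Z j = {}" if ij: "i < p" "j < p" "i \<noteq> j" for i j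
  proof (rule ccontr)
    assume "Z i \<inter> Z j \<noteq> {}"
    then obtain m m' where m: "m \<in> M" "m' \<in> M" "act (b [^] i) (act m t0) = act (b [^] j) (act m' t0)"
      by (auto simp: Z_def Y_def)
    define g h where "g = b [^] i \<otimes> m" and "h = b [^] j \<otimes> m'"
    have gh: "g \<in> carrier G" "h \<in> carrier G" using m b M.mem_carrier by (auto simp: g_def h_def)
    have "act g t0 = act h t0" using m b t0 M.mem_carrier by (simp add: g_def h_def act_mult)
    then have "inv h \<otimes> g \<in> Q" using gh t0 cancel by (simp add: Q_def act_mult)
    then have "inverse (\<chi> h) * \<chi> g = 1" using \<chi>(2) gh by (metis \<chi>_mult \<chi>_inv inv_closed)
    then have "\<chi> g = \<chi> h" using \<chi>_0[OF gh(2)] by (simp add: field_simps)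
    then have "\<chi> b ^ i = \<chi> b ^ j" using m b by (simp add: g_def h_def \<chi>_mult \<chi>_pow M_D)
    then show False using root_of_unity_inj[OF p w b(2)] ij by (auto simp: inj_on_def)
  qed
  \<comment> \<open>Moving a block to the first one changes the cocycle by a coboundary, which cancels in the
    product over the block.\<close>
  have block: "(\<Prod>t\<in>Z i. c u t) = \<psi> (inv (b [^] i) \<otimes> u \<otimes> b [^] i)" for i :: nat
  proof -
    define v where "v = inv (b [^] i) \<otimes> u \<otimes> b [^] i"
    have bi: "b [^] i \<in> carrier G" using b by simp
    have vM: "v \<in> M" unfolding v_def using M.inv_op_closed1[OF bi uM] .
    have vc: "v \<in> carrier G" using vM M.mem_carrier by blast
    have "inj_on (act (b [^] i)) Y" using cancel(1)[OF bi] YX by (metis inj_onI subsetD)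
    then have "(\<Prod>t\<in>Z i. c u t) = (\<Prod>t\<in>Y. c u (act (b [^] i) t))"
      unfolding Z_def by (subst prod.reindex) (auto simp: comp_def)
    \<comment> \<open>Expand the cocycle at \<open>u b ^ i = b ^ i v\<close> in both ways.\<close>
    moreover have "(\<Prod>t\<in>Y. c u (act (b [^] i) t)) * (\<Prod>t\<in>Y. c (b [^] i) t) =
        (\<Prod>t\<in>Y. c (b [^] i) (act v t)) * \<psi> v"
    proof -
      have "u \<otimes> b [^] i = b [^] i \<otimes> v" using u bi by (simp add: v_def m_assoc inv_mult_cancel)
      then have "c u (act (b [^] i) t) * c (b [^] i) t = c (b [^] i) (act v t) * c v t" if "t \<in> Y" for t
        using that u bi vc YX by (metis c_mult subsetD)
      then show ?thesis by (simp add: \<psi>_def flip: prod.distrib)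
    qed
    moreover have "(\<Prod>t\<in>Y. c (b [^] i) (act v t)) = (\<Prod>t\<in>Y. c (b [^] i) t)"
      by (rule prod.reindex_bij_betw[OF actY[OF vM]])
    moreover have "(\<Prod>t\<in>Y. c (b [^] i) t) \<noteq> 0"
      using finX YX c0[OF bi] finite_subset[OF YX finX] by (auto simp: prod_zero_iff)
    ultimately show ?thesis by (simp add: v_def)
  qed
  have "(\<Prod>t\<in>X. c u t) = (\<Prod>i<p. \<Prod>t\<in>Z i. c u t)"
    unfolding UZ by (rule prod.UNION_disjoint) (use finite_subset[OF ZX finX] disj in auto)
  also have "\<dots> = (\<Prod>i<p. \<psi> (inv b [^] i \<otimes> u \<otimes> inv (inv b [^] i)))"
    using b by (intro prod.cong refl) (simp add: block nat_pow_inv)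
  also have "\<dots> = 1"
    by (rule character_norm_trivial[OF xy odd M \<psi> uM]) (use b in auto)
  finally show ?thesis .
qed

text \<open>The set \<open>T\<close> is a transversal of the left cosets of \<open>P\<close>; writing \<open>g t = act g t * \<kappa> g t\<close>
with \<open>act g t\<close> in \<open>T\<close> and \<open>\<kappa> g t\<close> in \<open>P\<close>, the transfer of \<open>\<nu>\<close> is the product of
\<open>\<nu> (\<kappa> g t)\<close> over \<open>t\<close>.

To see that \<open>V u = 1\<close> forces \<open>\<nu> u = 1\<close> on \<open>P\<close>, induct on the order of \<open>u\<close> and split \<open>T\<close> into
\<open>P\<close>-orbits. The orbit of the identity contributes \<open>\<nu> u\<close>. It is the only orbit of length one,
since a fixed \<open>t\<close> normalises \<open>P\<close> and is therefore the identity. An orbit on which \<open>u\<close> has a fixed point contributes \<open>1\<close> by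
\<open>cocycle_prod_trivial\<close>. On any other orbit every \<open>u\<close>-cycle has length \<open>f > 1\<close> and contributes
\<open>\<nu> z\<close> for a conjugate \<open>z\<close> of \<open>u ^ f\<close> in \<open>P\<close>. Such a \<open>z\<close> has smaller order than \<open>u\<close> and also
satisfies \<open>V z = 1\<close>, so \<open>\<nu> z = 1\<close> by induction. Hence \<open>V u = \<nu> u\<close>.\<close>

lemma (in group) transfer_character:
  assumes fin: "finite (carrier G)"
    and T: "subgroup T G" and P: "subgroup P G" and TP: "T \<inter> P = {\<one>}" and prod: "T <#> P = carrier G"
    and p: "prime p" "odd p" and cardP: "card P = p ^ n"
    and xy: "metacyclic_pair (G\<lparr>carrier := P\<rparr>) x y"
    and norm: "\<And>t. t \<in> T \<Longrightarrow> (\<And>q. q \<in> P \<Longrightarrow> inv t \<otimes> q \<otimes> t \<in> P) \<Longrightarrow> t = \<one>"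
    and \<nu>: "p_character p (G\<lparr>carrier := P\<rparr>) \<nu>"
  obtains V where "p_character p G V" "\<And>u. u \<in> P \<Longrightarrow> V u = 1 \<Longrightarrow> \<nu> u = 1"
proof -
  interpret T: subgroup T G by (rule T)
  interpret P: subgroup P G by (rule P)
  let ?P = "G\<lparr>carrier := P\<rparr>"
  interpret PG: group ?P by (rule P.subgroup_is_group[OF is_group])
  interpret PP: finite_p_group ?P p n
    by unfold_locales (use p cardP in \<open>auto simp: order_def\<close>)
  note p0 = prime_gt_0_nat[OF p(1)]
  have finT: "finite T" using fin T.subset finite_subset by blast
  have \<nu>_mult: "\<nu> (g \<otimes> h) = \<nu> g * \<nu> h" if "g \<in> P" "h \<in> P" for g h
    using PG.p_character_mult[OF \<nu> p0] that by simp
  have \<nu>_p: "\<nu> g ^ p = 1" if "g \<in> P" for g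
    using PG.p_character_power[OF \<nu> p0] that by simp
  have "\<exists>t q. t \<in> T \<and> q \<in> P \<and> g = t \<otimes> q" if "g \<in> carrier G" for g
    using that unfolding prod[symmetric] set_mult_def by blast
  then obtain \<tau> \<pi> where fac: "\<And>g. g \<in> carrier G \<Longrightarrow> \<tau> g \<in> T \<and> \<pi> g \<in> P \<and> g = \<tau> g \<otimes> \<pi> g"
    by metis
  have \<tau>: "\<tau> g \<in> T" "\<tau> g \<in> carrier G" and \<pi>: "\<pi> g \<in> P" "\<pi> g \<in> carrier G" and g_eq: "\<tau> g \<otimes> \<pi> g = g"
    if "g \<in> carrier G" for g
    using fac[OF that] T.mem_carrier P.mem_carrier by auto
  have uniq: "\<tau> (t \<otimes> q) = t \<and> \<pi> (t \<otimes> q) = q" if "t \<in> T" "q \<in> P" for t q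
  proof -
    define g where "g = t \<otimes> q"
    have c: "t \<in> carrier G" "q \<in> carrier G" using that T.mem_carrier P.mem_carrier by auto
    then have g: "g \<in> carrier G" by (simp add: g_def)
    have eq: "\<tau> g \<otimes> \<pi> g = t \<otimes> q" using g_eq[OF g] by (simp add: g_def)
    have "inv t \<otimes> \<tau> g = q \<otimes> inv (\<pi> g)"
    proof -
      have "inv t \<otimes> (\<tau> g \<otimes> \<pi> g) \<otimes> inv (\<pi> g) = inv t \<otimes> (t \<otimes> q) \<otimes> inv (\<pi> g)" using eq by simp
      then show ?thesis using c \<tau>[OF g] \<pi>[OF g] by (simp add: m_assoc inv_mult_cancel)
    qed
    moreover have "inv t \<otimes> \<tau> g \<in> T" using that \<tau>[OF g] by simp
    moreover have "q \<otimes> inv (\<pi> g) \<in> P" using that \<pi>[OF g] by simp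
    ultimately have "inv t \<otimes> \<tau> g \<in> T \<inter> P" by simp
    then have "inv t \<otimes> \<tau> g = \<one>" using TP by blast
    then have "t \<otimes> (inv t \<otimes> \<tau> g) = t" using c by simp
    then have "\<tau> g = t" using c \<tau>[OF g] by (simp add: inv_mult_cancel)
    moreover have "\<pi> g = q" using eq c \<pi>[OF g] \<open>\<tau> g = t\<close> by simp
    ultimately show ?thesis by (simp add: g_def)
  qed
  have shift: "\<tau> (g \<otimes> q) = \<tau> g" "\<pi> (g \<otimes> q) = \<pi> g \<otimes> q" if "g \<in> carrier G" "q \<in> P" for g q
  proof -
    have "g \<otimes> q = \<tau> g \<otimes> (\<pi> g \<otimes> q)"
      using \<tau>[OF that(1)] \<pi>[OF that(1)] P.mem_carrier[OF that(2)] g_eq[OF that(1)] by (simp flip: m_assoc)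
    then show "\<tau> (g \<otimes> q) = \<tau> g" "\<pi> (g \<otimes> q) = \<pi> g \<otimes> q"
      using uniq[of "\<tau> g" "\<pi> g \<otimes> q"] \<tau>[OF that(1)] \<pi>[OF that(1)] that by auto
  qed
  define act where "act = (\<lambda>g t. \<tau> (g \<otimes> t))"
  define \<kappa> where "\<kappa> = (\<lambda>g t. \<pi> (g \<otimes> t))"
  have actT: "act g t \<in> T" and \<kappa>P: "\<kappa> g t \<in> P" and act_\<kappa>: "act g t \<otimes> \<kappa> g t = g \<otimes> t"
    if "g \<in> carrier G" "t \<in> T" for g t
    using that \<tau> \<pi> g_eq T.mem_carrier by (auto simp: act_def \<kappa>_def)
  have act_one: "act \<one> t = t" if "t \<in> T" for t
    using that uniq[of t \<one>] T.mem_carrier by (simp add: act_def)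
  have cocycle: "act (g \<otimes> h) t = act g (act h t) \<and> \<kappa> (g \<otimes> h) t = \<kappa> g (act h t) \<otimes> \<kappa> h t"
    if "g \<in> carrier G" "h \<in> carrier G" "t \<in> T" for g h t
  proof -
    have "g \<otimes> h \<otimes> t = (g \<otimes> act h t) \<otimes> \<kappa> h t"
      using that T.mem_carrier P.mem_carrier actT \<kappa>P by (simp add: m_assoc act_\<kappa>)
    moreover have "g \<otimes> act h t \<in> carrier G" using that actT T.mem_carrier by simp
    ultimately show ?thesis
      using shift[of "g \<otimes> act h t" "\<kappa> h t"] \<kappa>P that by (auto simp: act_def \<kappa>_def)
  qed
  have bij: "bij_betw (act g) T T" if g: "g \<in> carrier G" for g
  proof (rule bij_betw_byWitness[where f' = "act (inv g)"])
    show "\<forall>t\<in>T. act (inv g) (act g t) = t"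
      using g cocycle[of "inv g" g] act_one by (auto simp: )
    show "\<forall>t\<in>T. act g (act (inv g) t) = t"
      using g cocycle[of g "inv g"] act_one by (auto simp: )
  qed (use actT g in auto)
  define V where "V = (\<lambda>g. \<Prod>t\<in>T. \<nu> (\<kappa> g t))"
  have V: "p_character p G V"
    unfolding p_character_def
  proof (intro conjI ballI)
    fix g h assume gh: "g \<in> carrier G" "h \<in> carrier G"
    have "V (g \<otimes> h) = (\<Prod>t\<in>T. \<nu> (\<kappa> g (act h t)) * \<nu> (\<kappa> h t))"
      unfolding V_def using gh cocycle \<kappa>P actT \<nu>_mult by (intro prod.cong) auto
    also have "\<dots> = (\<Prod>t\<in>T. \<nu> (\<kappa> g (act h t))) * V h" by (simp add: prod.distrib V_def)
    also have "(\<Prod>t\<in>T. \<nu> (\<kappa> g (act h t))) = V g"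
      unfolding V_def by (rule prod.reindex_bij_betw[OF bij[OF gh(2)]])
    finally show "V (g \<otimes> h) = V g * V h" .
  next
    fix g assume "g \<in> carrier G"
    then show "V g ^ p = 1"
      unfolding V_def prod_power_distrib using \<kappa>P \<nu>_p by (intro prod.neutral) auto
  qed
  note V_mult = p_character_mult[OF V p0]
    and V_pow = p_character_nat_pow[OF V p0] and V_0 = p_character_nonzero[OF V p0]
  have main: "\<nu> u = 1" if "u \<in> P" "V u = 1" for u
    using that
  proof (induction "ord u" arbitrary: u rule: less_induct)
    case less
    have uc: "u \<in> carrier G" using less.prems P.mem_carrier by blast
    have ord_u: "ord u > 0" using ord_ge_1[OF fin uc] by simp
    have iter_act: "act (u [^] (i + j)) t = act (u [^] i) (act (u [^] j) t)" if "t \<in> T" for i j :: nat and t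
      using that uc cocycle[of "u [^] i" "u [^] j" t] by (simp add: nat_pow_mult)
    have cyc: "(\<Prod>s\<in>(\<lambda>i. act (u [^] i) t) ` (UNIV :: nat set). \<nu> (\<kappa> u s)) = 1"
      if t: "t \<in> T" and nofix: "act u t \<noteq> t" for t
    proof -
      \<comment> \<open>The length of the cycle of \<open>u\<close> through \<open>t\<close>.\<close>
      define f where "f = (LEAST i::nat. 0 < i \<and> act (u [^] i) t = t)"
      have ex: "0 < ord u \<and> act (u [^] ord u) t = t" using ord_u uc act_one t by simp
      have f: "0 < f" "act (u [^] f) t = t"
        using LeastI[of "\<lambda>i. 0 < i \<and> act (u [^] i) t = t", OF ex] by (auto simp: f_def)
      have f_least: "f \<le> i" if "0 < i" "act (u [^] i) t = t" for i
        unfolding f_def using that by (intro Least_le) simp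
      have "f \<noteq> 1" using f(2) nofix uc by auto
      have mult_f: "act (u [^] (k * f)) t = t" for k
        by (induction k) (use act_one t f in \<open>simp_all add: iter_act\<close>)
      have mod_f: "act (u [^] i) t = act (u [^] (i mod f)) t" for i
      proof -
        have "act (u [^] (i mod f + (i div f) * f)) t = act (u [^] (i mod f)) t"
          by (subst iter_act[OF t]) (subst mult_f, rule refl)
        then show ?thesis by (simp only: mod_div_mult_eq)
      qed
      have "ord u mod f = 0"
        using f_least[of "ord u mod f"] mod_f[of "ord u"] ex f(1)
        by (metis mod_less_divisor not_gr_zero not_less)
      then obtain e where e: "ord u = f * e" by (metis dvd_def mod_eq_0_iff_dvd)
      have img: "(\<lambda>i. act (u [^] i) t) ` (UNIV :: nat set) = (\<lambda>i. act (u [^] i) t) ` {..<f}"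
      proof
        show "(\<lambda>i. act (u [^] i) t) ` (UNIV :: nat set) \<subseteq> (\<lambda>i. act (u [^] i) t) ` {..<f}"
        proof
          fix r assume "r \<in> (\<lambda>i. act (u [^] i) t) ` (UNIV :: nat set)"
          then obtain i :: nat where "r = act (u [^] i) t" by blast
          then have "r = act (u [^] (i mod f)) t" by (rule trans[OF _ mod_f])
          moreover have "i mod f \<in> {..<f}" using f(1) by simp
          ultimately show "r \<in> (\<lambda>i. act (u [^] i) t) ` {..<f}" by (rule image_eqI)
        qed
      qed auto
      have inj: "inj_on (\<lambda>i. act (u [^] i) t) {..<f}"
      proof -
        have le: "i = j" if ij: "i \<le> j" "j < f" "act (u [^] i) t = act (u [^] j) t" for i j
        proof (rule ccontr)
          assume "i \<noteq> j"
          have "act (u [^] ((f - j) + i)) t = act (u [^] ((f - j) + j)) t"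
            by (simp only: iter_act[OF t] ij(3))
          then have "act (u [^] ((f - j) + i)) t = t" using f ij by simp
          then have "f \<le> (f - j) + i" using f_least ij by simp
          then show False using ij \<open>i \<noteq> j\<close> by simp
        qed
        show ?thesis by (intro inj_onI) (metis le lessThan_iff nat_le_linear)
      qed
      have prod_\<kappa>: "(\<Prod>i<k. \<nu> (\<kappa> u (act (u [^] i) t))) = \<nu> (\<kappa> (u [^] k) t)" for k :: nat
      proof (induction k)
        case 0
        have "\<kappa> \<one> t = \<one>" using t uniq[of t \<one>] T.mem_carrier by (simp add: \<kappa>_def)
        then show ?case using PG.p_character_one[OF \<nu> p0] by simp
      next
        case (Suc k)
        have "\<kappa> (u [^] Suc k) t = \<kappa> u (act (u [^] k) t) \<otimes> \<kappa> (u [^] k) t"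
          using cocycle[of u "u [^] k" t] uc t nat_pow_Suc2[OF uc] by simp
        then show ?case using Suc \<nu>_mult \<kappa>P actT uc t by simp
      qed
      \<comment> \<open>As \<open>u ^ f\<close> fixes \<open>t\<close>, this is the conjugate of \<open>u ^ f\<close> by the inverse of \<open>t\<close>.\<close>
      define z where "z = \<kappa> (u [^] f) t"
      have zP: "z \<in> P" and zc: "z \<in> carrier G" using \<kappa>P uc t P.mem_carrier by (auto simp: z_def)
      have tc: "t \<in> carrier G" using t T.mem_carrier by blast
      have tz: "t \<otimes> z = u [^] f \<otimes> t" using act_\<kappa>[of "u [^] f" t] f uc t by (simp add: z_def)
      have "V t * V z = V u ^ f * V t" using tz tc zc uc by (metis V_mult V_pow nat_pow_closed)
      then have "V z = 1" using less.prems V_0[OF tc] by simp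
      moreover have "ord z < ord u"
      proof -
        have ue: "u [^] (f * e) = \<one>" using pow_ord_eq_1[OF uc] unfolding e .
        have "t \<otimes> z [^] k = (u [^] f) [^] k \<otimes> t" for k :: nat
        proof (induction k)
          case (Suc k)
          have "t \<otimes> z [^] Suc k = (t \<otimes> z [^] k) \<otimes> z" using tc zc by (simp add: m_assoc)
          also have "\<dots> = (u [^] f) [^] k \<otimes> (t \<otimes> z)" using Suc tc zc uc by (simp add: m_assoc)
          also have "\<dots> = (u [^] f) [^] Suc k \<otimes> t" using tc uc by (simp add: tz m_assoc)
          finally show ?case .
        qed (use tc in simp)
        from this[of e] have "t \<otimes> z [^] e = t" using uc tc ue by (simp add: nat_pow_pow)
        then have "z [^] e = \<one>" using tc zc by simp
        then have "ord z dvd e" using pow_eq_id[OF zc] by blast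
        moreover have e0: "0 < e" using ord_u unfolding e by simp
        ultimately have "ord z \<le> e" by (rule dvd_imp_le)
        moreover have "1 * e < f * e" using e0 f(1) \<open>f \<noteq> 1\<close> by (intro mult_strict_right_mono) auto
        ultimately show ?thesis unfolding e by linarith
      qed
      ultimately have "\<nu> z = 1" using less.hyps zP by blast
      then show ?thesis
        unfolding img by (subst prod.reindex[OF inj]) (simp add: comp_def prod_\<kappa> z_def)
    qed
    have orbit_in: "t \<in> (\<lambda>q. act q t) ` P" if "t \<in> T" for t
      using that act_one P.one_closed by (metis imageI)
    have orbit_eq: "(\<lambda>q. act q s) ` P = (\<lambda>q. act q t) ` P" if t: "t \<in> T" and s: "s \<in> (\<lambda>q. act q t) ` P" for s t
    proof -
      obtain q where q: "q \<in> P" "s = act q t" using s by blast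
      have qc: "q \<in> carrier G" using q P.mem_carrier by blast
      have fwd: "act r s = act (r \<otimes> q) t" if "r \<in> P" for r
        using that q qc t P.mem_carrier cocycle by simp
      have bwd: "act r t = act (r \<otimes> inv q) s" if "r \<in> P" for r
      proof -
        have "act (r \<otimes> inv q) (act q t) = act (r \<otimes> inv q \<otimes> q) t"
          using that qc t P.mem_carrier cocycle by simp
        then show ?thesis using that qc P.mem_carrier by (simp add: q m_assoc)
      qed
      show ?thesis
      proof (intro subset_antisym image_subsetI)
        fix r assume r: "r \<in> P"
        show "act r s \<in> (\<lambda>q. act q t) ` P"
          by (rule image_eqI[where x = "r \<otimes> q"]) (use fwd r q in auto)
        show "act r t \<in> (\<lambda>q. act q s) ` P"
          by (rule image_eqI[where x = "r \<otimes> inv q"]) (use bwd r q(1) in auto)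
      qed
    qed
    have orbit_T: "act q t \<in> T - {\<one>}" if t: "t \<in> T - {\<one>}" and q: "q \<in> P" for q t
    proof -
      have c: "q \<in> carrier G" "t \<in> carrier G" using t q T.mem_carrier P.mem_carrier by auto
      have "act q t \<noteq> \<one>"
      proof
        assume "act q t = \<one>"
        then have "q \<otimes> t = \<kappa> q t" using act_\<kappa>[of q t] \<kappa>P[of q t] t c P.mem_carrier by simp
        then have "t = inv q \<otimes> \<kappa> q t" using c by (metis inv_mult_cancel(1))
        then have "t \<in> P" using q \<kappa>P[of q t] t c by (metis DiffD1 P.m_closed P.m_inv_closed)
        then show False using t TP by blast
      qed
      then show ?thesis using actT[of q t] t c by simp
    qed
    have orbit_prod: "(\<Prod>s\<in>(\<lambda>q. act q t) ` P. \<nu> (\<kappa> u s)) = 1" if t: "t \<in> T - {\<one>}" for t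
    proof (cases "\<exists>s\<in>(\<lambda>q. act q t) ` P. act u s = s")
      case False
      let ?O = "(\<lambda>q. act q t) ` P"
      have OT: "?O \<subseteq> T" using orbit_T[OF t] by auto
      have O_closed: "act q s \<in> ?O" if "s \<in> ?O" "q \<in> P" for q s
        using orbit_eq[OF _ that(1)] t that(2) by blast
      show ?thesis
      proof (rule prod_eq_1_by_orbits[where orb = "\<lambda>s. (\<lambda>i. act (u [^] i) s) ` (UNIV :: nat set)"])
        show "finite ?O" using OT finT finite_subset by blast
        fix s assume s: "s \<in> ?O"
        then have sT: "s \<in> T" using OT by blast
        show "s \<in> (\<lambda>i. act (u [^] i) s) ` (UNIV :: nat set)"
          using act_one[OF sT] by (metis nat_pow_0 rangeI)
        have "u [^] i \<in> P" for i :: nat by (induction i) (use less.prems in auto)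
        then show "(\<lambda>i. act (u [^] i) s) ` (UNIV :: nat set) \<subseteq> ?O" using O_closed s by blast
        show "(\<Prod>r\<in>(\<lambda>i. act (u [^] i) s) ` (UNIV :: nat set). \<nu> (\<kappa> u r)) = 1"
          using cyc[OF sT] False s by blast
        fix r assume "r \<in> (\<lambda>i. act (u [^] i) s) ` (UNIV :: nat set)"
        then obtain i :: nat where i: "r = act (u [^] i) s" by blast
        have fwd: "act (u [^] j) r = act (u [^] (j + i)) s" for j :: nat using iter_act[OF sT] i by simp
        have bwd: "act (u [^] j) s = act (u [^] (j + (ord u - 1) * i)) r" for j :: nat
        proof -
          have "act (u [^] (j + (ord u - 1) * i)) r = act (u [^] (j + (ord u - 1) * i + i)) s"
            using iter_act[OF sT] i by simp
          also have "j + (ord u - 1) * i + i = j + ord u * i" using ord_u by (cases "ord u") auto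
          also have "u [^] (j + ord u * i) = u [^] j"
            using uc by (simp flip: nat_pow_mult nat_pow_pow)
          finally show ?thesis by simp
        qed
        show "(\<lambda>j. act (u [^] j) r) ` (UNIV :: nat set) = (\<lambda>j. act (u [^] j) s) ` (UNIV :: nat set)"
        proof (intro subset_antisym image_subsetI)
          fix j :: nat
          show "act (u [^] j) r \<in> (\<lambda>j. act (u [^] j) s) ` (UNIV :: nat set)"
            unfolding fwd by (rule image_eqI[OF refl UNIV_I])
          show "act (u [^] j) s \<in> (\<lambda>j. act (u [^] j) r) ` (UNIV :: nat set)"
            unfolding bwd by (rule image_eqI[OF refl UNIV_I])
        qed
      qed
    next
      case True
      then obtain s where s: "s \<in> (\<lambda>q. act q t) ` P" "act u s = s" by blast
      have sT: "s \<in> T - {\<one>}" using s(1) orbit_T[OF t] by auto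
      have O: "(\<lambda>q. act q t) ` P = (\<lambda>q. act q s) ` P" using orbit_eq[OF _ s(1)] t by simp
      have OT: "(\<lambda>q. act q s) ` P \<subseteq> T" using orbit_T[OF sT] by auto
      have "\<exists>q\<in>P. act q s \<noteq> s"
      proof (rule ccontr)
        assume no: "\<not> (\<exists>q\<in>P. act q s \<noteq> s)"
        have "inv s \<otimes> q \<otimes> s \<in> P" if q: "q \<in> P" for q
        proof -
          have c: "q \<in> carrier G" "s \<in> carrier G" using q sT P.mem_carrier T.mem_carrier by auto
          have "q \<otimes> s = s \<otimes> \<kappa> q s" using act_\<kappa>[of q s] no q sT c by auto
          then have "inv s \<otimes> q \<otimes> s = \<kappa> q s"
            using c \<kappa>P[of q s] sT P.mem_carrier by (simp add: m_assoc inv_mult_cancel)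
          then show ?thesis using \<kappa>P[of q s] sT c by simp
        qed
        then show False using norm[of s] sT by blast
      qed
      then have nontriv: "\<exists>q\<in>carrier ?P. act q s \<noteq> s" by simp
      define X where "X = (\<lambda>q. act q s) ` P"
      have XT: "r \<in> T" if "r \<in> X" for r using that OT by (auto simp: X_def)
      have sX: "s \<in> X" unfolding X_def using orbit_in sT by blast
      have X_closed: "act q r \<in> X" if "q \<in> P" "r \<in> X" for q r
        using orbit_eq[of s r] that sT by (auto simp: X_def)
      have "(\<Prod>r\<in>X. \<nu> (\<kappa> u r)) = 1"
      proof (rule PP.cocycle_prod_trivial[where act = act and c = "\<lambda>g r. \<nu> (\<kappa> g r)" and ?t0.0 = s,
            OF xy p(2) _ _ _ _ sX nontriv])
        show "act g r \<in> X" if "g \<in> carrier ?P" "r \<in> X" for g r using that X_closed by simp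
        show "act \<one>\<^bsub>?P\<^esub> r = r" if "r \<in> X" for r using that XT act_one by simp
        show "act (g \<otimes>\<^bsub>?P\<^esub> h) r = act g (act h r)"
          if "g \<in> carrier ?P" "h \<in> carrier ?P" "r \<in> X" for g h r
          using cocycle[of g h r] that XT P.mem_carrier by simp
        show "X = (\<lambda>q. act q s) ` carrier ?P" by (simp add: X_def)
        show "\<nu> (\<kappa> (g \<otimes>\<^bsub>?P\<^esub> h) r) = \<nu> (\<kappa> g (act h r)) * \<nu> (\<kappa> h r)"
          if "g \<in> carrier ?P" "h \<in> carrier ?P" "r \<in> X" for g h r
        proof -
          have c: "g \<in> carrier G" "h \<in> carrier G" using that P.mem_carrier by auto
          then show ?thesis
            using cocycle[of g h r] that(3) XT \<nu>_mult[OF \<kappa>P \<kappa>P, of g "act h r" h r] actT by simp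
        qed
        show "\<nu> (\<kappa> g r) ^ p = 1" if "g \<in> carrier ?P" "r \<in> X" for g r
          using \<nu>_p[OF \<kappa>P[of g r]] that XT P.mem_carrier by simp
      qed (use less.prems s in auto)
      then show ?thesis unfolding O X_def .
    qed
    have "(\<Prod>t\<in>T - {\<one>}. \<nu> (\<kappa> u t)) = 1"
    proof (rule prod_eq_1_by_orbits[where orb = "\<lambda>t. (\<lambda>q. act q t) ` P"])
      show "finite (T - {\<one>})" using finT by simp
      fix t assume t: "t \<in> T - {\<one>}"
      then have tT: "t \<in> T" by blast
      show "t \<in> (\<lambda>q. act q t) ` P" by (rule orbit_in[OF tT])
      show "(\<lambda>q. act q t) ` P \<subseteq> T - {\<one>}" using orbit_T[OF t] by (rule image_subsetI)
      show "(\<lambda>q. act q s) ` P = (\<lambda>q. act q t) ` P" if "s \<in> (\<lambda>q. act q t) ` P" for s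
        by (rule orbit_eq[OF tT that])
      show "(\<Prod>s\<in>(\<lambda>q. act q t) ` P. \<nu> (\<kappa> u s)) = 1" by (rule orbit_prod[OF t])
    qed
    moreover have "V u = \<nu> (\<kappa> u \<one>) * (\<Prod>t\<in>T - {\<one>}. \<nu> (\<kappa> u t))"
      unfolding V_def by (rule prod.remove[OF finT T.one_closed])
    moreover have "\<kappa> u \<one> = u"
      using uniq[of \<one> u] less.prems uc by (simp add: \<kappa>_def)
    ultimately show ?case using less.prems by simp
  qed
  show ?thesis using that V main by blast
qed

section \<open>Splitting of metacyclic p-groups\<close>

context finite_p_group
begin

lemma subgroup_if_mult_closed:
  assumes "\<one> \<in> M" "M \<subseteq> carrier G" "\<And>g h. g \<in> M \<Longrightarrow> h \<in> M \<Longrightarrow> g \<otimes> h \<in> M"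
  shows "subgroup M G"
proof (rule subgroupI)
  fix g assume g: "g \<in> M"
  then have gc: "g \<in> carrier G" using assms by blast
  have "g [^] (k::nat) \<in> M" for k by (induction k) (use g assms in auto)
  moreover have "inv g = g [^] (p ^ n - 1)"
  proof (rule inv_equality)
    have "g [^] (p ^ n - 1) \<otimes> g = g [^] Suc (p ^ n - 1)" by simp
    also have "Suc (p ^ n - 1) = p ^ n" using prime_gt_0_nat[OF p] by simp
    finally show "g [^] (p ^ n - 1) \<otimes> g = \<one>" using pow_order[OF gc] by simp
  qed (use gc in auto)
  ultimately show "inv g \<in> M" by simp
qed (use assms in auto)

text \<open>In a group of odd order every element is a fixed power of its square, so that squaring is
injective and elements can be halved.\<close>

lemma odd_order_square_root:
  assumes "odd p" "g \<in> carrier G"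
  shows "(g \<otimes> g) [^] ((p ^ n + 1) div 2) = g"
proof -
  have "2 * ((p ^ n + 1) div 2) = p ^ n + 1" using assms(1) by simp
  moreover have "g \<otimes> g = g [^] (2::nat)" using assms(2) by (simp add: numeral_2_eq_2)
  ultimately have "(g \<otimes> g) [^] ((p ^ n + 1) div 2) = g [^] (p ^ n + 1)"
    using assms(2) by (simp only: nat_pow_pow)
  then show ?thesis using pow_order[OF assms(2)] assms(2) by simp
qed

text \<open>Put \<open>d = a b\<^sup>-\<^sup>1\<close> and \<open>z = [a, b]\<close>. Both are inverted by \<open>\<alpha>\<close>, and they commute: since
\<open>\<langle>z\<rangle>\<close> is normal, \<open>d z d\<^sup>-\<^sup>1\<close> is a power \<open>z ^ k\<close>, applying \<open>\<alpha>\<close> gives the same power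
for \<open>d\<^sup>-\<^sup>1 z d\<close>, so \<open>d\<^sup>2\<close> commutes with \<open>z\<close> and hence \<open>d\<close> does. Half of \<open>d\<close> turns \<open>b\<close>
into an element \<open>c\<close> fixed by \<open>\<alpha>\<close>, and \<open>d\<close> and \<open>c\<close> generate the group. An element that is both
fixed and inverted is trivial, so the abelian normal subgroup \<open>M = \<langle>d, z\<rangle>\<close> has the complement
\<open>\<langle>c\<rangle>\<close>.

The point is that \<open>M\<close> is generated by \<open>d\<close> alone. Otherwise some character \<open>\<psi>\<close> of \<open>M\<close> is
trivial on \<open>d\<close> and not on \<open>z\<close>. Write \<open>x = m e\<close> with \<open>m\<close> in \<open>M\<close> and \<open>e\<close> in \<open>\<langle>c\<rangle>\<close>. As a
commutator, \<open>z = x ^ f\<close> with \<open>p\<close> dividing \<open>f\<close>; expanding \<open>(m e) ^ f\<close> shows that \<open>\<psi> z\<close> is a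
product of \<open>\<psi>\<close> over \<open>f\<close> conjugates of \<open>m\<close> by powers of \<open>e\<close>, which is \<open>1\<close>.\<close>

lemma swap_automorphism_split:
  assumes xy: "metacyclic_pair G x y" and odd: "odd p"
    and ab: "a \<in> carrier G" "b \<in> carrier G" and gen: "generate G {a, b} = carrier G"
    and \<alpha>: "\<alpha> \<in> hom G G" "\<alpha> a = b" "\<alpha> b = a"
  obtains d c where "d \<in> carrier G" "c \<in> carrier G" "generate G {d} \<lhd> G"
    "generate G {d} \<inter> generate G {c} = {\<one>}" "generate G {d} <#> generate G {c} = carrier G"
proof -
  interpret \<alpha>: group_hom G G \<alpha> by unfold_locales (rule \<alpha>(1))
  note fin = finite_carrier
  have x: "x \<in> carrier G" and N: "generate G {x} \<lhd> G" using xy by (auto simp: metacyclic_pair_def)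
  define i where "i = (p ^ n + 1) div 2"
  define d where "d = a \<otimes> inv b"
  define c where "c = d [^] i \<otimes> b"
  have d: "d \<in> carrier G" and c: "c \<in> carrier G" using ab by (auto simp: d_def c_def)
  have a_eq: "a = d \<otimes> b" using ab by (simp add: d_def m_assoc)
  have \<alpha>d: "\<alpha> d = inv d" using ab \<alpha> by (simp add: d_def inv_mult_group)
  have dd: "d [^] i \<otimes> d [^] i = d"
    using odd_order_square_root[OF odd d] d by (simp add: i_def pow_mult_distrib)
  have \<alpha>c: "\<alpha> c = c"
  proof -
    have "\<alpha> c = inv (d [^] i) \<otimes> (d \<otimes> b)"
      using d ab \<alpha> by (simp add: c_def \<alpha>.hom_nat_pow \<alpha>d nat_pow_inv flip: a_eq)
    also have "\<dots> = inv (d [^] i) \<otimes> (d [^] i \<otimes> d [^] i) \<otimes> b" using d ab dd by (simp add: m_assoc)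
    also have "\<dots> = c" using d ab by (simp add: c_def m_assoc inv_mult_cancel)
    finally show ?thesis .
  qed
  obtain f0 where f0: "int p dvd f0" "a \<otimes> b = x [^] (f0::int) \<otimes> (b \<otimes> a)"
    using metacyclic_pair_commutator[OF xy ab] by blast
  define z where "z = x [^] f0"
  have z: "z \<in> carrier G" using x by (simp add: z_def)
  have zN: "z \<in> generate G {x}" unfolding z_def using generate_pow[OF x] by blast
  \<comment> \<open>A nonnegative exponent that is still divisible by \<open>p\<close>, even when \<open>n = 0\<close>: reduce modulo
    \<open>p * p ^ n\<close> instead of \<open>p ^ n\<close>.\<close>
  obtain f where f: "p dvd f" "z = x [^] (f::nat)"
  proof -
    define K where "K = int (p * p ^ n)"
    have K: "K > 0" using prime_gt_0_nat[OF p] by (simp add: K_def)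
    have nn: "int (nat (f0 mod K)) = f0 mod K" using K by simp
    have "ord x dvd p ^ n" using pow_order[OF x] pow_eq_id[OF x] by blast
    then have "ord x dvd p * p ^ n" by simp
    then have "int (ord x) dvd K" unfolding K_def by (simp only: int_dvd_int_iff)
    then have "int (ord x) dvd f0 mod K - f0" by (metis dvd_trans dvd_minus_mod dvd_diff_commute)
    then have "x [^] f0 = x [^] (f0 mod K)" using int_pow_eq[OF x] by blast
    then have "z = x [^] nat (f0 mod K)" using nn by (metis z_def int_pow_int)
    moreover have "int p dvd f0 mod K" using f0(1) by (simp add: K_def dvd_mod)
    then have "p dvd nat (f0 mod K)" using nn by (metis int_dvd_int_iff)
    ultimately show ?thesis using that by blast
  qed
  have z_eq: "z = (a \<otimes> b) \<otimes> inv (b \<otimes> a)" using f0(2) ab z by (simp add: z_def m_assoc)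
  have \<alpha>z: "\<alpha> z = inv z" unfolding z_eq using ab \<alpha> by (simp add: inv_mult_group m_assoc)
  have db: "d \<otimes> b = z \<otimes> (b \<otimes> d)"
  proof -
    have "d \<otimes> b \<otimes> b = z \<otimes> (b \<otimes> d) \<otimes> b"
      using f0(2) ab d z by (simp add: z_def[symmetric] a_eq m_assoc)
    then show ?thesis using ab d z by simp
  qed
  have dz: "d \<otimes> z = z \<otimes> d"
  proof -
    obtain k :: nat where k: "d \<otimes> z \<otimes> inv d = z [^] k"
      using cyclic_normal_conj[OF x N d] zN by metis
    have "\<alpha> (d \<otimes> z \<otimes> inv d) = \<alpha> (z [^] k)" using k by simp
    then have "inv d \<otimes> inv z \<otimes> d = inv (z [^] k)"
      using d z by (simp add: \<alpha>d \<alpha>z \<alpha>.hom_nat_pow nat_pow_inv)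
    then have "inv (inv d \<otimes> inv z \<otimes> d) = z [^] k" using z by simp
    then have "inv d \<otimes> z \<otimes> d = d \<otimes> z \<otimes> inv d" using d z k by (simp add: inv_mult_group m_assoc)
    then have "d \<otimes> (inv d \<otimes> z \<otimes> d) \<otimes> d = d \<otimes> (d \<otimes> z \<otimes> inv d) \<otimes> d" by simp
    then have "d \<otimes> d \<otimes> z = z \<otimes> (d \<otimes> d)" using d z by (simp add: m_assoc inv_mult_cancel)
    then have "(d \<otimes> d) [^] i \<otimes> z = z \<otimes> (d \<otimes> d) [^] i" using d z by (intro group_commutes_pow) auto
    then show ?thesis using odd_order_square_root[OF odd d] by (simp add: i_def)
  qed
  have dz_pow: "z [^] t \<otimes> d [^] s = d [^] s \<otimes> z [^] t" for s t :: nat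
  proof -
    have "d [^] s \<otimes> z = z \<otimes> d [^] s" by (rule group_commutes_pow[OF dz d z])
    then have "z \<otimes> d [^] s = d [^] s \<otimes> z" by simp
    then show ?thesis by (rule group_commutes_pow) (use d z in auto)
  qed
  have dc: "d \<otimes> c = z \<otimes> (c \<otimes> d)"
  proof -
    have "d \<otimes> c = d [^] i \<otimes> (d \<otimes> b)" using d ab nat_pow_comm[of d 1 i] by (simp add: c_def flip: m_assoc)
    also have "\<dots> = (d [^] i \<otimes> z) \<otimes> (b \<otimes> d)" using d ab z by (simp add: db m_assoc)
    also have "d [^] i \<otimes> z = z \<otimes> d [^] i" using dz_pow[of 1 i] z by simp
    also have "z \<otimes> d [^] i \<otimes> (b \<otimes> d) = z \<otimes> (c \<otimes> d)" using d ab z by (simp add: c_def m_assoc)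
    finally show ?thesis .
  qed
  have cdc: "c \<otimes> d \<otimes> inv c = inv z \<otimes> d"
  proof -
    have "inv z \<otimes> (d \<otimes> c) \<otimes> inv c = c \<otimes> d \<otimes> inv c" using c d z by (simp add: dc inv_mult_cancel)
    then show ?thesis using c d z by (simp add: m_assoc)
  qed
  have gen_dc: "generate G {d, c} = carrier G"
  proof
    show "generate G {d, c} \<subseteq> carrier G" using d c by (intro generate_incl) auto
    have sub: "subgroup (generate G {d, c}) G" using d c by (intro generate_is_subgroup) auto
    interpret D: subgroup "generate G {d, c}" G by (rule sub)
    have dD: "d \<in> generate G {d, c}" and cD: "c \<in> generate G {d, c}" by (auto intro: generate.incl)
    have "d [^] i \<in> generate G {d, c}" using subgroup_int_pow_closed[OF sub dD, of "int i"] by (simp add: int_pow_int)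
    then have "inv (d [^] i) \<otimes> c \<in> generate G {d, c}" using cD by simp
    then have bD: "b \<in> generate G {d, c}" using d ab by (simp add: c_def inv_mult_cancel)
    then have "a \<in> generate G {d, c}" using dD a_eq by simp
    then show "carrier G \<subseteq> generate G {d, c}" unfolding gen[symmetric] using bD sub by (intro generate_subgroup_incl) auto
  qed
  define M where "M = {d [^] s \<otimes> z [^] t | s t. s \<in> (UNIV :: nat set) \<and> t \<in> (UNIV :: nat set)}"
  have M_I: "d [^] s \<otimes> z [^] t \<in> M" for s t :: nat by (auto simp: M_def)
  have M_E: "\<exists>(s::nat) (t::nat). m = d [^] s \<otimes> z [^] t" if "m \<in> M" for m using that by (auto simp: M_def)
  have subM: "subgroup M G"
  proof (rule subgroup_if_mult_closed)
    show "\<one> \<in> M" using M_I[of 0 0] by simp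
    show "M \<subseteq> carrier G" using M_E d z by (metis m_closed nat_pow_closed subsetI)
    fix g h assume "g \<in> M" "h \<in> M"
    then obtain s t s' t' :: nat where gh: "g = d [^] s \<otimes> z [^] t" "h = d [^] s' \<otimes> z [^] t'" using M_E by metis
    have "g \<otimes> h = d [^] s \<otimes> (z [^] t \<otimes> d [^] s') \<otimes> z [^] t'" using d z by (simp add: gh m_assoc)
    also have "\<dots> = d [^] (s + s') \<otimes> z [^] (t + t')"
      unfolding dz_pow using d z by (simp add: m_assoc flip: nat_pow_mult)
    finally show "g \<otimes> h \<in> M" using M_I by simp
  qed
  interpret M: subgroup M G by (rule subM)
  have dM: "d \<in> M" and zM: "z \<in> M" using M_I[of 1 0] M_I[of 0 1] d z by auto
  have gen_d: "generate G {d} = {d [^] k | k. k \<in> (UNIV :: nat set)}"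
    by (rule generate_pow_on_finite_carrier[OF fin d])
  have dsubM: "generate G {d} \<subseteq> M" using subM dM by (intro generate_subgroup_incl) auto
  have M_pow: "m [^] k \<in> M" if "m \<in> M" for m and k :: nat
    using subgroup_int_pow_closed[OF subM that, of "int k"] by (simp add: int_pow_int)
  have normM: "M \<lhd> G"
  proof (rule normal_if_generators_normalise[OF fin subM _ gen_dc])
    fix s m assume s: "s \<in> {d, c}" and m: "m \<in> M"
    show "s \<otimes> m \<otimes> inv s \<in> M"
    proof (cases "s = d")
      case True
      then show ?thesis using dM m by simp
    next
      case False
      then have sc: "s = c" using s by simp
      obtain j l :: nat where jl: "m = d [^] j \<otimes> z [^] l" using M_E[OF m] by blast
      obtain k :: nat where k: "c \<otimes> z \<otimes> inv c = z [^] k"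
        using cyclic_normal_conj[OF x N c] zN by metis
      have "c \<otimes> m \<otimes> inv c = (c \<otimes> d [^] j \<otimes> inv c) \<otimes> (c \<otimes> z [^] l \<otimes> inv c)"
        using c d z by (simp add: jl m_assoc inv_mult_cancel)
      also have "\<dots> = (inv z \<otimes> d) [^] j \<otimes> (z [^] k) [^] l" using c d z by (simp add: conj_pow cdc k)
      also have "\<dots> \<in> M" using dM zM M_pow by simp
      finally show ?thesis using sc by simp
    qed
  qed (use d c in auto)
  have inverted: "\<alpha> m = inv m" if mM: "m \<in> M" for m
  proof -
    obtain s t :: nat where m: "m = d [^] s \<otimes> z [^] t" using M_E[OF mM] by blast
    have "\<alpha> m = inv (d [^] s) \<otimes> inv (z [^] t)"
      using d z by (simp add: m \<alpha>.hom_nat_pow \<alpha>d \<alpha>z nat_pow_inv)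
    also have "\<dots> = inv (z [^] t \<otimes> d [^] s)" using d z by (simp add: inv_mult_group)
    finally show ?thesis by (simp add: m dz_pow)
  qed
  have fixed: "\<alpha> g = g" if "g \<in> generate G {c}" for g
    using that c by (auto simp: generate_pow \<alpha>.hom_int_pow \<alpha>c)
  \<comment> \<open>Such an element is fixed and inverted by \<open>\<alpha>\<close>, so its square is trivial.\<close>
  have trivial: "g = \<one>" if "g \<in> M" "g \<in> generate G {c}" for g
  proof -
    have g: "g \<in> carrier G" using that by simp
    have "inv g = g" using inverted fixed that by metis
    then have "g \<otimes> g = \<one>" using g by (metis r_inv)
    then show ?thesis using odd_order_square_root[OF odd g] by simp
  qed
  have prod_c: "K <#> generate G {c} = carrier G" if K: "K \<lhd> G" "d \<in> K" for K
  proof -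
    interpret K: normal K G by (rule K(1))
    have sub: "subgroup (K <#> generate G {c}) G"
      by (rule mult_norm_subgroup[OF K(1) generate_is_subgroup]) (use c in auto)
    have "d \<otimes> \<one> \<in> K <#> generate G {c}" unfolding set_mult_def using K(2) generate.one[of G "{c}"] by blast
    moreover have "\<one> \<otimes> c \<in> K <#> generate G {c}"
      unfolding set_mult_def using K.one_closed generate.incl[of c "{c}" G] by blast
    ultimately have "generate G {d, c} \<subseteq> K <#> generate G {c}"
      using sub d c by (intro generate_subgroup_incl) auto
    then show ?thesis using gen_dc subgroup.subset[OF sub] by blast
  qed
  have zd: "z \<in> generate G {d}"
  proof (rule ccontr)
    assume notin: "z \<notin> generate G {d}"
    let ?M = "G\<lparr>carrier := M\<rparr>"
    interpret MG: group ?M by (rule M.subgroup_is_group[OF is_group])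
    note p0 = prime_gt_0_nat[OF p]
    have "card M dvd p ^ n" using lagrange[OF subM] order_eq by (metis dvd_triv_right)
    then obtain k where k: "order ?M = p ^ k" using p divides_primepow_nat by (auto simp: order_def)
    have Qsub: "subgroup (generate G {d}) ?M"
      using d dsubM subM by (intro subgroup_incl generate_is_subgroup) auto
    have Qne: "generate G {d} \<noteq> carrier ?M" using notin zM by auto
    obtain \<psi> g where \<psi>: "p_character p ?M \<psi>" "\<And>q. q \<in> generate G {d} \<Longrightarrow> \<psi> q = 1"
      and g: "g \<in> carrier ?M" "\<psi> g \<noteq> 1"
      by (rule MG.p_group_character_exists[OF p k Qsub Qne]) blast
    have \<psi>_mult: "\<psi> (u \<otimes> v) = \<psi> u * \<psi> v" if "u \<in> M" "v \<in> M" for u v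
      using MG.p_character_mult[OF \<psi>(1) p0, of u v] that by simp
    have \<psi>z: "\<psi> z \<noteq> 1"
    proof
      assume 1: "\<psi> z = 1"
      obtain s t :: nat where st: "g = d [^] s \<otimes> z [^] t" using M_E[of g] g(1) by auto
      have "\<psi> (z [^] t) = 1"
        using MG.p_character_nat_pow[OF \<psi>(1) p0, of z t] zM 1 nat_pow_consistent by simp
      moreover have "\<psi> (d [^] s) = 1" using gen_d by (intro \<psi>(2)) blast
      ultimately show False using g st \<psi>_mult M_pow dM zM by simp
    qed
    have "x \<in> M <#> generate G {c}" using prod_c[OF normM dM] x by simp
    then obtain m e where me: "m \<in> M" "e \<in> generate G {c}" "x = m \<otimes> e" unfolding set_mult_def by blast
    have mc: "m \<in> carrier G" using me(1) by simp
    have subC: "subgroup (generate G {c}) G" using c by (intro generate_is_subgroup) auto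
    have ec: "e \<in> carrier G" using me(2) subgroup.mem_carrier[OF subC] by blast
    have pow: "\<exists>w\<in>M. x [^] k = w \<otimes> e [^] k \<and> \<psi> w = (\<Prod>j<k. \<psi> (e [^] j \<otimes> m \<otimes> inv (e [^] j)))" for k :: nat
    proof (induction k)
      case 0
      show ?case using M.one_closed MG.p_character_one[OF \<psi>(1) p0] by (intro bexI[of _ \<one>]) auto
    next
      case (Suc k)
      then obtain w where w: "w \<in> M" "x [^] k = w \<otimes> e [^] k"
        "\<psi> w = (\<Prod>j<k. \<psi> (e [^] j \<otimes> m \<otimes> inv (e [^] j)))" by blast
      define v where "v = e [^] k \<otimes> m \<otimes> inv (e [^] k)"
      have v: "v \<in> M" unfolding v_def using normal.inv_op_closed2[OF normM _ me(1)] ec by simp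
      have "x [^] Suc k = w \<otimes> e [^] k \<otimes> (m \<otimes> e)" using w me by simp
      also have "\<dots> = (w \<otimes> v) \<otimes> e [^] Suc k"
        using w(1) mc ec by (simp add: v_def m_assoc inv_mult_cancel)
      finally show ?case using w v \<psi>_mult by (intro bexI[of _ "w \<otimes> v"]) (auto simp: v_def)
    qed
    obtain w where w: "w \<in> M" "x [^] f = w \<otimes> e [^] f"
      "\<psi> w = (\<Prod>j<f. \<psi> (e [^] j \<otimes> m \<otimes> inv (e [^] j)))" using pow by blast
    have eC: "e [^] f \<in> generate G {c}"
      using subgroup_int_pow_closed[OF subC me(2), of "int f"] by (simp add: int_pow_int)
    have "e [^] f = inv w \<otimes> z" using w ec f(2) by (simp add: inv_mult_cancel)
    then have "e [^] f \<in> M" using w zM by simp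
    then have "e [^] f = \<one>" using trivial eC by blast
    then have "z = w" using w f(2) by simp
    moreover have "\<psi> w = 1"
      unfolding w(3) by (rule character_norm_trivial[OF xy odd normM \<psi>(1) me(1) ec f(1)])
    ultimately show False using \<psi>z by simp
  qed
  have normd: "generate G {d} \<lhd> G"
  proof (rule normal_if_generators_normalise[OF fin _ _ gen_dc])
    show subd: "subgroup (generate G {d}) G" using d by (intro generate_is_subgroup) auto
    interpret D: subgroup "generate G {d}" G by (rule subd)
    have dD: "d \<in> generate G {d}" by (rule generate.incl) simp
    fix s m assume s: "s \<in> {d, c}" and m: "m \<in> generate G {d}"
    show "s \<otimes> m \<otimes> inv s \<in> generate G {d}"
    proof (cases "s = d")
      case True
      then show ?thesis using dD m by simp
    next
      case False
      then have sc: "s = c" using s by simp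
      obtain j :: nat where j: "m = d [^] j" using m gen_d by blast
      have "c \<otimes> m \<otimes> inv c = (inv z \<otimes> d) [^] j" using c d by (simp add: j conj_pow cdc)
      moreover have "inv z \<otimes> d \<in> generate G {d}" using zd dD by simp
      ultimately show ?thesis
        using subgroup_int_pow_closed[OF subd, of "inv z \<otimes> d" "int j"] sc by (simp add: int_pow_int)
    qed
  qed (use d c in auto)
  have "generate G {d} \<inter> generate G {c} = {\<one>}"
    using trivial dsubM generate.one by blast
  moreover have "generate G {d} <#> generate G {c} = carrier G"
    by (rule prod_c[OF normd]) (auto intro: generate.incl)
  ultimately show ?thesis using that d c normd by blast
qed

end

text \<open>The group-theoretic core. If \<open>b\<close> does not generate \<open>P\<close>, some nontrivial element of \<open>T\<close>
normalises \<open>P\<close>, for otherwise a nontrivial character of \<open>P\<close> that is trivial on \<open>b\<close> would,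
by its transfer and \<open>link\<close>, be trivial on \<open>a\<close> too and so on all of \<open>P\<close>. By \<open>swap\<close> this element induces an automorphism of \<open>P\<close>
to which \<open>swap_automorphism_split\<close> applies.\<close>

lemma (in group) exact_factorisation_split:
  assumes fin: "finite (carrier G)"
    and T: "subgroup T G" and P: "subgroup P G" and TP: "T \<inter> P = {\<one>}" and prod: "T <#> P = carrier G"
    and p: "prime p" "odd p" and cardP: "card P = p ^ n"
    and xy: "metacyclic_pair (G\<lparr>carrier := P\<rparr>) x y"
    and coprime: "\<And>t. t \<in> T \<Longrightarrow> coprime (ord t) p"
    and ab: "a \<in> P" "b \<in> P" and gen: "generate G {a, b} = P"
    and link: "s \<in> T" "t \<in> T" "s \<otimes> a = b \<otimes> t"
    and swap: "\<And>t. t \<in> T \<Longrightarrow> (\<And>q. q \<in> P \<Longrightarrow> inv t \<otimes> q \<otimes> t \<in> P) \<Longrightarrow> t \<noteq> \<one> \<Longrightarrow>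
      inv t \<otimes> a \<otimes> t = b \<and> inv t \<otimes> b \<otimes> t = a"
  obtains d c where "d \<in> P" "c \<in> P" "generate G {d} \<lhd> G\<lparr>carrier := P\<rparr>"
    "generate G {d} \<inter> generate G {c} = {\<one>}" "generate G {d} <#> generate G {c} = P"
proof -
  interpret P: subgroup P G by (rule P)
  let ?P = "G\<lparr>carrier := P\<rparr>"
  interpret PG: group ?P by (rule P.subgroup_is_group[OF is_group])
  interpret PP: finite_p_group ?P p n
    by unfold_locales (use p cardP in \<open>auto simp: order_def\<close>)
  note p0 = prime_gt_0_nat[OF p(1)]
  have genP: "generate ?P K = generate G K" if "K \<subseteq> P" for K
    by (rule generate_consistent[OF that P])
  have inT: "t \<in> carrier G" if "t \<in> T" for t using that subgroup.mem_carrier[OF T] by blast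
  show ?thesis
  proof (cases "generate G {b} = P")
    case True
    have 1: "generate G {b} \<lhd> ?P" unfolding True using PG.normal_self by simp
    have 2: "generate G {b} \<inter> generate G {\<one>} = {\<one>}" unfolding True generate_one by simp
    have 3: "generate G {b} <#> generate G {\<one>} = P"
      unfolding True generate_one using P.mem_carrier by (auto simp: set_mult_def)
    show ?thesis by (rule that[OF ab(2) P.one_closed 1 2 3])
  next
    case noncyclic: False
    show ?thesis
    proof (cases "\<exists>t\<in>T. t \<noteq> \<one> \<and> (\<forall>q\<in>P. inv t \<otimes> q \<otimes> t \<in> P)")
      case True
      then obtain r where r: "r \<in> T" "r \<noteq> \<one>" and rP: "\<And>q. q \<in> P \<Longrightarrow> inv r \<otimes> q \<otimes> r \<in> P" by blast
      have rc: "r \<in> carrier G" using inT r by blast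
      have hom: "(\<lambda>q. inv r \<otimes> q \<otimes> r) \<in> hom ?P ?P"
        by (rule homI) (use rP rc P.mem_carrier in \<open>auto simp: m_assoc inv_mult_cancel\<close>)
      have sw: "inv r \<otimes> a \<otimes> r = b" "inv r \<otimes> b \<otimes> r = a" using swap[OF r(1) rP r(2)] by auto
      obtain d c where dc: "d \<in> carrier ?P" "c \<in> carrier ?P" "generate ?P {d} \<lhd> ?P"
        "generate ?P {d} \<inter> generate ?P {c} = {\<one>\<^bsub>?P\<^esub>}" "generate ?P {d} <#>\<^bsub>?P\<^esub> generate ?P {c} = carrier ?P"
        by (rule PP.swap_automorphism_split[OF xy p(2) _ _ _ hom sw]) (use ab gen genP[of "{a, b}"] in auto)
      have dcP: "d \<in> P" "c \<in> P" using dc by auto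
      have gd: "generate ?P {d} = generate G {d}" "generate ?P {c} = generate G {c}" using genP dcP by auto
      have 1: "generate G {d} \<lhd> ?P" using dc(3) unfolding gd .
      have 2: "generate G {d} \<inter> generate G {c} = {\<one>}" using dc(4) unfolding gd by simp
      have 3: "generate G {d} <#> generate G {c} = P" using dc(5) unfolding gd set_mult_consistent by simp
      show ?thesis by (rule that[OF dcP 1 2 3])
    next
      case False
      have Qsub: "subgroup (generate G {b}) ?P"
        using ab P.mem_carrier by (intro subgroup_incl generate_is_subgroup P generate_subgroup_incl) auto
      obtain \<nu> g where \<nu>: "p_character p ?P \<nu>" "\<And>q. q \<in> generate G {b} \<Longrightarrow> \<nu> q = 1"
        and g: "g \<in> carrier ?P" "\<nu> g \<noteq> 1"
        by (rule PG.p_group_character_exists[OF p(1) PP.order_eq Qsub]) (use noncyclic in auto)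
      obtain V where V: "p_character p G V" "\<And>u. u \<in> P \<Longrightarrow> V u = 1 \<Longrightarrow> \<nu> u = 1"
        by (rule transfer_character[OF fin T P TP prod p cardP xy _ \<nu>(1)]) (use False in blast)+
      note V_mult = p_character_mult[OF V(1) p0] and V_inv = p_character_inv[OF V(1) p0]
      have V_T: "V r = 1" if r: "r \<in> T" for r
      proof (rule root_of_unity_coprime)
        show "V r ^ ord r = 1"
          using p_character_nat_pow[OF V(1) p0, of r "ord r"] p_character_one[OF V(1) p0] inT[OF r] by simp
        show "V r ^ p = 1" using p_character_power[OF V(1) p0] inT[OF r] by blast
        show "coprime (ord r) p" by (rule coprime[OF r])
      qed
      have c: "a \<in> carrier G" "b \<in> carrier G" using ab P.mem_carrier by auto
      have "V s * V a = V (s \<otimes> a)" using V_mult c inT[OF link(1)] by simp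
      also have "\<dots> = V b * V t" unfolding link(3) using V_mult c inT[OF link(2)] by simp
      finally have "V a = V b" using V_T link(1,2) by simp
      then have "V (a \<otimes> inv b) = 1"
        using c p_character_nonzero[OF V(1) p0, of b] by (simp add: V_mult V_inv)
      then have "\<nu> (a \<otimes> inv b) = 1" using V(2) ab by simp
      moreover have "\<nu> (inv b) = 1" "\<nu> b = 1"
        using generate.inv[of b "{b}" G] generate.incl[of b "{b}" G] \<nu>(2) by auto
      ultimately have "\<nu> a = 1"
        using PG.p_character_mult[OF \<nu>(1) p0, of a "inv b"] ab by simp
      then have "\<nu> g = 1"
        using PG.p_character_generate[OF \<nu>(1) p0, of "{a, b}" g] \<open>\<nu> b = 1\<close> ab g gen genP[of "{a, b}"] by auto
      then show ?thesis using g by simp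
    qed
  qed
qed

section \<open>Metacyclic groups: subgroups and products\<close>

lemma int_subgroup_generator:
  fixes J :: "int set"
  assumes "0 \<in> J" and diff: "\<And>i j. i \<in> J \<Longrightarrow> j \<in> J \<Longrightarrow> i - j \<in> J"
  shows "\<exists>d\<in>J. \<forall>j\<in>J. d dvd j"
proof (cases "J = {0}")
  case False
  have neg: "- j \<in> J" if "j \<in> J" for j using diff[OF assms(1) that] by simp
  have add: "i + j \<in> J" if "i \<in> J" "j \<in> J" for i j using diff[OF that(1) neg[OF that(2)]] by simp
  obtain j where j: "j \<in> J" "j \<noteq> 0" using assms(1) False by blast
  then have ex: "0 < nat \<bar>j\<bar> \<and> int (nat \<bar>j\<bar>) \<in> J" using neg by (simp add: abs_if)
  define d where "d = (LEAST k::nat. 0 < k \<and> int k \<in> J)"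
  have d: "0 < d" "int d \<in> J" using LeastI[of "\<lambda>k. 0 < k \<and> int k \<in> J", OF ex] by (auto simp: d_def)
  have least: "d \<le> k" if "0 < k" "int k \<in> J" for k unfolding d_def using that by (intro Least_le) simp
  have mult: "int k * int d \<in> J" for k
    by (induction k) (use assms(1) d add in \<open>auto simp: algebra_simps\<close>)
  have imult: "q * int d \<in> J" for q
  proof (cases "q \<ge> 0")
    case True
    then show ?thesis using mult[of "nat q"] by simp
  next
    case False
    then show ?thesis using neg[OF mult[of "nat (- q)"]] by simp
  qed
  have "int d dvd k" if k: "k \<in> J" for k
  proof -
    have "k - (k div int d) * int d \<in> J" using diff[OF k imult] .
    then have "int (nat (k mod int d)) \<in> J" using d by (simp add: minus_div_mult_eq_mod)
    then have "k mod int d = 0" using least[of "nat (k mod int d)"] d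
      by (smt (verit) nat_less_iff not_less of_nat_0_less_iff pos_mod_bound pos_mod_sign zero_less_nat_eq)
    then show ?thesis by blast
  qed
  then show ?thesis using d by blast
qed auto

lemma (in group) metacyclic_pair_exists:
  assumes "metacyclic_group G"
  shows "\<exists>x y. metacyclic_pair G x y"
proof -
  obtain N where N: "N \<lhd> G" and cN: "cyclic_group (G\<lparr>carrier := N\<rparr>)" and cQ: "cyclic_group (G Mod N)"
    using assms by (auto simp: metacyclic_group_def)
  interpret N: normal N G by (rule N)
  interpret NG: group "G\<lparr>carrier := N\<rparr>" by (rule N.subgroup_is_group[OF is_group])
  interpret Q: group "G Mod N" by (rule N.factorgroup_is_group)
  interpret h: group_hom G "G Mod N" "\<lambda>a. N #> a"
    by unfold_locales (rule N.r_coset_hom_Mod)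
  obtain x where x: "x \<in> N" "N = range (\<lambda>k::int. x [^]\<^bsub>G\<lparr>carrier := N\<rparr>\<^esub> k)"
    using cN unfolding NG.cyclic_group by auto
  have xc: "x \<in> carrier G" using x(1) by simp
  have "N = range (\<lambda>k::int. x [^] k)" using x int_pow_consistent[OF N.subgroup_axioms x(1)] by simp
  then have Ngen: "generate G {x} = N" using generate_pow[OF xc] by auto
  obtain Y where Y: "Y \<in> carrier (G Mod N)" "carrier (G Mod N) = range (\<lambda>k::int. Y [^]\<^bsub>G Mod N\<^esub> k)"
    using cQ unfolding Q.cyclic_group by blast
  obtain y where y: "y \<in> carrier G" "Y = N #> y" using Y(1) by (auto simp: FactGroup_def RCOSETS_def)
  have "\<exists>(i::int) (j::int). g = x [^] i \<otimes> y [^] j" if g: "g \<in> carrier G" for g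
  proof -
    have "N #> g \<in> carrier (G Mod N)" using g by (rule h.hom_closed)
    then obtain j :: int where "N #> g = Y [^]\<^bsub>G Mod N\<^esub> j" using Y by auto
    then have "N #> g = N #> y [^] j" using y h.hom_int_pow by simp
    then have "g \<in> N #> y [^] j" using rcos_self[OF g N.subgroup_axioms] by simp
    then obtain k where k: "k \<in> N" "g = k \<otimes> y [^] j" by (auto simp: r_coset_def)
    then obtain i :: int where "k = x [^] i" using generate_pow[OF xc] Ngen by auto
    then show ?thesis using k by blast
  qed
  then have "metacyclic_pair G x y" using xc y N Ngen by (simp add: metacyclic_pair_def)
  then show ?thesis by blast
qed

text \<open>Intersect with \<open>N = \<langle>x\<rangle>\<close>: the exponents \<open>j\<close> with \<open>x ^ j\<close> in \<open>P\<close> form a subgroup of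
the integers, and so do the exponents \<open>j\<close> for which \<open>P\<close> meets the coset \<open>N y ^ j\<close>. Generators
of these two subgroups yield \<open>x'\<close> and \<open>y'\<close>.\<close>

lemma (in group) metacyclic_pair_subgroup:
  assumes xy: "metacyclic_pair G x y" and P: "subgroup P G"
  shows "\<exists>x' y'. metacyclic_pair (G\<lparr>carrier := P\<rparr>) x' y'"
proof -
  have x: "x \<in> carrier G" and y: "y \<in> carrier G" and N: "generate G {x} \<lhd> G"
    and ex: "\<And>g. g \<in> carrier G \<Longrightarrow> \<exists>(i::int) (j::int). g = x [^] i \<otimes> y [^] j"
    using xy by (auto simp: metacyclic_pair_def)
  interpret P: subgroup P G by (rule P)
  let ?P = "G\<lparr>carrier := P\<rparr>"
  interpret PG: group ?P by (rule P.subgroup_is_group[OF is_group])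
  define N where "N = generate G {x}"
  interpret N: normal N G unfolding N_def by (rule N)
  interpret h: group_hom G "G Mod N" "\<lambda>a. N #> a"
    using N.r_coset_hom_Mod N.factorgroup_is_group by (simp add: group_hom_def group_hom_axioms_def is_group)
  have gen: "g \<in> N \<longleftrightarrow> (\<exists>i::int. g = x [^] i)" for g using generate_pow[OF x] by (auto simp: N_def)
  have coset_eq: "N #> g = N #> k \<Longrightarrow> g \<otimes> inv k \<in> N" if "g \<in> carrier G" "k \<in> carrier G" for g k
  proof -
    assume "N #> g = N #> k"
    then have "g \<in> N #> k" using rcos_self[OF that(1) N.subgroup_axioms] by simp
    then obtain l where "l \<in> N" "g = l \<otimes> k" by (auto simp: r_coset_def)
    then show ?thesis using that by (simp add: m_assoc)
  qed
  have "\<exists>d\<in>{j::int. x [^] j \<in> P}. \<forall>j\<in>{j. x [^] j \<in> P}. d dvd j"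
    by (rule int_subgroup_generator) (use x in \<open>auto simp: int_pow_diff\<close>)
  then obtain d where d: "x [^] d \<in> P" "\<And>j::int. x [^] j \<in> P \<Longrightarrow> d dvd j" by auto
  have "\<exists>e\<in>{j::int. \<exists>g\<in>P. N #> g = N #> y [^] j}. \<forall>j\<in>{j::int. \<exists>g\<in>P. N #> g = N #> y [^] j}. e dvd j"
  proof (rule int_subgroup_generator)
    show "0 \<in> {j::int. \<exists>g\<in>P. N #> g = N #> y [^] j}"
      using P.one_closed N.subset by (auto intro!: bexI[of _ \<one>])
    fix i j assume "i \<in> {j::int. \<exists>g\<in>P. N #> g = N #> y [^] j}" "j \<in> {j::int. \<exists>g\<in>P. N #> g = N #> y [^] j}"
    then obtain g k where gk: "g \<in> P" "N #> g = N #> y [^] i" "k \<in> P" "N #> k = N #> y [^] j" by auto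
    have "N #> (g \<otimes> inv k) = N #> y [^] (i - j)"
      using gk(1,3) y h.hom_mult[of g "inv k"] h.hom_mult[of "y [^] i" "inv (y [^] j)"] h.hom_inv[of k] h.hom_inv[of "y [^] j"]
      by (simp add: gk(2,4) int_pow_diff)
    moreover have "g \<otimes> inv k \<in> P" using gk by simp
    ultimately show "i - j \<in> {j::int. \<exists>g\<in>P. N #> g = N #> y [^] j}" by blast
  qed
  then obtain e y' where y': "y' \<in> P" "N #> y' = N #> y [^] (e::int)"
    and e: "\<And>(j::int) g. g \<in> P \<Longrightarrow> N #> g = N #> y [^] j \<Longrightarrow> e dvd j" by blast
  define x' where "x' = x [^] d"
  have x': "x' \<in> P" "x' \<in> carrier G" using d x by (auto simp: x'_def)
  have gen': "generate ?P {x'} = N \<inter> P"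
  proof -
    have "generate ?P {x'} = generate G {x'}" using x' by (intro generate_consistent P) auto
    also have "\<dots> = N \<inter> P"
    proof
      show "generate G {x'} \<subseteq> N \<inter> P"
        using x' gen by (intro generate_subgroup_incl subgroups_Inter_pair N.subgroup_axioms P) (auto simp: x'_def)
      show "N \<inter> P \<subseteq> generate G {x'}"
      proof
        fix g assume g: "g \<in> N \<inter> P"
        then obtain j :: int where j: "g = x [^] j" using gen by blast
        then obtain q where "j = d * q" using g d(2)[of j] by auto
        then have "g = x' [^] q" using j x by (simp add: x'_def int_pow_pow)
        then show "g \<in> generate G {x'}" using generate_pow[OF x'(2)] by blast
      qed
    qed
    finally show ?thesis .
  qed
  have "N \<inter> P \<lhd> ?P"
  proof (rule PG.normal_invI)
    show "subgroup (N \<inter> P) ?P"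
      by (rule subgroup_incl[OF _ P]) (auto intro: subgroups_Inter_pair N.subgroup_axioms P)
    fix g k assume "g \<in> carrier ?P" "k \<in> N \<inter> P"
    then show "g \<otimes>\<^bsub>?P\<^esub> k \<otimes>\<^bsub>?P\<^esub> inv\<^bsub>?P\<^esub> g \<in> N \<inter> P"
      using N.inv_op_closed2 by (simp add: m_inv_consistent[OF P])
  qed
  moreover have "\<exists>(i::int) (j::int). g = x' [^]\<^bsub>?P\<^esub> i \<otimes>\<^bsub>?P\<^esub> y' [^]\<^bsub>?P\<^esub> j" if g: "g \<in> carrier ?P" for g
  proof -
    have gP: "g \<in> P" using g by simp
    obtain i j where ij: "g = x [^] (i::int) \<otimes> y [^] (j::int)" using ex[of g] gP by auto
    have "x [^] i \<in> N" using gen by blast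
    then have "N #> x [^] i = N" using coset_join2[OF int_pow_closed[OF x] N.subgroup_axioms] by blast
    then have Ng: "N #> g = N #> y [^] j"
      using coset_mult_assoc[OF N.subset int_pow_closed[OF x, of i] int_pow_closed[OF y, of j]]
      unfolding ij by argo
    then obtain q where q: "j = e * q" using e[OF gP] by blast
    have "N #> y' [^] q = N #> y [^] j"
      using h.hom_int_pow[of y' q] h.hom_int_pow[of "y [^] e" q] y y' by (simp add: q int_pow_pow)
    then have "g \<otimes> inv (y' [^] q) \<in> N" using coset_eq[of g "y' [^] q"] Ng gP y'(1) by simp
    moreover have yq: "y' [^] q \<in> P" by (rule subgroup_int_pow_closed[OF P y'(1)])
    ultimately have "g \<otimes> inv (y' [^] q) \<in> generate G {x'}"
      using gP gen' x' generate_consistent[of "{x'}" P] P by simp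
    then obtain l :: int where "g \<otimes> inv (y' [^] q) = x' [^] l" using generate_pow[OF x'(2)] by auto
    then have "g = x' [^] l \<otimes> y' [^] q" using gP yq by (metis P.mem_carrier inv_solve_right' int_pow_closed x'(2))
    then show ?thesis
      using int_pow_consistent[OF P x'(1)] int_pow_consistent[OF P y'(1)] by auto
  qed
  ultimately have "metacyclic_pair ?P x' y'" using x' y' by (simp add: metacyclic_pair_def gen')
  then show ?thesis by blast
qed

lemma (in group_action) subgroup_group_action:
  assumes "subgroup H G"
  shows "group_action (G\<lparr>carrier := H\<rparr>) E \<phi>"
proof -
  interpret h: group_hom G "BijGroup E" \<phi> by (rule group_hom)
  have "\<phi> \<in> hom (G\<lparr>carrier := H\<rparr>) (BijGroup E)"
    using h.hom_closed h.hom_mult subgroup.mem_carrier[OF assms] by (auto intro!: homI)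
  then show ?thesis
    unfolding group_action_def group_hom_def group_hom_axioms_def
    using h.G.subgroup_imp_group[OF assms] h.H.is_group by blast
qed

lemma (in group) metacyclic_group_product:
  assumes s: "s \<in> carrier G" and t: "t \<in> normalizer G (generate G {s})"
  shows "subgroup (generate G {s} <#> generate G {t}) G"
    and "metacyclic_group (G\<lparr>carrier := generate G {s} <#> generate G {t}\<rparr>)"
proof -
  let ?N = "generate G {s}" and ?R = "normalizer G (generate G {s})"
  let ?H = "?N <#> generate G {t}"
  have N: "subgroup ?N G" using s by (intro generate_is_subgroup) auto
  have R: "subgroup ?R G" by (rule normalizer_imp_subgroup[OF subgroup.subset[OF N]])
  have tc: "t \<in> carrier G" using t subgroup.mem_carrier[OF R] by blast
  have T: "subgroup (generate G {t}) G" using tc by (intro generate_is_subgroup) auto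
  have TR: "generate G {t} \<subseteq> ?R" using t R by (intro generate_subgroup_incl) auto
  have normR: "?N \<lhd> G\<lparr>carrier := ?R\<rparr>" by (rule subgroup_in_normalizer[OF N])
  have "subgroup ?H (G\<lparr>carrier := ?R\<rparr>)"
    by (rule mult_norm_sub_in_sub[OF normR subgroup_incl[OF T R TR] R])
  then have HR: "?H \<subseteq> ?R" and H: "subgroup ?H G"
    using subgroup.subset[of ?H "G\<lparr>carrier := ?R\<rparr>"] incl_subgroup[OF R] by auto
  then show "subgroup ?H G" by simp
  let ?HG = "G\<lparr>carrier := ?H\<rparr>"
  interpret H: subgroup ?H G by (rule H)
  interpret HG: group ?HG by (rule H.subgroup_is_group[OF is_group])
  have NH: "?N \<subseteq> ?H"
  proof
    fix g assume g: "g \<in> ?N"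
    then have "g \<otimes> \<one> \<in> ?H" unfolding set_mult_def using generate.one[of G "{t}"] by blast
    then show "g \<in> ?H" using g subgroup.mem_carrier[OF N] by simp
  qed
  have "\<one> \<otimes> t \<in> ?H"
    unfolding set_mult_def using generate.one[of G "{s}"] generate.incl[of t "{t}" G] by blast
  then have tH: "t \<in> ?H" using tc by simp
  have norm: "?N \<lhd> ?HG"
  proof (rule HG.normal_invI)
    show "subgroup ?N ?HG" by (rule subgroup_incl[OF N H NH])
    fix g k assume gk: "g \<in> carrier ?HG" "k \<in> ?N"
    then have gR: "g \<in> ?R" using HR by auto
    then have "g \<otimes> k \<otimes> inv g \<in> ?N"
      using normal.inv_op_closed2[OF normR, of g k] gk m_inv_consistent[OF R] by simp
    then show "g \<otimes>\<^bsub>?HG\<^esub> k \<otimes>\<^bsub>?HG\<^esub> inv\<^bsub>?HG\<^esub> g \<in> ?N"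
      using gk m_inv_consistent[OF H] by simp
  qed
  have cycN: "cyclic_group (?HG\<lparr>carrier := ?N\<rparr>)"
    using cyclic_group_generated[of s] s by (simp add: subgroup_generated_def)
  interpret NH: normal ?N ?HG by (rule norm)
  interpret Q: group "?HG Mod ?N" by (rule NH.factorgroup_is_group)
  interpret h: group_hom ?HG "?HG Mod ?N" "\<lambda>a. ?N #>\<^bsub>?HG\<^esub> a"
    by unfold_locales (rule NH.r_coset_hom_Mod)
  have "cyclic_group (?HG Mod ?N)"
    unfolding Q.cyclic_group
  proof (intro bexI subset_antisym)
    show tQ: "?N #>\<^bsub>?HG\<^esub> t \<in> carrier (?HG Mod ?N)" using h.hom_closed tH by simp
    show "range (\<lambda>k::int. (?N #>\<^bsub>?HG\<^esub> t) [^]\<^bsub>?HG Mod ?N\<^esub> k) \<subseteq> carrier (?HG Mod ?N)"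
      using Q.int_pow_closed[OF tQ] by blast
    show "carrier (?HG Mod ?N) \<subseteq> range (\<lambda>k::int. (?N #>\<^bsub>?HG\<^esub> t) [^]\<^bsub>?HG Mod ?N\<^esub> k)"
    proof
      fix C assume "C \<in> carrier (?HG Mod ?N)"
      then obtain g where g: "g \<in> ?H" "C = ?N #>\<^bsub>?HG\<^esub> g" by (auto simp: FactGroup_def RCOSETS_def)
      then obtain u l where ul: "u \<in> ?N" "l \<in> generate G {t}" "g = u \<otimes> l" unfolding set_mult_def by blast
      obtain k :: int where k: "l = t [^] k" using ul(2) generate_pow[OF tc] by auto
      have lH: "t [^] k \<in> ?H" by (rule subgroup_int_pow_closed[OF H tH])
      have "C = (?N #>\<^bsub>?HG\<^esub> u) #>\<^bsub>?HG\<^esub> t [^] k"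
        using HG.coset_mult_assoc[OF NH.subset, of u "t [^] k"] ul NH lH by (auto simp: g k)
      also have "?N #>\<^bsub>?HG\<^esub> u = ?N"
        by (rule HG.coset_join2[OF _ NH.subgroup_axioms ul(1)]) (use ul NH in auto)
      also have "?N #>\<^bsub>?HG\<^esub> t [^] k = (?N #>\<^bsub>?HG\<^esub> t) [^]\<^bsub>?HG Mod ?N\<^esub> k"
        using h.hom_int_pow[of t k] tH int_pow_consistent[OF H tH] by simp
      finally show "C \<in> range (\<lambda>k::int. (?N #>\<^bsub>?HG\<^esub> t) [^]\<^bsub>?HG Mod ?N\<^esub> k)" by blast
    qed
  qed
  then show "metacyclic_group ?HG"
    unfolding metacyclic_group_def using HG.is_group norm cycN by blast
qed

section \<open>Automorphism groups of graphs and metacirculants\<close>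

interpretation Aut: group "Aut \<Gamma>" for \<Gamma> by (rule group_Aut)

lemma Aut_mult_apply:
  assumes "f \<in> carrier (Aut \<Gamma>)" "g \<in> carrier (Aut \<Gamma>)" "v \<in> pverts \<Gamma>"
  shows "(f \<otimes>\<^bsub>Aut \<Gamma>\<^esub> g) v = f (g v)"
  using assms by (simp add: Aut_simps compose_eq)

lemma Aut_one_apply: "v \<in> pverts \<Gamma> \<Longrightarrow> \<one>\<^bsub>Aut \<Gamma>\<^esub> v = v"
  by (simp add: Aut_simps)

lemma Aut_vertex: "f \<in> carrier (Aut \<Gamma>) \<Longrightarrow> v \<in> pverts \<Gamma> \<Longrightarrow> f v \<in> pverts \<Gamma>"
  by (simp add: Aut_simps automorphism_vertex)

lemma Aut_inv_apply:
  assumes "f \<in> carrier (Aut \<Gamma>)" "v \<in> pverts \<Gamma>"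
  shows "(inv\<^bsub>Aut \<Gamma>\<^esub> f) (f v) = v" and "f ((inv\<^bsub>Aut \<Gamma>\<^esub> f) v) = v"
  using assms Aut_mult_apply[of "inv\<^bsub>Aut \<Gamma>\<^esub> f" \<Gamma> f v] Aut_mult_apply[of f \<Gamma> "inv\<^bsub>Aut \<Gamma>\<^esub> f" v]
  by (simp_all add: Aut_one_apply)

lemma Aut_eqI:
  assumes "f \<in> carrier (Aut \<Gamma>)" "g \<in> carrier (Aut \<Gamma>)" "\<And>v. v \<in> pverts \<Gamma> \<Longrightarrow> f v = g v"
  shows "f = g"
proof (rule extensionalityI[where A = "pverts \<Gamma>"])
  show "f \<in> extensional (pverts \<Gamma>)" "g \<in> extensional (pverts \<Gamma>)"
    using assms by (auto simp: Aut_simps automorphisms_def dest: Bij_imp_extensional)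
qed (rule assms(3))

lemma Aut_arc_iff:
  assumes "f \<in> carrier (Aut \<Gamma>)" "u \<in> pverts \<Gamma>" "v \<in> pverts \<Gamma>"
  shows "(f u, f v) \<in> parcs \<Gamma> \<longleftrightarrow> (u, v) \<in> parcs \<Gamma>"
  using assms by (simp add: Aut_simps automorphisms_def)

lemma Aut_pow_apply:
  assumes "f \<in> carrier (Aut \<Gamma>)" "v \<in> pverts \<Gamma>"
  shows "(f [^]\<^bsub>Aut \<Gamma>\<^esub> (k::nat)) v = (f ^^ k) v"
proof (induction k)
  case (Suc k)
  have "(f [^]\<^bsub>Aut \<Gamma>\<^esub> Suc k) v = (f \<otimes>\<^bsub>Aut \<Gamma>\<^esub> f [^]\<^bsub>Aut \<Gamma>\<^esub> k) v"
    using Aut.nat_pow_Suc2[OF assms(1)] by simp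
  then show ?case using Suc assms by (simp add: Aut_mult_apply)
qed (use assms in \<open>simp add: Aut_one_apply\<close>)

lemma finite_Aut:
  assumes "finite (pverts \<Gamma>)"
  shows "finite (carrier (Aut \<Gamma>))"
proof (rule finite_subset)
  show "carrier (Aut \<Gamma>) \<subseteq> PiE (pverts \<Gamma>) (\<lambda>_. pverts \<Gamma>)"
    by (auto simp: Aut_simps automorphisms_def PiE_def dest: Bij_imp_extensional Bij_imp_funcset)
  show "finite (PiE (pverts \<Gamma>) (\<lambda>_. pverts \<Gamma>))" using assms by (intro finite_PiE)
qed

lemma funpow_image:
  fixes f :: "'a \<Rightarrow> 'a"
  shows "((\<lambda>B. f ` B) ^^ k) B = (f ^^ k) ` B"
  by (induction k) (auto simp: image_image)

lemma normal_element_image_orbit: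
  assumes N: "N \<subseteq> carrier (Aut \<Gamma>)" and f: "f \<in> carrier (Aut \<Gamma>)" and v: "v \<in> pverts \<Gamma>"
    and conj: "\<And>g. g \<in> N \<Longrightarrow> f \<otimes>\<^bsub>Aut \<Gamma>\<^esub> g \<otimes>\<^bsub>Aut \<Gamma>\<^esub> inv\<^bsub>Aut \<Gamma>\<^esub> f \<in> N"
      "\<And>g. g \<in> N \<Longrightarrow> inv\<^bsub>Aut \<Gamma>\<^esub> f \<otimes>\<^bsub>Aut \<Gamma>\<^esub> g \<otimes>\<^bsub>Aut \<Gamma>\<^esub> f \<in> N"
  shows "f ` {g v | g. g \<in> N} = {g (f v) | g. g \<in> N}"
proof (intro subset_antisym subsetI)
  fix w assume "w \<in> f ` {g v | g. g \<in> N}"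
  then obtain g where g: "g \<in> N" "w = f (g v)" by blast
  have "(f \<otimes>\<^bsub>Aut \<Gamma>\<^esub> g \<otimes>\<^bsub>Aut \<Gamma>\<^esub> inv\<^bsub>Aut \<Gamma>\<^esub> f) (f v) = w"
    using g f v N by (simp add: Aut_mult_apply Aut_vertex Aut_inv_apply subset_iff)
  then show "w \<in> {g (f v) | g. g \<in> N}" using conj(1)[OF g(1)] by blast
next
  fix w assume "w \<in> {g (f v) | g. g \<in> N}"
  then obtain g where g: "g \<in> N" "w = g (f v)" by blast
  have "w = f ((inv\<^bsub>Aut \<Gamma>\<^esub> f \<otimes>\<^bsub>Aut \<Gamma>\<^esub> g \<otimes>\<^bsub>Aut \<Gamma>\<^esub> f) v)"
    using g f v N by (simp add: Aut_mult_apply Aut_vertex Aut_inv_apply subset_iff)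
  then show "w \<in> f ` {g v | g. g \<in> N}" using conj(2)[OF g(1)] by blast
qed

text \<open>Take \<open>\<sigma> = d\<close> and \<open>\<tau> = c\<close>. As \<open>P\<close> is regular, the cycle of \<open>c\<close> through \<open>v0\<close> has
length \<open>ord c\<close>, which is the index of \<open>\<langle>d\<rangle>\<close> in \<open>P\<close> and hence the number of orbits of \<open>\<langle>d\<rangle>\<close>;
and \<open>P = \<langle>d\<rangle>\<langle>c\<rangle>\<close> says that the powers of \<open>c\<close> carry the orbit of \<open>v0\<close> to every other
orbit. This is where the trivial intersection matters: it makes \<open>ord c * ord d\<close> the number
of vertices.\<close>

lemma split_regular_imp_metacirculant:
  fixes \<Gamma> :: "'a pair_pre_digraph" and P :: "('a \<Rightarrow> 'a) set"
  defines "A \<equiv> Aut \<Gamma>"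
  assumes fin: "finite (pverts \<Gamma>)" and P: "subgroup P A" and v0: "v0 \<in> pverts \<Gamma>"
    and reg: "bij_betw (\<lambda>g. g v0) P (pverts \<Gamma>)"
    and d: "d \<in> P" and c: "c \<in> P" and norm: "generate A {d} \<lhd> A\<lparr>carrier := P\<rparr>"
    and int: "generate A {d} \<inter> generate A {c} = {\<one>\<^bsub>A\<^esub>}"
    and prod: "generate A {d} <#>\<^bsub>A\<^esub> generate A {c} = P"
  shows "metacirculant \<Gamma>"
proof -
  interpret A: group A unfolding A_def by (rule group_Aut)
  interpret P: subgroup P A by (rule P)
  let ?V = "pverts \<Gamma>"
  define N where "N = generate A {d}"
  define C where "C = generate A {c}"
  have finA: "finite (carrier A)" unfolding A_def by (rule finite_Aut[OF fin])
  have dc: "d \<in> carrier A" "c \<in> carrier A" using d c by auto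
  have N: "subgroup N A" and C: "subgroup C A" using dc by (auto simp: N_def C_def intro: A.generate_is_subgroup)
  interpret N: subgroup N A by (rule N)
  interpret C: subgroup C A by (rule C)
  have NP: "N \<subseteq> P" unfolding N_def using d by (intro A.generate_subgroup_incl P) auto
  have ordd: "A.ord d = card N" and ordc: "A.ord c = card C"
    using A.generate_pow_card dc by (auto simp: N_def C_def)
  have conj: "g \<otimes>\<^bsub>A\<^esub> k \<otimes>\<^bsub>A\<^esub> inv\<^bsub>A\<^esub> g \<in> N" "inv\<^bsub>A\<^esub> g \<otimes>\<^bsub>A\<^esub> k \<otimes>\<^bsub>A\<^esub> g \<in> N"
    if "g \<in> P" "k \<in> N" for g k
    using that normal.inv_op_closed2[OF norm[folded N_def], of g k] normal.inv_op_closed1[OF norm[folded N_def], of g k]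
      A.m_inv_consistent[OF P] by auto
  have apply_mult: "(f \<otimes>\<^bsub>A\<^esub> g) v = f (g v)" if "f \<in> P" "g \<in> P" "v \<in> ?V" for f g v
    using that P.mem_carrier by (auto simp: A_def intro!: Aut_mult_apply)
  have vert: "g v \<in> ?V" if "g \<in> P" "v \<in> ?V" for g v
    by (rule Aut_vertex[OF P.mem_carrier[OF that(1), unfolded A_def] that(2)])
  have reach: "\<exists>g\<in>P. v = g v0" if "v \<in> ?V" for v
    using that bij_betw_imp_surj_on[OF reg] by blast
  have inj: "g = h" if "g \<in> P" "h \<in> P" "g v0 = h v0" for g h
    using that inj_onD[OF bij_betw_imp_inj_on[OF reg]] by blast
  have free: "g = \<one>\<^bsub>A\<^esub>" if g: "g \<in> P" and v: "v \<in> ?V" "g v = v" for g v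
  proof -
    obtain h where h: "h \<in> P" "v = h v0" using reach v by blast
    have "(g \<otimes>\<^bsub>A\<^esub> h) v0 = h v0" using apply_mult g h v0 v by simp
    then have "g \<otimes>\<^bsub>A\<^esub> h = h" using inj g h by simp
    then show ?thesis using g h by simp
  qed
  have carrier_S: "carrier (subgroup_generated A {d}) = N"
    using dc by (simp add: carrier_subgroup_generated N_def)
  have card_eq: "card ?V = A.ord c * A.ord d"
  proof -
    have "bij_betw (\<lambda>(g, h). g \<otimes>\<^bsub>A\<^esub> h) (N \<times> C) P"
      unfolding bij_betw_def
    proof
      show "inj_on (\<lambda>(g, h). g \<otimes>\<^bsub>A\<^esub> h) (N \<times> C)"
      proof (rule inj_onI, clarsimp)
        fix g h g' h' assume gh: "g \<in> N" "h \<in> C" "g' \<in> N" "h' \<in> C" and eq: "g \<otimes>\<^bsub>A\<^esub> h = g' \<otimes>\<^bsub>A\<^esub> h'"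
        have "inv\<^bsub>A\<^esub> g' \<otimes>\<^bsub>A\<^esub> (g \<otimes>\<^bsub>A\<^esub> h) \<otimes>\<^bsub>A\<^esub> inv\<^bsub>A\<^esub> h = inv\<^bsub>A\<^esub> g' \<otimes>\<^bsub>A\<^esub> (g' \<otimes>\<^bsub>A\<^esub> h') \<otimes>\<^bsub>A\<^esub> inv\<^bsub>A\<^esub> h"
          using eq by simp
        then have e: "inv\<^bsub>A\<^esub> g' \<otimes>\<^bsub>A\<^esub> g = h' \<otimes>\<^bsub>A\<^esub> inv\<^bsub>A\<^esub> h" using gh by (simp add: A.m_assoc A.inv_mult_cancel)
        have "inv\<^bsub>A\<^esub> g' \<otimes>\<^bsub>A\<^esub> g \<in> N" using gh by simp
        moreover have "h' \<otimes>\<^bsub>A\<^esub> inv\<^bsub>A\<^esub> h \<in> C" using gh by simp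
        ultimately have 1: "inv\<^bsub>A\<^esub> g' \<otimes>\<^bsub>A\<^esub> g = \<one>\<^bsub>A\<^esub>" "h' \<otimes>\<^bsub>A\<^esub> inv\<^bsub>A\<^esub> h = \<one>\<^bsub>A\<^esub>"
          using int e unfolding N_def C_def by auto
        have "g = g' \<otimes>\<^bsub>A\<^esub> (inv\<^bsub>A\<^esub> g' \<otimes>\<^bsub>A\<^esub> g)" using gh by (simp add: A.inv_mult_cancel)
        moreover have "h' = (h' \<otimes>\<^bsub>A\<^esub> inv\<^bsub>A\<^esub> h) \<otimes>\<^bsub>A\<^esub> h" using gh by (simp add: A.m_assoc)
        ultimately show "g = g' \<and> h = h'" unfolding 1 using gh by simp
      qed
      show "(\<lambda>(g, h). g \<otimes>\<^bsub>A\<^esub> h) ` (N \<times> C) = P" using prod by (auto simp: N_def C_def set_mult_def)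
    qed
    then have "card P = card N * card C" using bij_betw_same_card card_cartesian_product by metis
    then show ?thesis using bij_betw_same_card[OF reg] ordd ordc by simp
  qed
  have semi: "semiregular (subgroup_generated A {d}) ?V"
  proof -
    have "stabilizer (subgroup_generated A {d}) (\<lambda>f. f) v = {\<one>\<^bsub>A\<^esub>}" if v: "v \<in> ?V" for v
    proof -
      have "\<one>\<^bsub>A\<^esub> v = v" using v by (simp add: A_def Aut_one_apply)
      then show ?thesis
        unfolding stabilizer_def carrier_S using free NP v N.one_closed by blast
    qed
    then show ?thesis by (simp add: semiregular_def)
  qed
  have normalizer: "c \<in> normalizer A (carrier (subgroup_generated A {d}))"
  proof -
    have "c <#\<^bsub>A\<^esub> N #>\<^bsub>A\<^esub> inv\<^bsub>A\<^esub> c = N"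
    proof (intro subset_antisym subsetI)
      fix g assume "g \<in> c <#\<^bsub>A\<^esub> N #>\<^bsub>A\<^esub> inv\<^bsub>A\<^esub> c"
      then obtain k where "k \<in> N" "g = c \<otimes>\<^bsub>A\<^esub> k \<otimes>\<^bsub>A\<^esub> inv\<^bsub>A\<^esub> c" by (auto simp: l_coset_def r_coset_def)
      then show "g \<in> N" using conj c by simp
    next
      fix g assume g: "g \<in> N"
      define k where "k = inv\<^bsub>A\<^esub> c \<otimes>\<^bsub>A\<^esub> g \<otimes>\<^bsub>A\<^esub> c"
      have "k \<in> N" using conj(2) c g by (simp add: k_def)
      moreover have "g = c \<otimes>\<^bsub>A\<^esub> k \<otimes>\<^bsub>A\<^esub> inv\<^bsub>A\<^esub> c"
        using g dc by (simp add: k_def A.m_assoc A.inv_mult_cancel)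
      ultimately show "g \<in> c <#\<^bsub>A\<^esub> N #>\<^bsub>A\<^esub> inv\<^bsub>A\<^esub> c" by (auto simp: l_coset_def r_coset_def)
    qed
    then show ?thesis
      unfolding normalizer_def stabilizer_def carrier_S using dc N.subset by simp
  qed
  have pow_c: "(c [^]\<^bsub>A\<^esub> (k::nat)) v = (c ^^ k) v" if "v \<in> ?V" for k v
    using Aut_pow_apply[of c \<Gamma> v k] dc that by (simp add: A_def)
  have powP: "c [^]\<^bsub>A\<^esub> (k::nat) \<in> P" for k
    by (induction k) (use c in auto)
  have ordc0: "A.ord c > 0" using A.ord_ge_1[OF finA dc(2)] by simp
  have cycle: "\<exists>C\<subseteq>?V. cyclic_on c C \<and> card C = A.ord c"
  proof -
    define Z where "Z = Orbits.orbit c v0"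
    have Z: "Z = (\<lambda>k. (c [^]\<^bsub>A\<^esub> k) v0) ` {1..A.ord c}"
    proof
      show "Z \<subseteq> (\<lambda>k. (c [^]\<^bsub>A\<^esub> k) v0) ` {1..A.ord c}"
      proof
        fix w assume "w \<in> Z"
        then obtain k where k: "w = (c [^]\<^bsub>A\<^esub> (k::nat)) v0" using pow_c[OF v0] by (auto simp: Z_def orbit_altdef)
        \<comment> \<open>Exponents are taken in \<open>{1..ord c}\<close> because \<open>orbit\<close> uses positive iterates only.\<close>
        define j where "j = (if k mod A.ord c = 0 then A.ord c else k mod A.ord c)"
        have jr: "j \<in> {1..A.ord c}" using ordc0 by (auto simp: j_def intro: less_imp_le)
        have "k mod A.ord c = j mod A.ord c" by (simp add: j_def)
        then have "int (A.ord c) dvd int j - int k"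
          by (metis cong_def cong_iff_dvd_diff cong_int_iff)
        then have "c [^]\<^bsub>A\<^esub> int k = c [^]\<^bsub>A\<^esub> int j" using A.int_pow_eq[OF dc(2)] by blast
        then have "c [^]\<^bsub>A\<^esub> k = c [^]\<^bsub>A\<^esub> j" by (simp add: int_pow_int)
        then show "w \<in> (\<lambda>k. (c [^]\<^bsub>A\<^esub> k) v0) ` {1..A.ord c}" using k jr by auto
      qed
      show "(\<lambda>k. (c [^]\<^bsub>A\<^esub> k) v0) ` {1..A.ord c} \<subseteq> Z"
        using pow_c[OF v0] by (auto simp: Z_def orbit_altdef)
    qed
    have "inj_on (\<lambda>k. (c [^]\<^bsub>A\<^esub> k) v0) {1..A.ord c}"
    proof (rule inj_onI)
      fix i j assume ij: "i \<in> {1..A.ord c}" "j \<in> {1..A.ord c}" "(c [^]\<^bsub>A\<^esub> i) v0 = (c [^]\<^bsub>A\<^esub> j) v0"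
      have "c [^]\<^bsub>A\<^esub> i = c [^]\<^bsub>A\<^esub> j" by (rule inj[OF powP powP ij(3)])
      then show "i = j" by (rule inj_onD[OF A.ord_inj'[OF dc(2)] _ ij(1,2)])
    qed
    then have "card Z = A.ord c" unfolding Z by (simp add: card_image)
    moreover have "Z \<subseteq> ?V" unfolding Z by (rule image_subsetI) (rule vert[OF powP v0])
    moreover have "v0 \<in> Z"
    proof -
      have "v0 = (c [^]\<^bsub>A\<^esub> A.ord c) v0" using v0 dc by (simp add: A_def Aut_one_apply)
      then show ?thesis unfolding Z using ordc0 by (intro image_eqI[where x = "A.ord c"]) auto
    qed
    ultimately show ?thesis unfolding cyclic_on_def Z_def by blast
  qed
  have orbits: "cyclic_on (\<lambda>B. c ` B) (orbits (subgroup_generated A {d}) ?V (\<lambda>f. f))"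
  proof -
    define B where "B = (\<lambda>v. {g v | g. g \<in> N})"
    have orb: "Group_Action.orbit (subgroup_generated A {d}) (\<lambda>f. f) v = B v" for v
      by (simp add: Group_Action.orbit_def carrier_S B_def)
    have shift: "((\<lambda>B. c ` B) ^^ k) (B v0) = B ((c [^]\<^bsub>A\<^esub> k) v0)" for k :: nat
    proof -
      have "(c ^^ k) ` B v0 = (c [^]\<^bsub>A\<^esub> k) ` B v0"
      proof (rule image_cong[OF refl])
        fix w assume "w \<in> B v0"
        then obtain g where "g \<in> N" "w = g v0" by (auto simp: B_def)
        then have "w \<in> ?V" using vert[of g v0] NP v0 by auto
        then show "(c ^^ k) w = (c [^]\<^bsub>A\<^esub> k) w" using pow_c by simp
      qed
      also have "\<dots> = B ((c [^]\<^bsub>A\<^esub> k) v0)"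
        unfolding B_def
        by (rule normal_element_image_orbit[where \<Gamma> = \<Gamma>, folded A_def, OF N.subset _ v0])
          (use powP conj dc in auto)
      finally show ?thesis by (simp add: funpow_image)
    qed
    have translate: "B (g v) = B v" if g: "g \<in> N" and v: "v \<in> ?V" for g v
    proof (intro subset_antisym subsetI)
      fix w assume "w \<in> B (g v)"
      then obtain k where k: "k \<in> N" "w = k (g v)" by (auto simp: B_def)
      have "k \<in> P" "g \<in> P" using k(1) g NP by auto
      then have "w = (k \<otimes>\<^bsub>A\<^esub> g) v" using k(2) apply_mult[of k g v] v by simp
      then show "w \<in> B v" using N.m_closed[OF k(1) g] unfolding B_def by blast
    next
      fix w assume "w \<in> B v"
      then obtain k where k: "k \<in> N" "w = k v" by (auto simp: B_def)
      have kg: "k \<otimes>\<^bsub>A\<^esub> inv\<^bsub>A\<^esub> g \<in> N" using k(1) g by simp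
      then have "(k \<otimes>\<^bsub>A\<^esub> inv\<^bsub>A\<^esub> g \<otimes>\<^bsub>A\<^esub> g) v = (k \<otimes>\<^bsub>A\<^esub> inv\<^bsub>A\<^esub> g) (g v)"
        by (intro apply_mult subsetD[OF NP] g v)
      moreover have "k \<otimes>\<^bsub>A\<^esub> inv\<^bsub>A\<^esub> g \<otimes>\<^bsub>A\<^esub> g = k" using k(1) g by (simp add: A.m_assoc)
      ultimately have "w = (k \<otimes>\<^bsub>A\<^esub> inv\<^bsub>A\<^esub> g) (g v)" using k(2) by simp
      then show "w \<in> B (g v)" using kg unfolding B_def by blast
    qed
    have "{B v | v. v \<in> ?V} = Orbits.orbit (\<lambda>B. c ` B) (B v0)"
    proof (intro subset_antisym subsetI)
      fix X assume "X \<in> {B v | v. v \<in> ?V}"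
      then obtain v where v: "v \<in> ?V" "X = B v" by blast
      obtain h where h: "h \<in> P" "v = h v0" using reach v by blast
      obtain g l where gl: "g \<in> N" "l \<in> C" "h = g \<otimes>\<^bsub>A\<^esub> l"
        using h(1) prod unfolding N_def C_def set_mult_def by blast
      obtain k :: nat where k: "l = c [^]\<^bsub>A\<^esub> k"
        using gl(2) A.generate_pow_on_finite_carrier[OF finA dc(2)] by (auto simp: C_def)
      have "v = g ((c [^]\<^bsub>A\<^esub> k) v0)"
        using h gl k apply_mult[of g "c [^]\<^bsub>A\<^esub> k" v0] powP NP v0 by auto
      then have "X = B ((c [^]\<^bsub>A\<^esub> k) v0)" using v(2) translate[OF gl(1) vert[OF powP v0]] by simp
      also have "c [^]\<^bsub>A\<^esub> k = c [^]\<^bsub>A\<^esub> (k + A.ord c)"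
        using dc by (simp flip: A.nat_pow_mult)
      finally have "X = ((\<lambda>B. c ` B) ^^ (k + A.ord c)) (B v0)" by (simp only: shift)
      then show "X \<in> Orbits.orbit (\<lambda>B. c ` B) (B v0)" using ordc0 by (auto simp: orbit_altdef)
    next
      fix X assume "X \<in> Orbits.orbit (\<lambda>B. c ` B) (B v0)"
      then obtain k where "X = B ((c [^]\<^bsub>A\<^esub> (k::nat)) v0)" by (auto simp: orbit_altdef shift)
      then show "X \<in> {B v | v. v \<in> ?V}" using vert[OF powP v0] by blast
    qed
    then show ?thesis
      unfolding cyclic_on_def orbits_def orb using v0 by blast
  qed
  have "mr_metacirculant (A.ord c) (A.ord d) \<Gamma>"
    unfolding mr_metacirculant_def Let_def A_def[symmetric]
    using ordc0 A.ord_ge_1[OF finA dc(1)] card_eq dc semi normalizer cycle orbits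
    by (intro conjI bexI[of _ d] bexI[of _ c]) auto
  then show ?thesis unfolding metacirculant_def by blast
qed

text \<open>The group \<open>\<langle>\<sigma>\<rangle>\<langle>\<tau>\<rangle>\<close> is metacyclic since \<open>\<tau>\<close> normalises \<open>\<langle>\<sigma>\<rangle>\<close>, and it is
transitive since \<open>\<tau>\<close> permutes the orbits of \<open>\<langle>\<sigma>\<rangle>\<close> transitively.\<close>

lemma metacirculant_imp_weak_metacirculant:
  assumes "metacirculant \<Gamma>"
  shows "weak_metacirculant \<Gamma>"
proof -
  let ?A = "Aut \<Gamma>" and ?V = "pverts \<Gamma>"
  obtain s t where s: "s \<in> carrier ?A" and t: "t \<in> carrier ?A"
    and norm: "t \<in> normalizer ?A (carrier (subgroup_generated ?A {s}))"
    and cyc: "cyclic_on (\<lambda>B. t ` B) (orbits (subgroup_generated ?A {s}) ?V (\<lambda>f. f))"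
    using assms unfolding metacirculant_def mr_metacirculant_def Let_def by blast
  define N where "N = generate ?A {s}"
  define H where "H = N <#>\<^bsub>?A\<^esub> generate ?A {t}"
  have carrier_S: "carrier (subgroup_generated ?A {s}) = N"
    using s by (simp add: carrier_subgroup_generated N_def)
  have H: "subgroup H ?A" and meta: "metacyclic_group (?A\<lparr>carrier := H\<rparr>)"
    using Aut.metacyclic_group_product[OF s, of t] norm unfolding carrier_S by (auto simp: H_def N_def)
  have N: "subgroup N ?A" using s by (auto simp: N_def intro: Aut.generate_is_subgroup)
  have T: "subgroup (generate ?A {t}) ?A" using t by (auto intro: Aut.generate_is_subgroup)
  interpret N: subgroup N ?A by (rule N)
  interpret H: subgroup H ?A by (rule H)
  have NH: "N \<subseteq> H"
  proof
    fix g assume g: "g \<in> N"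
    then have "g \<otimes>\<^bsub>?A\<^esub> \<one>\<^bsub>?A\<^esub> \<in> H" unfolding H_def set_mult_def using generate.one[of ?A "{t}"] by blast
    then show "g \<in> H" using g by simp
  qed
  have "\<one>\<^bsub>?A\<^esub> \<otimes>\<^bsub>?A\<^esub> t \<in> H"
    unfolding H_def set_mult_def using N.one_closed generate.incl[of t "{t}" ?A] by blast
  then have tH: "t \<in> H" using t by simp
  have powH: "t [^]\<^bsub>?A\<^esub> (k::nat) \<in> H" for k by (induction k) (use tH in auto)
  have act: "group_action (?A\<lparr>carrier := H\<rparr>) ?V (\<lambda>f. f)"
    by (rule group_action.subgroup_group_action[OF vertex_group_action H])
  have trans: "\<exists>g\<in>H. g v = w" if v: "v \<in> ?V" and w: "w \<in> ?V" for v w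
  proof -
    define B where "B = (\<lambda>v. {g v | g. g \<in> N})"
    have orb: "orbits (subgroup_generated ?A {s}) ?V (\<lambda>f. f) = {B v | v. v \<in> ?V}"
      by (simp add: orbits_def Group_Action.orbit_def carrier_S B_def)
    have "B v \<in> {B v | v. v \<in> ?V}" "B w \<in> {B v | v. v \<in> ?V}" using v w by auto
    then have "B w \<in> Orbits.orbit (\<lambda>B. t ` B) (B v)" using cyc unfolding orb cyclic_on_alldef by blast
    then obtain k where "B w = (t ^^ k) ` B v" unfolding orbit_altdef funpow_image by blast
    moreover have "w \<in> B w" using w N.one_closed Aut_one_apply[OF w] unfolding B_def by (metis (mono_tags, lifting) mem_Collect_eq)
    ultimately obtain g where g: "g \<in> N" "w = (t ^^ k) (g v)" by (auto simp: B_def)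
    have gv: "g v \<in> ?V" by (rule Aut_vertex[OF N.mem_carrier[OF g(1)] v])
    have "(t [^]\<^bsub>?A\<^esub> k \<otimes>\<^bsub>?A\<^esub> g) v = (t [^]\<^bsub>?A\<^esub> k) (g v)"
      by (rule Aut_mult_apply[OF Aut.nat_pow_closed[OF t] N.mem_carrier[OF g(1)] v])
    then have "w = (t [^]\<^bsub>?A\<^esub> k \<otimes>\<^bsub>?A\<^esub> g) v"
      using g(2) Aut_pow_apply[OF t gv] by metis
    moreover have "t [^]\<^bsub>?A\<^esub> k \<otimes>\<^bsub>?A\<^esub> g \<in> H" using powH g NH by blast
    ultimately show ?thesis by blast
  qed
  have "transitive_action (?A\<lparr>carrier := H\<rparr>) ?V (\<lambda>f. f)"
    unfolding transitive_action_def transitive_action_axioms_def using act trans by simp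
  then show ?thesis unfolding weak_metacirculant_def using H meta by blast
qed

section \<open>Tetravalent half-arc-transitive graphs\<close>

text \<open>The only nontrivial permutation of a pair has even order.\<close>

lemma odd_perm_of_pair:
  assumes B: "card B = 2" and f: "f ` B \<subseteq> B" "inj_on f B" and odd: "odd k"
    and fk: "\<And>b. b \<in> B \<Longrightarrow> (f ^^ k) b = b" and b: "b \<in> B"
  shows "f b = b"
proof (rule ccontr)
  assume ne: "f b \<noteq> b"
  have "card {b, f b} = 2" using ne by simp
  moreover have "{b, f b} \<subseteq> B" using b f by auto
  moreover have "finite B" using B by (metis card.infinite zero_neq_numeral)
  ultimately have "B = {b, f b}" using B card_subset_eq by metis
  then have "f (f b) = b" using f b ne by (metis image_subset_iff inj_on_def insertE singletonD)
  then have "(f ^^ 2) b = b" by (simp add: numeral_2_eq_2)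
  then have "(f ^^ (2 * j)) b = b" for j by (induction j) (simp_all add: numeral_2_eq_2)
  moreover obtain j where "k = Suc (2 * j)" using odd by (metis oddE Suc_eq_plus1)
  ultimately show False using fk[OF b] ne by simp
qed

locale tetravalent_half_arc_transitive = pair_graph \<Gamma> for \<Gamma> :: "'a pair_pre_digraph" +
  assumes conn: "Digraph_Component.connected (with_proj \<Gamma>)"
    and valency: "v \<in> pverts \<Gamma> \<Longrightarrow> out_degree (with_proj \<Gamma>) v = 4"
    and hat: "half_arc_transitive \<Gamma>"
begin

abbreviation "A \<equiv> Aut \<Gamma>"
abbreviation "V \<equiv> pverts \<Gamma>"

lemma arc_sym: "(u, v) \<in> parcs \<Gamma> \<longleftrightarrow> (v, u) \<in> parcs \<Gamma>"
  using pair_sym_arcs by (auto simp: symmetric_def dest: symD)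

lemma arc_closed_set_eq_verts:
  assumes "W \<subseteq> V" "W \<noteq> {}" and closed: "\<And>u w. u \<in> W \<Longrightarrow> (u, w) \<in> parcs \<Gamma> \<Longrightarrow> w \<in> W"
  shows "W = V"
proof
  show "V \<subseteq> W"
  proof
    fix w assume w: "w \<in> V"
    obtain u where u: "u \<in> W" using assms(2) by blast
    have "(u, w) \<in> rtrancl_on V ((parcs \<Gamma>)\<^sup>s)"
      using conn u w assms(1) unfolding connected_conv by auto
    then show "w \<in> W"
    proof (induction rule: rtrancl_on_induct)
      case (step y z)
      then show ?case using closed arc_sym by (auto simp: symcl_def)
    qed (rule u)
  qed
qed (rule assms(1))

lemma vertex_transitive:
  assumes "u \<in> V" "v \<in> V"
  obtains f where "f \<in> carrier A" "f u = v"
  using transitive_action.unique_orbit[of A V "\<lambda>f. f" u v] hat assms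
  unfolding half_arc_transitive_def by blast

lemma arc_image: "f \<in> carrier A \<Longrightarrow> (u, v) \<in> parcs \<Gamma> \<Longrightarrow> (f u, f v) \<in> parcs \<Gamma>"
  using Aut_arc_iff wellformed' by metis

end

text \<open>The set \<open>D\<close> is one of the two orbits of the automorphism group on arcs; the other is its
converse.\<close>

locale half_arc_orientation = tetravalent_half_arc_transitive +
  fixes D :: "('a \<times> 'a) set"
  assumes D_arcs: "D \<subseteq> parcs \<Gamma>"
    and D_iff: "(u, v) \<in> parcs \<Gamma> \<longleftrightarrow> (u, v) \<in> D \<or> (v, u) \<in> D"
    and D_asym: "(u, v) \<in> D \<Longrightarrow> (v, u) \<notin> D"
    and D_inv: "f \<in> carrier A \<Longrightarrow> (u, v) \<in> D \<Longrightarrow> (f u, f v) \<in> D"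
    and D_trans: "(u, v) \<in> D \<Longrightarrow> (u', v') \<in> D \<Longrightarrow> \<exists>f\<in>carrier A. f u = u' \<and> f v = v'"

text \<open>Let \<open>D\<close> be the orbit of one arc. Edge-transitivity puts every arc or its reverse into
\<open>D\<close>. If \<open>D\<close> contained both an arc and its reverse, it would be closed under reversal and so
contain all arcs, contrary to half-arc-transitivity.\<close>

lemma (in tetravalent_half_arc_transitive) orientation_exists: "\<exists>D. half_arc_orientation \<Gamma> D"
proof -
  obtain x where x: "x \<in> V" using conn unfolding connected_conv by auto
  have "card (out_arcs (with_proj \<Gamma>) x) = 4" using valency[OF x] by (simp add: out_degree_def)
  then have "out_arcs (with_proj \<Gamma>) x \<noteq> {}" by force
  then obtain u0 v0 where a0: "(u0, v0) \<in> parcs \<Gamma>" by (auto simp: out_arcs_def)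
  have uv0: "u0 \<in> V" "v0 \<in> V" using a0 wellformed' by auto
  define D where "D = {(f u0, f v0) | f. f \<in> carrier A}"
  have D_arcs: "D \<subseteq> parcs \<Gamma>" using arc_image a0 by (auto simp: D_def)
  have D_inv: "(f u, f v) \<in> D" if f: "f \<in> carrier A" and uv: "(u, v) \<in> D" for f u v
  proof -
    obtain g where g: "g \<in> carrier A" "u = g u0" "v = g v0" using uv by (auto simp: D_def)
    then have "f u = (f \<otimes>\<^bsub>A\<^esub> g) u0" "f v = (f \<otimes>\<^bsub>A\<^esub> g) v0" using f uv0 by (simp_all add: Aut_mult_apply)
    moreover have "f \<otimes>\<^bsub>A\<^esub> g \<in> carrier A" using f g by simp
    ultimately show ?thesis unfolding D_def by blast
  qed
  have D_trans: "\<exists>f\<in>carrier A. f u = u' \<and> f v = v'" if D2: "(u, v) \<in> D" "(u', v') \<in> D" for u v u' v'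
  proof -
    obtain g h where gh: "g \<in> carrier A" "u = g u0" "v = g v0" "h \<in> carrier A" "u' = h u0" "v' = h v0"
      using D2 by (auto simp: D_def)
    have "(h \<otimes>\<^bsub>A\<^esub> inv\<^bsub>A\<^esub> g) (g w) = h w" if "w \<in> V" for w
      using gh that by (simp add: Aut_mult_apply Aut_vertex Aut_inv_apply)
    moreover have "h \<otimes>\<^bsub>A\<^esub> inv\<^bsub>A\<^esub> g \<in> carrier A" using gh by simp
    ultimately show ?thesis using gh uv0 by blast
  qed
  have D_or: "(u, v) \<in> D \<or> (v, u) \<in> D" if uv: "(u, v) \<in> parcs \<Gamma>" for u v
  proof -
    have E: "{u0, v0} \<in> edges \<Gamma>" "{u, v} \<in> edges \<Gamma>" using a0 uv by (auto simp: edges_def)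
    obtain f where f: "f \<in> carrier A" "edge_action \<Gamma> f {u0, v0} = {u, v}"
      using transitive_action.unique_orbit[of A "edges \<Gamma>" "edge_action \<Gamma>", OF _ E] hat
      unfolding half_arc_transitive_def by blast
    then have "{f u0, f v0} = {u, v}" using E by (simp add: edge_action_def)
    then have "(u, v) = (f u0, f v0) \<or> (v, u) = (f u0, f v0)" by (auto simp: doubleton_eq_iff)
    then show ?thesis using f unfolding D_def by blast
  qed
  have D_asym: "(v, u) \<notin> D" if uv: "(u, v) \<in> D" for u v
  proof
    assume vu: "(v, u) \<in> D"
    have swap: "(y, x) \<in> D" if xy: "(x, y) \<in> D" for x y
      using D_trans[OF uv xy] D_inv vu by blast
    have all: "(x, y) \<in> D" if "(x, y) \<in> parcs \<Gamma>" for x y using D_or[OF that] swap by blast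
    have "transitive_action A (parcs \<Gamma>) (arc_action \<Gamma>)"
    proof (intro transitive_action.intro transitive_action_axioms.intro arc_group_action)
      fix a b assume ab: "a \<in> parcs \<Gamma>" "b \<in> parcs \<Gamma>"
      then obtain f where "f \<in> carrier A" "f (fst a) = fst b" "f (snd a) = snd b"
        using D_trans[OF all[of "fst a" "snd a"] all[of "fst b" "snd b"]] by auto
      then show "\<exists>f\<in>carrier A. arc_action \<Gamma> f a = b"
        using ab by (intro bexI[of _ f]) (auto simp: arc_action_def map_prod_def split: prod.splits)
    qed
    then show False using hat unfolding half_arc_transitive_def by blast
  qed
  have "half_arc_orientation \<Gamma> D"
  proof
    show "(u, v) \<in> parcs \<Gamma> \<longleftrightarrow> (u, v) \<in> D \<or> (v, u) \<in> D" for u v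
      using D_or D_arcs arc_sym by blast
  qed (fact D_arcs D_asym D_inv D_trans)+
  then show ?thesis by blast
qed

context half_arc_orientation
begin

lemma D_verts: "(u, v) \<in> D \<Longrightarrow> u \<in> V" "(u, v) \<in> D \<Longrightarrow> v \<in> V"
  using D_arcs wellformed' by blast+

lemma D_inv_iff:
  assumes "f \<in> carrier A" "u \<in> V" "v \<in> V"
  shows "(f u, f v) \<in> D \<longleftrightarrow> (u, v) \<in> D"
  using D_inv[OF assms(1), of u v] D_inv[of "inv\<^bsub>A\<^esub> f" "f u" "f v"] assms by (auto simp: Aut_inv_apply)

lemma inj_on_Aut: "f \<in> carrier A \<Longrightarrow> inj_on f V"
  by (metis Aut_inv_apply(1) inj_onI)

text \<open>By vertex-transitivity the in- and out-valencies are constant. Counting \<open>D\<close> by tails and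
by heads shows that they agree, and their sum is four.\<close>

lemma out_in_card:
  assumes v: "v \<in> V"
  shows "card {w. (v, w) \<in> D} = 2" and "card {w. (w, v) \<in> D} = 2"
proof -
  have finD: "finite D" using D_arcs pair_finite_arcs finite_subset by blast
  have finout: "finite {w. (u, w) \<in> D}" and finin: "finite {w. (w, u) \<in> D}" for u
    using D_verts pair_finite_verts by (auto intro: finite_subset[of _ V])
  have const: "card {w. (u, w) \<in> D} = card {w. (v, w) \<in> D} \<and> card {w. (w, u) \<in> D} = card {w. (w, v) \<in> D}"
    if u: "u \<in> V" for u
  proof -
    obtain f where f: "f \<in> carrier A" "f v = u" by (rule vertex_transitive[OF v u])
    have img: "f ` {w. (v, w) \<in> D} = {w. (u, w) \<in> D}" "f ` {w. (w, v) \<in> D} = {w. (w, u) \<in> D}"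
    proof -
      have "w \<in> f ` {w. (v, w) \<in> D}" if "(u, w) \<in> D" for w
      proof (rule image_eqI)
        show "w = f ((inv\<^bsub>A\<^esub> f) w)" using f that D_verts by (simp add: Aut_inv_apply)
        have "((inv\<^bsub>A\<^esub> f) (f v), (inv\<^bsub>A\<^esub> f) w) \<in> D" by (rule D_inv[OF Aut.inv_closed[OF f(1)]]) (use f that in simp)
        then show "(inv\<^bsub>A\<^esub> f) w \<in> {w. (v, w) \<in> D}" using Aut_inv_apply(1)[OF f(1) v] by (simp only: mem_Collect_eq)
      qed
      then show "f ` {w. (v, w) \<in> D} = {w. (u, w) \<in> D}" using f D_inv[OF f(1)] by fastforce
      have "w \<in> f ` {w. (w, v) \<in> D}" if "(w, u) \<in> D" for w
      proof (rule image_eqI)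
        show "w = f ((inv\<^bsub>A\<^esub> f) w)" using f that D_verts by (simp add: Aut_inv_apply)
        have "((inv\<^bsub>A\<^esub> f) w, (inv\<^bsub>A\<^esub> f) (f v)) \<in> D" by (rule D_inv[OF Aut.inv_closed[OF f(1)]]) (use f that in simp)
        then show "(inv\<^bsub>A\<^esub> f) w \<in> {w. (w, v) \<in> D}" using Aut_inv_apply(1)[OF f(1) v] by (simp only: mem_Collect_eq)
      qed
      then show "f ` {w. (w, v) \<in> D} = {w. (w, u) \<in> D}" using f D_inv[OF f(1)] by fastforce
    qed
    have "inj_on f {w. (v, w) \<in> D}" "inj_on f {w. (w, v) \<in> D}"
      using inj_on_Aut[OF f(1)] D_verts by (auto intro: inj_on_subset)
    then show ?thesis using card_image img by metis
  qed
  have "{w. (v, w) \<in> D} \<union> {w. (w, v) \<in> D} = {w. (v, w) \<in> parcs \<Gamma>}" using D_iff by blast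
  moreover have "{w. (v, w) \<in> D} \<inter> {w. (w, v) \<in> D} = {}" using D_asym by blast
  moreover have "card {w. (v, w) \<in> parcs \<Gamma>} = 4"
  proof -
    have "out_arcs (with_proj \<Gamma>) v = Pair v ` {w. (v, w) \<in> parcs \<Gamma>}" by (auto simp: out_arcs_def)
    moreover have "inj_on (Pair v) {w. (v, w) \<in> parcs \<Gamma>}" by (auto intro: inj_onI)
    ultimately show ?thesis using valency[OF v] card_image by (metis out_degree_def)
  qed
  ultimately have sum4: "card {w. (v, w) \<in> D} + card {w. (w, v) \<in> D} = 4"
    using card_Un_disjoint[OF finout[of v] finin[of v]] by simp
  have "card D = (\<Sum>u\<in>V. card {w. (u, w) \<in> D})"
  proof -
    have "D = Sigma V (\<lambda>u. {w. (u, w) \<in> D})" using D_verts by auto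
    then show ?thesis using card_SigmaI[OF pair_finite_verts, of "\<lambda>u. {w. (u, w) \<in> D}"] finout by simp
  qed
  also have "\<dots> = card V * card {w. (v, w) \<in> D}" using const by simp
  finally have 1: "card D = card V * card {w. (v, w) \<in> D}" .
  have "card D = card (D\<inverse>)" by simp
  also have "card (D\<inverse>) = (\<Sum>u\<in>V. card {w. (w, u) \<in> D})"
  proof -
    have "D\<inverse> = Sigma V (\<lambda>u. {w. (w, u) \<in> D})" using D_verts by auto
    then show ?thesis using card_SigmaI[OF pair_finite_verts, of "\<lambda>u. {w. (w, u) \<in> D}"] finin by simp
  qed
  also have "\<dots> = card V * card {w. (w, v) \<in> D}" using const by simp
  finally have "card {w. (v, w) \<in> D} = card {w. (w, v) \<in> D}"
    using 1 v pair_finite_verts by (auto simp: card_gt_0_iff)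
  then show "card {w. (v, w) \<in> D} = 2" "card {w. (w, v) \<in> D} = 2" using sum4 by auto
qed

text \<open>If \<open>f\<close> fixes a vertex, it permutes the two out-neighbours, and being of odd order it fixes
them; the same holds for in-neighbours. So the set of fixed vertices is closed under adjacency.\<close>

lemma odd_order_stabiliser_trivial:
  assumes f: "f \<in> carrier A" and v: "v \<in> V" "f v = v" and k: "odd k" "f [^]\<^bsub>A\<^esub> (k::nat) = \<one>\<^bsub>A\<^esub>"
  shows "f = \<one>\<^bsub>A\<^esub>"
proof -
  have fk: "(f ^^ k) w = w" if "w \<in> V" for w
    using Aut_pow_apply[OF f that, of k] k that by (simp add: Aut_one_apply)
  have step: "f w = w" if u: "u \<in> V" "f u = u" and w: "(u, w) \<in> parcs \<Gamma>" for u w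
  proof -
    have out: "f w = w" if uw: "(u, w) \<in> D" for w
    proof (rule odd_perm_of_pair[OF out_in_card(1)[OF u(1)] _ _ k(1)])
      show "f ` {w. (u, w) \<in> D} \<subseteq> {w. (u, w) \<in> D}" using D_inv[OF f, of u] u by auto
      show "inj_on f {w. (u, w) \<in> D}" using inj_on_Aut[OF f] D_verts by (auto intro: inj_on_subset)
    qed (use uw fk D_verts in auto)
    moreover have "f w = w" if uw: "(w, u) \<in> D" for w
    proof (rule odd_perm_of_pair[OF out_in_card(2)[OF u(1)] _ _ k(1)])
      show "f ` {w. (w, u) \<in> D} \<subseteq> {w. (w, u) \<in> D}" using D_inv[OF f, of _ u] u by fastforce
      show "inj_on f {w. (w, u) \<in> D}" using inj_on_Aut[OF f] D_verts by (auto intro: inj_on_subset)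
    qed (use uw fk D_verts in auto)
    ultimately show ?thesis using w D_iff by blast
  qed
  have "{w \<in> V. f w = w} = V"
    by (rule arc_closed_set_eq_verts) (use v step wellformed' in auto)
  then show ?thesis
    by (intro Aut_eqI[OF f]) (auto simp: Aut_one_apply)
qed

text \<open>The setting of \<open>exact_factorisation_split\<close>: \<open>P\<close> is a subgroup of order \<open>p ^ n\<close> in the
given metacyclic group, \<open>T\<close> the stabiliser of a vertex \<open>v0\<close>, and \<open>a\<close>, \<open>b\<close> are the elements of \<open>P\<close>
that carry \<open>v0\<close> to its out-neighbours.\<close>

lemma weak_imp_metacirculant:
  assumes weak: "weak_metacirculant \<Gamma>" and p: "prime p" "odd p" and card: "card V = p ^ n"
  shows "metacirculant \<Gamma>"
proof -
  have finA: "finite (carrier A)" by (rule finite_Aut[OF pair_finite_verts])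
  have p0: "p > 0" using p prime_gt_0_nat by blast
  obtain H where H: "subgroup H A" and meta: "metacyclic_group (A\<lparr>carrier := H\<rparr>)"
    and trans: "transitive_action (A\<lparr>carrier := H\<rparr>) V (\<lambda>f. f)"
    using weak unfolding weak_metacirculant_def by blast
  let ?H = "A\<lparr>carrier := H\<rparr>"
  interpret HG: group ?H by (rule Aut.subgroup_imp_group[OF H])
  interpret act: transitive_action ?H V "\<lambda>f. f" by (rule trans)
  obtain v0 where v0: "v0 \<in> V" using conn unfolding connected_conv by auto
  have "Group_Action.orbit ?H (\<lambda>f. f) v0 = V"
    using act.unique_orbit[OF v0] act.element_image[OF _ v0] by (auto simp: Group_Action.orbit_def)
  then have "p ^ n * card (stabilizer ?H (\<lambda>f. f) v0) = order ?H"
    using act.orbit_stabilizer_theorem[OF v0] card by simp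
  moreover have "finite (carrier ?H)" using finA subgroup.subset[OF H] finite_subset by auto
  ultimately obtain P where PH: "subgroup P ?H" and cardP: "card P = p ^ n"
    using sylow_thm[OF p(1) HG.is_group, of n "card (stabilizer ?H (\<lambda>f. f) v0)"] by auto
  have P: "subgroup P A" by (rule Aut.incl_subgroup[OF H PH])
  interpret P: subgroup P A by (rule P)
  interpret PG: group "A\<lparr>carrier := P\<rparr>" by (rule Aut.subgroup_imp_group[OF P])
  obtain x y where "metacyclic_pair ?H x y" using HG.metacyclic_pair_exists[OF meta] by blast
  from HG.metacyclic_pair_subgroup[OF this PH]
  obtain x y where xy: "metacyclic_pair (A\<lparr>carrier := P\<rparr>) x y" by auto
  define T where "T = stabilizer A (\<lambda>f. f) v0"
  have T: "subgroup T A" unfolding T_def by (rule group_action.stabilizer_subgroup[OF vertex_group_action v0])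
  interpret T: subgroup T A by (rule T)
  have T_I: "f \<in> T" if "f \<in> carrier A" "f v0 = v0" for f using that unfolding T_def stabilizer_def by blast
  have T_D: "f v0 = v0" if "f \<in> T" for f using that unfolding T_def stabilizer_def by blast
  have trivial: "f = \<one>\<^bsub>A\<^esub>" if "f \<in> P" "f v0 = v0" for f
  proof (rule odd_order_stabiliser_trivial[OF P.mem_carrier[OF that(1)] v0 that(2)])
    show "odd (p ^ n)" using p by simp
    have "f [^]\<^bsub>A\<lparr>carrier := P\<rparr>\<^esub> order (A\<lparr>carrier := P\<rparr>) = \<one>\<^bsub>A\<^esub>" using PG.pow_order_eq_1[of f] that by simp
    then show "f [^]\<^bsub>A\<^esub> (p ^ n) = \<one>\<^bsub>A\<^esub>" using cardP by (simp add: order_def flip: Aut.nat_pow_consistent)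
  qed
  have mult: "(f \<otimes>\<^bsub>A\<^esub> g) v = f (g v)" if "f \<in> carrier A" "g \<in> carrier A" "v \<in> V" for f g v
    by (rule Aut_mult_apply[OF that])
  have injP: "f = g" if fg: "f \<in> P" "g \<in> P" "f v0 = g v0" for f g
  proof -
    have c: "f \<in> carrier A" "g \<in> carrier A" using fg by auto
    have "(inv\<^bsub>A\<^esub> g \<otimes>\<^bsub>A\<^esub> f) v0 = v0" using c v0 fg(3) by (simp add: mult Aut_inv_apply)
    then have "inv\<^bsub>A\<^esub> g \<otimes>\<^bsub>A\<^esub> f = \<one>\<^bsub>A\<^esub>" using trivial fg by simp
    then have "g \<otimes>\<^bsub>A\<^esub> (inv\<^bsub>A\<^esub> g \<otimes>\<^bsub>A\<^esub> f) = g" using c by simp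
    then show ?thesis using c by (simp add: Aut.inv_mult_cancel)
  qed
  have reg: "bij_betw (\<lambda>g. g v0) P V"
  proof -
    have inj: "inj_on (\<lambda>g. g v0) P" by (intro inj_onI injP)
    have "(\<lambda>g. g v0) ` P = V"
    proof (rule card_subset_eq[OF pair_finite_verts])
      show "(\<lambda>g. g v0) ` P \<subseteq> V" by (intro image_subsetI Aut_vertex[OF P.mem_carrier v0])
      show "card ((\<lambda>g. g v0) ` P) = card V" using card_image[OF inj] cardP card by simp
    qed
    then show ?thesis using inj by (simp add: bij_betw_def)
  qed
  have reach: "\<exists>g\<in>P. v = g v0" if "v \<in> V" for v
    using that bij_betw_imp_surj_on[OF reg] by blast
  have TP: "T \<inter> P = {\<one>\<^bsub>A\<^esub>}"
    using trivial T_D T.one_closed P.one_closed by blast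
  have prod: "T <#>\<^bsub>A\<^esub> P = carrier A"
  proof
    show "T <#>\<^bsub>A\<^esub> P \<subseteq> carrier A" by (auto simp: set_mult_def)
    show "carrier A \<subseteq> T <#>\<^bsub>A\<^esub> P"
    proof
      fix g assume g: "g \<in> carrier A"
      obtain q where q: "q \<in> P" "(inv\<^bsub>A\<^esub> g) v0 = q v0"
        using reach[OF Aut_vertex[OF Aut.inv_closed[OF g] v0]] by blast
      have "g (q v0) = v0" unfolding q(2)[symmetric] using g v0 by (simp add: Aut_inv_apply)
      then have "(g \<otimes>\<^bsub>A\<^esub> q) v0 = v0" using g q v0 by (simp add: mult)
      then have "g \<otimes>\<^bsub>A\<^esub> q \<in> T" using g q by (intro T_I) auto
      moreover have "g = (g \<otimes>\<^bsub>A\<^esub> q) \<otimes>\<^bsub>A\<^esub> inv\<^bsub>A\<^esub> q" using g q by (simp add: Aut.m_assoc)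
      ultimately show "g \<in> T <#>\<^bsub>A\<^esub> P" using q unfolding set_mult_def by blast
    qed
  qed
  have coprime: "coprime (Aut.ord \<Gamma> t) p" if t: "t \<in> T" for t
  proof (rule ccontr)
    assume "\<not> coprime (Aut.ord \<Gamma> t) p"
    then have "p dvd Aut.ord \<Gamma> t" using p(1) by (metis coprime_commute prime_imp_coprime)
    then obtain e where e: "Aut.ord \<Gamma> t = e * p" by (metis dvd_def mult.commute)
    have tc: "t \<in> carrier A" using t by simp
    have pos: "Aut.ord \<Gamma> t > 0" using Aut.ord_ge_1[OF finA tc] by simp
    have "t [^]\<^bsub>A\<^esub> e = \<one>\<^bsub>A\<^esub>"
    proof (rule odd_order_stabiliser_trivial[OF _ v0 _ p(2)])
      show "t [^]\<^bsub>A\<^esub> e \<in> carrier A" using tc by simp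
      have "t [^]\<^bsub>A\<^esub> e \<in> T" by (induction e) (use t in auto)
      then show "(t [^]\<^bsub>A\<^esub> e) v0 = v0" by (rule T_D)
      have "t [^]\<^bsub>A\<^esub> (e * p) = \<one>\<^bsub>A\<^esub>" using Aut.pow_ord_eq_1[OF tc] unfolding e .
      then show "(t [^]\<^bsub>A\<^esub> e) [^]\<^bsub>A\<^esub> p = \<one>\<^bsub>A\<^esub>" using tc by (simp add: Aut.nat_pow_pow)
    qed
    then have "e * p dvd e" using Aut.pow_eq_id[OF tc] unfolding e by blast
    moreover have "e > 0" using pos e by simp
    ultimately have "e * p \<le> e * 1" using dvd_imp_le by fastforce
    then show False using \<open>e > 0\<close> prime_gt_1_nat[OF p(1)] by simp
  qed
  obtain w1 w2 where w: "{w. (v0, w) \<in> D} = {w1, w2}" "w1 \<noteq> w2"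
    using out_in_card(1)[OF v0] by (auto simp: card_2_iff)
  have wD: "(v0, w1) \<in> D" "(v0, w2) \<in> D" using w by blast+
  obtain a where a: "a \<in> P" "w1 = a v0" using reach D_verts(2)[OF wD(1)] by blast
  obtain b where b: "b \<in> P" "w2 = b v0" using reach D_verts(2)[OF wD(2)] by blast
  have ab: "a \<noteq> b" using w a b by blast
  have ac: "a \<in> carrier A" and bc: "b \<in> carrier A" using a b by auto
  have out: "q \<in> {a, b}" if "q \<in> P" "(v0, q v0) \<in> D" for q
  proof -
    have "q v0 \<in> {a v0, b v0}" using w that(2) a b by blast
    then show ?thesis using injP that(1) a b by blast
  qed
  \<comment> \<open>The images of \<open>v0\<close> under \<open>\<langle>a, b\<rangle>\<close> are closed under adjacency. The out-neighbours of
    \<open>g v0\<close> are \<open>g a v0\<close> and \<open>g b v0\<close>, its in-neighbours are obtained from the inverses of \<open>a\<close>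
    and \<open>b\<close>.\<close>
  have gen: "generate A {a, b} = P"
  proof -
    let ?K = "generate A {a, b}"
    have K: "subgroup ?K A" using ac bc by (intro Aut.generate_is_subgroup) auto
    interpret K: subgroup ?K A by (rule K)
    have KP: "?K \<subseteq> P" using a b by (intro Aut.generate_subgroup_incl P) auto
    have abK: "q \<in> {a, b} \<Longrightarrow> q \<in> ?K" for q by (rule generate.incl)
    have "(\<lambda>g. g v0) ` ?K = V"
    proof (rule arc_closed_set_eq_verts)
      show "(\<lambda>g. g v0) ` ?K \<subseteq> V" by (intro image_subsetI Aut_vertex[OF K.mem_carrier v0])
      show "(\<lambda>g. g v0) ` ?K \<noteq> {}" using K.one_closed by blast
      fix u w assume "u \<in> (\<lambda>g. g v0) ` ?K" and uw: "(u, w) \<in> parcs \<Gamma>"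
      then obtain g where g: "g \<in> ?K" "u = g v0" by blast
      have gc: "g \<in> carrier A" using g by simp
      have wV: "w \<in> V" using uw wellformed' by blast
      obtain q where q: "q \<in> P" "(inv\<^bsub>A\<^esub> g) w = q v0"
        using reach[OF Aut_vertex[OF Aut.inv_closed[OF gc] wV]] by blast
      have qc: "q \<in> carrier A" using q by simp
      have w_eq: "w = g (q v0)" unfolding q(2)[symmetric] using gc wV by (simp add: Aut_inv_apply)
      have qV: "q v0 \<in> V" by (rule Aut_vertex[OF qc v0])
      consider "(v0, q v0) \<in> D" | "(q v0, v0) \<in> D"
        using uw D_iff D_inv_iff[OF gc] v0 qV unfolding g(2) w_eq by blast
      then have "q \<in> ?K"
      proof cases
        case 1
        then show ?thesis using out q abK by blast
      next
        case 2
        have "((inv\<^bsub>A\<^esub> q) (q v0), (inv\<^bsub>A\<^esub> q) v0) \<in> D" by (rule D_inv[OF _ 2]) (use qc in simp)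
        then have "(v0, (inv\<^bsub>A\<^esub> q) v0) \<in> D" using qc v0 by (simp only: Aut_inv_apply)
        then have "inv\<^bsub>A\<^esub> q \<in> ?K" using out[of "inv\<^bsub>A\<^esub> q"] q abK by blast
        then have "inv\<^bsub>A\<^esub> (inv\<^bsub>A\<^esub> q) \<in> ?K" by (rule K.m_inv_closed)
        then show ?thesis using qc by simp
      qed
      then have "g \<otimes>\<^bsub>A\<^esub> q \<in> ?K" using g by simp
      moreover have "w = (g \<otimes>\<^bsub>A\<^esub> q) v0" unfolding w_eq using mult[OF gc qc v0] by simp
      ultimately show "w \<in> (\<lambda>g. g v0) ` ?K" by blast
    qed
    note VK = this
    have "q \<in> ?K" if "q \<in> P" for q
    proof -
      have "q v0 \<in> (\<lambda>g. g v0) ` ?K"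
        unfolding VK by (rule Aut_vertex[OF P.mem_carrier[OF that] v0])
      then obtain g where g: "g \<in> ?K" "q v0 = g v0" by blast
      have "g \<in> P" using g(1) KP by blast
      then have "q = g" using injP[of q g] that g(2) by blast
      then show ?thesis using g by simp
    qed
    then show ?thesis using KP by blast
  qed
  obtain s where s: "s \<in> carrier A" "s v0 = v0" "s (a v0) = b v0"
    using D_trans[OF wD] a b by blast
  have sT: "s \<in> T" using T_I s by blast
  define t where "t = inv\<^bsub>A\<^esub> b \<otimes>\<^bsub>A\<^esub> (s \<otimes>\<^bsub>A\<^esub> a)"
  have tc: "t \<in> carrier A" using s ac bc by (simp add: t_def)
  have bt: "s \<otimes>\<^bsub>A\<^esub> a = b \<otimes>\<^bsub>A\<^esub> t" using s ac bc by (simp add: t_def Aut.inv_mult_cancel)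
  have "t v0 = (inv\<^bsub>A\<^esub> b) (b v0)" unfolding t_def using s ac bc v0 by (simp add: mult)
  then have "t v0 = v0" using bc v0 by (simp add: Aut_inv_apply)
  then have tT: "t \<in> T" using T_I tc by blast
  have swap: "inv\<^bsub>A\<^esub> r \<otimes>\<^bsub>A\<^esub> a \<otimes>\<^bsub>A\<^esub> r = b \<and> inv\<^bsub>A\<^esub> r \<otimes>\<^bsub>A\<^esub> b \<otimes>\<^bsub>A\<^esub> r = a"
    if r: "r \<in> T" and norm: "\<And>q. q \<in> P \<Longrightarrow> inv\<^bsub>A\<^esub> r \<otimes>\<^bsub>A\<^esub> q \<otimes>\<^bsub>A\<^esub> r \<in> P" and r1: "r \<noteq> \<one>\<^bsub>A\<^esub>" for r
  proof -
    have rc: "r \<in> carrier A" and rv: "r v0 = v0" using r T_D by auto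
    have rv': "(inv\<^bsub>A\<^esub> r) v0 = v0" using r T_D by simp
    have im: "inv\<^bsub>A\<^esub> r \<otimes>\<^bsub>A\<^esub> q \<otimes>\<^bsub>A\<^esub> r \<in> {a, b}" if q: "q \<in> {a, b}" for q
    proof (rule out)
      have qP: "q \<in> P" using q a b by blast
      then show "inv\<^bsub>A\<^esub> r \<otimes>\<^bsub>A\<^esub> q \<otimes>\<^bsub>A\<^esub> r \<in> P" by (rule norm)
      have "(v0, q v0) \<in> D" using q wD a b by blast
      then have "((inv\<^bsub>A\<^esub> r) v0, (inv\<^bsub>A\<^esub> r) (q v0)) \<in> D" by (rule D_inv[OF Aut.inv_closed[OF rc]])
      moreover have "(inv\<^bsub>A\<^esub> r \<otimes>\<^bsub>A\<^esub> q \<otimes>\<^bsub>A\<^esub> r) v0 = (inv\<^bsub>A\<^esub> r) (q v0)"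
        using rc qP v0 by (simp add: mult rv)
      ultimately show "(v0, (inv\<^bsub>A\<^esub> r \<otimes>\<^bsub>A\<^esub> q \<otimes>\<^bsub>A\<^esub> r) v0) \<in> D" unfolding rv' by simp
    qed
    have inj: "q = q'" if "q \<in> carrier A" "q' \<in> carrier A"
      "inv\<^bsub>A\<^esub> r \<otimes>\<^bsub>A\<^esub> q \<otimes>\<^bsub>A\<^esub> r = inv\<^bsub>A\<^esub> r \<otimes>\<^bsub>A\<^esub> q' \<otimes>\<^bsub>A\<^esub> r" for q q'
      using that rc by simp
    \<comment> \<open>Otherwise \<open>r\<close> centralises \<open>a\<close> and \<open>b\<close>, hence \<open>P\<close>; as \<open>P\<close> is transitive and \<open>r\<close> fixes
    \<open>v0\<close>, it fixes every vertex.\<close>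
    have not_fixed: "inv\<^bsub>A\<^esub> r \<otimes>\<^bsub>A\<^esub> a \<otimes>\<^bsub>A\<^esub> r \<noteq> a"
    proof
      assume fa: "inv\<^bsub>A\<^esub> r \<otimes>\<^bsub>A\<^esub> a \<otimes>\<^bsub>A\<^esub> r = a"
      have fb: "inv\<^bsub>A\<^esub> r \<otimes>\<^bsub>A\<^esub> b \<otimes>\<^bsub>A\<^esub> r = b"
        using im[of b] inj[OF ac bc] fa ab by auto
      define Z where "Z = {g \<in> carrier A. r \<otimes>\<^bsub>A\<^esub> g = g \<otimes>\<^bsub>A\<^esub> r}"
      have Z: "subgroup Z A"
      proof (rule Aut.subgroupI)
        show "Z \<noteq> {}" using rc by (auto simp: Z_def)
        fix g assume g: "g \<in> Z"
        then have gc: "g \<in> carrier A" and eq: "r \<otimes>\<^bsub>A\<^esub> g = g \<otimes>\<^bsub>A\<^esub> r" by (auto simp: Z_def)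
        have "inv\<^bsub>A\<^esub> g \<otimes>\<^bsub>A\<^esub> (r \<otimes>\<^bsub>A\<^esub> g) \<otimes>\<^bsub>A\<^esub> inv\<^bsub>A\<^esub> g = inv\<^bsub>A\<^esub> g \<otimes>\<^bsub>A\<^esub> (g \<otimes>\<^bsub>A\<^esub> r) \<otimes>\<^bsub>A\<^esub> inv\<^bsub>A\<^esub> g"
          using eq by simp
        then show "inv\<^bsub>A\<^esub> g \<in> Z" using gc rc by (simp add: Z_def Aut.m_assoc Aut.inv_mult_cancel)
      next
        fix g h assume "g \<in> Z" "h \<in> Z"
        then show "g \<otimes>\<^bsub>A\<^esub> h \<in> Z" using rc by (auto simp: Z_def Aut.m_assoc) (metis Aut.m_assoc)
      qed (auto simp: Z_def)
      have in_Z: "q \<in> Z" if q: "q \<in> carrier A" "inv\<^bsub>A\<^esub> r \<otimes>\<^bsub>A\<^esub> q \<otimes>\<^bsub>A\<^esub> r = q" for q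
      proof -
        have "r \<otimes>\<^bsub>A\<^esub> (inv\<^bsub>A\<^esub> r \<otimes>\<^bsub>A\<^esub> q \<otimes>\<^bsub>A\<^esub> r) = r \<otimes>\<^bsub>A\<^esub> q" using q by simp
        then have "q \<otimes>\<^bsub>A\<^esub> r = r \<otimes>\<^bsub>A\<^esub> q" using q(1) rc by (simp add: Aut.m_assoc Aut.inv_mult_cancel)
        then show ?thesis using q by (simp add: Z_def)
      qed
      have "P \<subseteq> Z" unfolding gen[symmetric]
        using in_Z ac bc fa fb by (intro Aut.generate_subgroup_incl Z) auto
      have "r v = \<one>\<^bsub>A\<^esub> v" if v: "v \<in> V" for v
      proof -
        obtain q where q: "q \<in> P" "v = q v0" using reach[OF v] by blast
        then have "r \<otimes>\<^bsub>A\<^esub> q = q \<otimes>\<^bsub>A\<^esub> r" using \<open>P \<subseteq> Z\<close> by (auto simp: Z_def)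
        then have "r (q v0) = q (r v0)" using mult[OF rc P.mem_carrier[OF q(1)] v0] mult[OF P.mem_carrier[OF q(1)] rc v0] by simp
        then show ?thesis using q rv v by (simp add: Aut_one_apply)
      qed
      then have "r = \<one>\<^bsub>A\<^esub>" by (intro Aut_eqI[OF rc]) auto
      then show False using r1 by blast
    qed
    then have fab: "inv\<^bsub>A\<^esub> r \<otimes>\<^bsub>A\<^esub> a \<otimes>\<^bsub>A\<^esub> r = b" using im[of a] by blast
    moreover have "inv\<^bsub>A\<^esub> r \<otimes>\<^bsub>A\<^esub> b \<otimes>\<^bsub>A\<^esub> r = a" using im[of b] inj[OF ac bc] fab ab by auto
    ultimately show ?thesis by blast
  qed
  obtain d c where dc: "d \<in> P" "c \<in> P" "generate A {d} \<lhd> A\<lparr>carrier := P\<rparr>"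
    "generate A {d} \<inter> generate A {c} = {\<one>\<^bsub>A\<^esub>}" "generate A {d} <#>\<^bsub>A\<^esub> generate A {c} = P"
    by (rule Aut.exact_factorisation_split[OF finA T P TP prod p cardP xy coprime a(1) b(1) gen sT tT bt swap])
  show ?thesis
    by (rule split_regular_imp_metacirculant[OF pair_finite_verts P v0 reg dc])
qed

end

theorem theorem7p2:
  fixes \<Gamma> :: "'a pair_pre_digraph" and p n :: nat
  assumes "pair_graph \<Gamma>"
    and "Digraph_Component.connected (with_proj \<Gamma>)"
    and "\<forall>v\<in>pverts \<Gamma>. out_degree (with_proj \<Gamma>) v = 4"
    and "half_arc_transitive \<Gamma>"
    and "prime p" and "odd p" and "0 < n"
    and "card (pverts \<Gamma>) = p ^ n"
  shows "weak_metacirculant \<Gamma> \<longleftrightarrow> metacirculant \<Gamma>"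
proof
  assume weak: "weak_metacirculant \<Gamma>"
  interpret tetravalent_half_arc_transitive \<Gamma>
    using assms(1-4) by (auto simp: tetravalent_half_arc_transitive_def tetravalent_half_arc_transitive_axioms_def)
  obtain D where "half_arc_orientation \<Gamma> D" using orientation_exists by blast
  then interpret half_arc_orientation \<Gamma> D .
  show "metacirculant \<Gamma>" by (rule weak_imp_metacirculant[OF weak assms(5,6,8)])
qed (rule metacirculant_imp_weak_metacirculant)

end
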